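(* Let $f,g$ satisfy Assumption (CPSO) and let $(x^*,u^* )\in\mathcal M\times\Omega$ be a point at which (RPD-i), (RPD-ii) and (ND) hold. Let $\alpha\in[\underline\alpha,\overline\alpha]$ and $\beta\in[0,1]$ be such that $-\frac1{1+2\beta}<\lambda_{\min}(D_x\mathcal A_\alpha(x^*,u^* ))$. Let $\psi:U\to\mathcal M$ be the local solution map around $u^*$ (with $U$ possibly reduced), let $u\in U$, and let $x\in\mathcal M$ be sufficiently close to $\psi(u)$. Then, for $\dot u\in\mathcal U$, the sequence $(\hat z^{(k)})_{k\in\mathbb N}$ generated by $$\hat z^{(k+1)}=D_z\mathcal A_{\alpha,\beta}(x,x,u)\,\hat z^{(k)}+D_u\mathcal A_{\alpha,\beta}(x,x,u)\,\dot u,\qquad k\ge0,$$ converges linearly to $\varphi_{\alpha,\beta}(x,x,u)\,\dot u$, where $$\varphi_{\alpha,\beta}(x,x,u):=\big(I-D_z\mathcal A_{\alpha,\beta}(x,x,u)\,\Pi(x,x)\big)^{-1}D_u\mathcal A_{\alpha,\beta}(x,x,u),$$ with rate $\rho\big(D_z\mathcal A_{\alpha,\beta}(x,x,u)\,\Pi(x,x)\big)$.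
   Context: $\mathcal X,\mathcal U$ are finite-dimensional Euclidean spaces, $\mathcal M\subset\mathcal X$ is a $C^2$-smooth embedded submanifold, $\Omega\subset\mathcal U$ is open. $T_x\mathcal M$, $N_x\mathcal M=(T_x\mathcal M)^\perp$ are the tangent and normal spaces, $\Pi(x)$, $\Pi^\perp(x)$ the orthogonal projections onto them; $\Pi(x_1,x_2):=\mathrm{diag}(\Pi(x_1),\Pi(x_2))$ is the orthogonal projection onto $T_{x_1}\mathcal M\times T_{x_2}\mathcal M$ for $x_1,x_2\in\mathcal M$. A linear operator defined on a subspace is extended to the whole space by composing it with the orthogonal projection onto that subspace; $\dagger$ is the pseudoinverse; $\rho(\cdot)$ is the spectral radius; $\lambda_{\min}$ is the smallest eigenvalue. Linear convergence with rate $\rho$ is meant in the sense that for each $\delta\in(0,1-\rho)$ there is $C(\delta)$ such that the distance to the limit is at most $C(\delta)(\rho+\delta)^k$ for all $k\in\mathbb N$. Riemannian derivatives: for a function $h$ whose restriction to $\mathcal M$ is $C^2$ with $C^2$ extension $\tilde h$ near $x\in\mathcal M$, $\nabla_{\mathcal M}h(x)=\Pi(x)\nabla\tilde h(x)$ and $\nabla^2_{\mathcal M}h(x)=\Pi(x)\nabla^2\tilde h(x)+\mathfrak W_x(\cdot,\Pi^\perp(x)\nabla\tilde h(x))$ on $T_x\mathcal M$, where for $w\in N_x\mathcal M$ the Weingarten map $\mathfrak W_x(\cdot,w):T_x\mathcal M\to T_x\mathcal M$ is $v\mapsto-\Pi(x)\,\mathrm dW[v]$ with $W$ any local extension of $w$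 to a normal vector field on $\mathcal M$. For $h(x,u)$, $\nabla_{\mathcal M}h,\nabla^2_{\mathcal M}h$ are taken in $x$ with $u$ fixed, and $D_u$ is the partial derivative in $u$. Partial smoothness: a proper lower semicontinuous $h$ is partly smooth at $x\in\mathcal M$ relative to $\mathcal M$ if $h$ is regular (in the sense of Rockafellar–Wets) at all points near $x$ and $\partial h(x)\ne\emptyset$; $\mathcal M$ is a $C^2$ manifold and $h|_{\mathcal M}$ is $C^2$ around $x$; $N_x\mathcal M=\mathrm{par}\,\partial h(x)$ (subspace parallel to the affine hull); and $\partial h$ is continuous at $x$ relative to $\mathcal M$. It is partly smooth relative to $\mathcal M$ if this holds at every $x\in\mathcal M$. Assumption (CPSO): $f:\mathcal X\times\mathcal U\to\mathbb R$ is $C^2$; $g:\mathcal X\times\mathcal U\to\overline{\mathbb R}$ is partly smooth relative to $\mathcal M\times\Omega$; for each $u\in\Omega$, $f(\cdot,u)$ and $g(\cdot,u)$ are convex and $\nabla_xf(\cdot,u)$ is $L$-Lipschitz. $F:=f+g$; $\partial_x$ is the convex subdifferential in $x$. Conditions at a point $(x^*,u^* )\in\mathcal M\times\Omega$: (RPD-i) $\nabla^2_{\mathcal M}F(x^*,u^* )$ is positive definite on $T_{x^*}\mathcal M$; (RPD-ii) $\Pi(x^* )\nabla_x^2f(x^*,u^* )|_{T_{x^*}\mathcal M}$ is positive definite on $T_{x^*}\mathcal M$; (ND) $0\in\mathrm{ri}\,\partial_xF(x^*,u^* )$. Local solution map (known fact): if (CPSO) holds and (RPD-i), (ND) hold at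 $(x^*,u^* )$, there are an open neighbourhood $U\subset\Omega$ of $u^*$ and a $C^1$ map $\psi:U\to\mathcal M$ with $\psi(u^* )=x^*$ such that for all $u\in U$: $\psi(u)$ is the unique minimizer of $F(\cdot,u)|_{\mathcal M}$, (ND) and (RPD-i) hold at $(\psi(u),u)$, and $D\psi(u)=-\nabla^2_{\mathcal M}F(\psi(u),u)^\dagger D_u\nabla_{\mathcal M}F(\psi(u),u)$. Update maps: $0<\underline\alpha\le\overline\alpha<2/L$ are fixed; $P_{\alpha g}(w,u):=\arg\min_{x\in\mathcal X}\alpha g(x,u)+\tfrac12\|x-w\|^2$, $\mathcal A_\alpha(x,u):=P_{\alpha g}(x-\alpha\nabla_xf(x,u),u)$, and $\mathcal A_{\alpha,\beta}(x_1,x_2,u):=\big(\mathcal A_\alpha(x_1+\beta(x_1-x_2),u),\,x_1\big)$, with $z=(x_1,x_2)$. (Under (CPSO) and (ND) at $(x^*,u^* )$, for $\alpha\in(0,2/L)$: $\mathcal A_\alpha$ is $C^1$ with values in $\mathcal M$ near $(x^*,u^* )$, and $\mathcal A_{\alpha,\beta}$ is $C^1$ near $(x^*,x^*,u^* )$.)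
   Formalization: In the recursion the derivative D_z A(x,x,u) is composed with Π(x,x), since with the unprojected derivative the claimed limit is false for x ≠ ψ(u) (e.g. M the unit circle, A_1(x,u)=u/|u|); for x = ψ(u) the recursion is also stated as printed. *)

theory Defs
  imports "HOL-Analysis.Analysis"
begin

section \<open>Differentiability classes, gradients and Hessians\<close>

text \<open>Both predicates are meant for open \<open>S\<close>.\<close>

definition C1_map_on :: "'a::real_normed_vector set \<Rightarrow> ('a \<Rightarrow> 'b::real_normed_vector) \<Rightarrow> bool" where
  "C1_map_on S h \<longleftrightarrow>
    (\<exists>h'. (\<forall>x\<in>S. (h has_derivative blinfun_apply (h' x)) (at x)) \<and> continuous_on S h')"

definition C2_map_on :: "'a::real_normed_vector set \<Rightarrow> ('a \<Rightarrow> 'b::real_normed_vector) \<Rightarrow> bool" where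
  "C2_map_on S h \<longleftrightarrow>
    (\<exists>h'. (\<forall>x\<in>S. (h has_derivative blinfun_apply (h' x)) (at x)) \<and> C1_map_on S h')"

definition grad :: "('a::euclidean_space \<Rightarrow> real) \<Rightarrow> 'a \<Rightarrow> 'a" where
  "grad h x = (THE D. GDERIV h x :> D)"

definition hess :: "('a::euclidean_space \<Rightarrow> real) \<Rightarrow> 'a \<Rightarrow> 'a \<Rightarrow> 'a" where
  "hess h x = frechet_derivative (grad h) (at x)"


section \<open>Linear operators\<close>

definition pos_def_on :: "'a::real_inner set \<Rightarrow> ('a \<Rightarrow> 'a) \<Rightarrow> bool" where
  "pos_def_on T A \<longleftrightarrow> (\<forall>v\<in>T. v \<noteq> 0 \<longrightarrow> v \<bullet> A v > 0)"

text \<open>The Moore--Penrose pseudoinverse, through the four Penrose equations.\<close>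

definition pinv :: "('a::euclidean_space \<Rightarrow> 'a) \<Rightarrow> 'a \<Rightarrow> 'a" where
  "pinv A = (THE P. linear P \<and> A \<circ> P \<circ> A = A \<and> P \<circ> A \<circ> P = P
              \<and> adjoint (A \<circ> P) = A \<circ> P \<and> adjoint (P \<circ> A) = P \<circ> A)"

definition lambda_min :: "('a::euclidean_space \<Rightarrow> 'a) \<Rightarrow> real" where
  "lambda_min A = Min {c. \<exists>v. v \<noteq> 0 \<and> A v = c *\<^sub>R v}"

text \<open>\<open>c\<close> is an eigenvalue of the complexification of \<open>A\<close>, with eigenvector \<open>v + \<i> w\<close>.\<close>

definition complex_eigenvalue :: "('a::euclidean_space \<Rightarrow> 'a) \<Rightarrow> complex \<Rightarrow> bool" where
  "complex_eigenvalue A c \<longleftrightarrow>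
    (\<exists>v w. (v \<noteq> 0 \<or> w \<noteq> 0) \<and> A v = Re c *\<^sub>R v - Im c *\<^sub>R w \<and> A w = Im c *\<^sub>R v + Re c *\<^sub>R w)"

definition spec_radius :: "('a::euclidean_space \<Rightarrow> 'a) \<Rightarrow> real" where
  "spec_radius A = Max (cmod ` {c. complex_eigenvalue A c})"

definition converges_linearly :: "(nat \<Rightarrow> 'a::metric_space) \<Rightarrow> 'a \<Rightarrow> real \<Rightarrow> bool" where
  "converges_linearly z l r \<longleftrightarrow> r < 1 \<and>
    (\<forall>d. 0 < d \<and> d < 1 - r \<longrightarrow> (\<exists>C. \<forall>k. dist (z k) l \<le> C * (r + d) ^ k))"


section \<open>Embedded submanifolds\<close>

text \<open>\<open>\<phi>\<close> is a \<open>C\<^sup>2\<close> diffeomorphism around \<open>x\<close> that flattens \<open>M\<close> to a subspace of dimension \<open>d\<close>.\<close>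

definition C2_manifold_around :: "nat \<Rightarrow> 'a::euclidean_space set \<Rightarrow> 'a \<Rightarrow> bool" where
  "C2_manifold_around d M x \<longleftrightarrow>
    (\<exists>V (\<phi>::'a \<Rightarrow> 'a) \<phi>i S. open V \<and> x \<in> V \<and> open (\<phi> ` V) \<and> homeomorphism V (\<phi> ` V) \<phi> \<phi>i
       \<and> C2_map_on V \<phi> \<and> C2_map_on (\<phi> ` V) \<phi>i
       \<and> subspace S \<and> dim S = d \<and> \<phi> ` (M \<inter> V) = \<phi> ` V \<inter> S)"

definition C2_submanifold :: "'a::euclidean_space set \<Rightarrow> bool" where
  "C2_submanifold M \<longleftrightarrow> (\<exists>d. \<forall>x\<in>M. C2_manifold_around d M x)"

definition tangent_space :: "'a::euclidean_space set \<Rightarrow> 'a \<Rightarrow> 'a set" where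
  "tangent_space M x =
    {v. \<exists>\<gamma> e. e > 0 \<and> \<gamma> C1_differentiable_on {-e<..<e} \<and> \<gamma> ` {-e<..<e} \<subseteq> M
          \<and> \<gamma> 0 = x \<and> (\<gamma> has_vector_derivative v) (at 0)}"

definition normal_space :: "'a::euclidean_space set \<Rightarrow> 'a \<Rightarrow> 'a set" where
  "normal_space M x = orthogonal_comp (tangent_space M x)"

text \<open>The nearest point of a linear subspace is the orthogonal projection onto it.\<close>

definition tproj :: "'a::euclidean_space set \<Rightarrow> 'a \<Rightarrow> 'a \<Rightarrow> 'a" where
  "tproj M x = closest_point (tangent_space M x)"

definition nproj :: "'a::euclidean_space set \<Rightarrow> 'a \<Rightarrow> 'a \<Rightarrow> 'a" where
  "nproj M x = closest_point (normal_space M x)"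

definition tproj2 :: "'a::euclidean_space set \<Rightarrow> 'a \<times> 'a \<Rightarrow> 'a \<times> 'a \<Rightarrow> 'a \<times> 'a" where
  "tproj2 M x v = (tproj M (fst x) (fst v), tproj M (snd x) (snd v))"


section \<open>Riemannian derivatives\<close>

definition C2_extension :: "'a::euclidean_space set \<Rightarrow> ('a \<Rightarrow> ereal) \<Rightarrow> 'a \<Rightarrow> ('a \<Rightarrow> real) \<Rightarrow> bool" where
  "C2_extension M h x k \<longleftrightarrow>
    (\<exists>V. open V \<and> x \<in> V \<and> C2_map_on V k \<and> (\<forall>y\<in>M \<inter> V. h y = ereal (k y)))"

definition C2_ext :: "'a::euclidean_space set \<Rightarrow> ('a \<Rightarrow> ereal) \<Rightarrow> 'a \<Rightarrow> 'a \<Rightarrow> real" where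
  "C2_ext M h x = (SOME k. C2_extension M h x k)"

definition normal_field_extension ::
    "'a::euclidean_space set \<Rightarrow> 'a \<Rightarrow> 'a \<Rightarrow> ('a \<Rightarrow> 'a) \<Rightarrow> bool" where
  "normal_field_extension M x w W \<longleftrightarrow>
    (\<exists>V. open V \<and> x \<in> V \<and> C1_map_on V W \<and> W x = w \<and> (\<forall>y\<in>M \<inter> V. W y \<in> normal_space M y))"

definition weingarten :: "'a::euclidean_space set \<Rightarrow> 'a \<Rightarrow> 'a \<Rightarrow> 'a \<Rightarrow> 'a" where
  "weingarten M x v w =
    - tproj M x (frechet_derivative (SOME W. normal_field_extension M x w W) (at x) v)"

definition riem_grad :: "'a::euclidean_space set \<Rightarrow> ('a \<Rightarrow> ereal) \<Rightarrow> 'a \<Rightarrow> 'a" where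
  "riem_grad M h x = tproj M x (grad (C2_ext M h x) x)"

text \<open>The Riemannian Hessian is an operator on the tangent space; it is extended to the whole
  space by precomposition with the orthogonal projection.\<close>

definition riem_hess :: "'a::euclidean_space set \<Rightarrow> ('a \<Rightarrow> ereal) \<Rightarrow> 'a \<Rightarrow> 'a \<Rightarrow> 'a" where
  "riem_hess M h x v =
    tproj M x (hess (C2_ext M h x) x (tproj M x v))
      + weingarten M x (tproj M x v) (nproj M x (grad (C2_ext M h x) x))"


section \<open>Variational analysis\<close>

definition epi :: "('a \<Rightarrow> ereal) \<Rightarrow> ('a \<times> real) set" where
  "epi h = {(y, r). h y \<le> ereal r}"

definition proper_fun :: "('a \<Rightarrow> ereal) \<Rightarrow> bool" where
  "proper_fun h \<longleftrightarrow> (\<forall>x. h x \<noteq> -\<infinity>) \<and> (\<exists>x. h x \<noteq> \<infinity>)"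

definition lsc_fun :: "('a::topological_space \<Rightarrow> ereal) \<Rightarrow> bool" where
  "lsc_fun h \<longleftrightarrow> (\<forall>x. h x \<le> Liminf (at x) h)"

definition convex_fun :: "('a::real_vector \<Rightarrow> ereal) \<Rightarrow> bool" where
  "convex_fun h \<longleftrightarrow> convex (epi h)"

definition convex_subdiff :: "('a::real_inner \<Rightarrow> ereal) \<Rightarrow> 'a \<Rightarrow> 'a set" where
  "convex_subdiff h x = {v. \<bar>h x\<bar> \<noteq> \<infinity> \<and> (\<forall>y. h x + ereal (v \<bullet> (y - x)) \<le> h y)}"

text \<open>Regular and general (limiting) normals and subgradients, and (Clarke) regularity of sets and
  functions, in the sense of Rockafellar and Wets. Regularity of a function at a point includes
  that it is finite there.\<close>

definition regular_normals :: "'a::real_inner set \<Rightarrow> 'a \<Rightarrow> 'a set" where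
  "regular_normals C x =
    {v. \<forall>e>0. \<exists>d>0. \<forall>y\<in>C. dist y x < d \<longrightarrow> v \<bullet> (y - x) \<le> e * norm (y - x)}"

definition general_normals :: "'a::real_inner set \<Rightarrow> 'a \<Rightarrow> 'a set" where
  "general_normals C x =
    {v. \<exists>xs vs. (\<forall>n. xs n \<in> C \<and> vs n \<in> regular_normals C (xs n))
          \<and> xs \<longlonglongrightarrow> x \<and> vs \<longlonglongrightarrow> v}"

definition regular_set_at :: "'a::real_inner set \<Rightarrow> 'a \<Rightarrow> bool" where
  "regular_set_at C x \<longleftrightarrow>
    x \<in> C \<and> (\<exists>e>0. closed (C \<inter> cball x e)) \<and> general_normals C x = regular_normals C x"

definition regular_fun_at :: "('a::real_inner \<Rightarrow> ereal) \<Rightarrow> 'a \<Rightarrow> bool" where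
  "regular_fun_at h x \<longleftrightarrow> \<bar>h x\<bar> \<noteq> \<infinity> \<and> regular_set_at (epi h) (x, real_of_ereal (h x))"

definition regular_subdiff :: "('a::real_inner \<Rightarrow> ereal) \<Rightarrow> 'a \<Rightarrow> 'a set" where
  "regular_subdiff h x =
    {v. \<bar>h x\<bar> \<noteq> \<infinity> \<and>
        (\<forall>e>0. \<exists>d>0. \<forall>y. dist y x < d \<longrightarrow>
            h x + ereal (v \<bullet> (y - x) - e * norm (y - x)) \<le> h y)}"

definition subdiff :: "('a::real_inner \<Rightarrow> ereal) \<Rightarrow> 'a \<Rightarrow> 'a set" where
  "subdiff h x =
    {v. \<bar>h x\<bar> \<noteq> \<infinity> \<and>
        (\<exists>xs vs. (\<forall>n. vs n \<in> regular_subdiff h (xs n))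
            \<and> xs \<longlonglongrightarrow> x \<and> (\<lambda>n. h (xs n)) \<longlonglongrightarrow> h x \<and> vs \<longlonglongrightarrow> v)}"

definition par :: "'a::euclidean_space set \<Rightarrow> 'a set" where
  "par A = (THE L. subspace L \<and> affine_parallel (affine hull A) L)"

text \<open>Painleve--Kuratowski continuity: outer and inner semicontinuity at \<open>x\<close> relative to \<open>M\<close>.\<close>

definition setmap_continuous_at ::
    "('a::metric_space \<Rightarrow> 'b::metric_space set) \<Rightarrow> 'a set \<Rightarrow> 'a \<Rightarrow> bool" where
  "setmap_continuous_at S M x \<longleftrightarrow>
    (\<forall>xs. (\<forall>n. xs n \<in> M) \<and> xs \<longlonglongrightarrow> x \<longrightarrow>
       (\<forall>vs v. (\<forall>n. vs n \<in> S (xs n)) \<and> vs \<longlonglongrightarrow> v \<longrightarrow> v \<in> S x) \<and>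
       (\<forall>v\<in>S x. \<exists>vs. (\<forall>\<^sub>F n in sequentially. vs n \<in> S (xs n)) \<and> vs \<longlonglongrightarrow> v))"

text \<open>Regularity is only meaningful where \<open>h\<close> is finite, so ``at all points near \<open>x\<close>'' ranges over
  the points of the domain of \<open>h\<close> near \<open>x\<close>.\<close>

definition partly_smooth_at :: "('a::euclidean_space \<Rightarrow> ereal) \<Rightarrow> 'a set \<Rightarrow> 'a \<Rightarrow> bool" where
  "partly_smooth_at h M x \<longleftrightarrow>
     (\<forall>\<^sub>F y in nhds x. h y \<noteq> \<infinity> \<longrightarrow> regular_fun_at h y) \<and> subdiff h x \<noteq> {}
   \<and> (\<exists>d. C2_manifold_around d M x) \<and> (\<exists>k. C2_extension M h x k)
   \<and> normal_space M x = par (subdiff h x)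
   \<and> setmap_continuous_at (subdiff h) M x"

definition partly_smooth :: "('a::euclidean_space \<Rightarrow> ereal) \<Rightarrow> 'a set \<Rightarrow> bool" where
  "partly_smooth h M \<longleftrightarrow> proper_fun h \<and> lsc_fun h \<and> (\<forall>x\<in>M. partly_smooth_at h M x)"


section \<open>The parametric problem\<close>

definition CPSO ::
    "('x::euclidean_space \<times> 'u::euclidean_space \<Rightarrow> real) \<Rightarrow> ('x \<times> 'u \<Rightarrow> ereal)
      \<Rightarrow> 'x set \<Rightarrow> 'u set \<Rightarrow> real \<Rightarrow> bool" where
  "CPSO f g M \<Omega> L \<longleftrightarrow>
     C2_map_on UNIV f \<and> partly_smooth g (M \<times> \<Omega>)
   \<and> (\<forall>u\<in>\<Omega>. convex_on UNIV (\<lambda>x. f (x, u)) \<and> convex_fun (\<lambda>x. g (x, u))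
          \<and> L-lipschitz_on UNIV (grad (\<lambda>x. f (x, u))))"

definition objective :: "('x \<times> 'u \<Rightarrow> real) \<Rightarrow> ('x \<times> 'u \<Rightarrow> ereal) \<Rightarrow> 'u \<Rightarrow> 'x \<Rightarrow> ereal" where
  "objective f g u x = ereal (f (x, u)) + g (x, u)"

definition RPD_i ::
    "('x::euclidean_space \<times> 'u \<Rightarrow> real) \<Rightarrow> ('x \<times> 'u \<Rightarrow> ereal) \<Rightarrow> 'x set \<Rightarrow> 'x \<Rightarrow> 'u \<Rightarrow> bool" where
  "RPD_i f g M x u \<longleftrightarrow> pos_def_on (tangent_space M x) (riem_hess M (objective f g u) x)"

definition RPD_ii ::
    "('x::euclidean_space \<times> 'u \<Rightarrow> real) \<Rightarrow> 'x set \<Rightarrow> 'x \<Rightarrow> 'u \<Rightarrow> bool" where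
  "RPD_ii f M x u \<longleftrightarrow>
    pos_def_on (tangent_space M x) (\<lambda>v. tproj M x (hess (\<lambda>y. f (y, u)) x v))"

definition ND ::
    "('x::euclidean_space \<times> 'u \<Rightarrow> real) \<Rightarrow> ('x \<times> 'u \<Rightarrow> ereal) \<Rightarrow> 'x \<Rightarrow> 'u \<Rightarrow> bool" where
  "ND f g x u \<longleftrightarrow> 0 \<in> rel_interior (convex_subdiff (objective f g u) x)"

definition local_solution_map ::
    "('x::euclidean_space \<times> 'u::euclidean_space \<Rightarrow> real) \<Rightarrow> ('x \<times> 'u \<Rightarrow> ereal)
      \<Rightarrow> 'x set \<Rightarrow> 'u set \<Rightarrow> 'x \<Rightarrow> 'u \<Rightarrow> 'u set \<Rightarrow> ('u \<Rightarrow> 'x) \<Rightarrow> bool" where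
  "local_solution_map f g M \<Omega> xs us U \<psi> \<longleftrightarrow>
     open U \<and> us \<in> U \<and> U \<subseteq> \<Omega> \<and> C1_map_on U \<psi> \<and> \<psi> ` U \<subseteq> M \<and> \<psi> us = xs
   \<and> (\<forall>u\<in>U.
        (\<forall>y. is_arg_min (objective f g u) (\<lambda>x. x \<in> M) y \<longleftrightarrow> y = \<psi> u)
      \<and> ND f g (\<psi> u) u \<and> RPD_i f g M (\<psi> u) u
      \<and> (\<psi> has_derivative
           (\<lambda>du. - pinv (riem_hess M (objective f g u) (\<psi> u))
                    (frechet_derivative (\<lambda>u'. riem_grad M (objective f g u') (\<psi> u)) (at u) du)))
          (at u))"


section \<open>Proximal gradient updates\<close>

definition prox ::
    "('x::euclidean_space \<times> 'u \<Rightarrow> ereal) \<Rightarrow> real \<Rightarrow> 'x \<Rightarrow> 'u \<Rightarrow> 'x" where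
  "prox g \<alpha> w u =
    arg_min (\<lambda>x. ereal \<alpha> * g (x, u) + ereal (1 / 2 * (norm (x - w))\<^sup>2)) (\<lambda>_. True)"

definition pgd ::
    "('x::euclidean_space \<times> 'u \<Rightarrow> real) \<Rightarrow> ('x \<times> 'u \<Rightarrow> ereal) \<Rightarrow> real \<Rightarrow> 'x \<Rightarrow> 'u \<Rightarrow> 'x" where
  "pgd f g \<alpha> x u = prox g \<alpha> (x - \<alpha> *\<^sub>R grad (\<lambda>y. f (y, u)) x) u"

definition apgd ::
    "('x::euclidean_space \<times> 'u \<Rightarrow> real) \<Rightarrow> ('x \<times> 'u \<Rightarrow> ereal) \<Rightarrow> real \<Rightarrow> real
      \<Rightarrow> 'x \<times> 'x \<Rightarrow> 'u \<Rightarrow> 'x \<times> 'x" where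
  "apgd f g \<alpha> \<beta> z u = (pgd f g \<alpha> (fst z + \<beta> *\<^sub>R (fst z - snd z)) u, fst z)"

definition Dx_pgd ::
    "('x::euclidean_space \<times> 'u \<Rightarrow> real) \<Rightarrow> ('x \<times> 'u \<Rightarrow> ereal) \<Rightarrow> real \<Rightarrow> 'x \<Rightarrow> 'u \<Rightarrow> 'x \<Rightarrow> 'x" where
  "Dx_pgd f g \<alpha> x u = frechet_derivative (\<lambda>x. pgd f g \<alpha> x u) (at x)"

definition Dz_apgd ::
    "('x::euclidean_space \<times> 'u \<Rightarrow> real) \<Rightarrow> ('x \<times> 'u \<Rightarrow> ereal) \<Rightarrow> real \<Rightarrow> real
      \<Rightarrow> 'x \<times> 'x \<Rightarrow> 'u \<Rightarrow> 'x \<times> 'x \<Rightarrow> 'x \<times> 'x" where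
  "Dz_apgd f g \<alpha> \<beta> z u = frechet_derivative (\<lambda>z. apgd f g \<alpha> \<beta> z u) (at z)"

definition Du_apgd ::
    "('x::euclidean_space \<times> 'u::euclidean_space \<Rightarrow> real) \<Rightarrow> ('x \<times> 'u \<Rightarrow> ereal) \<Rightarrow> real \<Rightarrow> real
      \<Rightarrow> 'x \<times> 'x \<Rightarrow> 'u \<Rightarrow> 'u \<Rightarrow> 'x \<times> 'x" where
  "Du_apgd f g \<alpha> \<beta> z u = frechet_derivative (\<lambda>u. apgd f g \<alpha> \<beta> z u) (at u)"

text \<open>\<open>D\<^sub>z\<A>\<^sub>\<alpha>\<^sub>,\<^sub>\<beta>(z,u)\<close> as an operator on the tangent space of \<open>M \<times> M\<close> at \<open>z\<close>, extended to the
  whole space by the orthogonal projection. For \<open>z = (x, x)\<close> with \<open>x \<noteq> \<psi>(u)\<close> the range of the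
  ambient derivative need not lie in this tangent space, and the recursion driven by the ambient
  derivative then has in general a limit other than \<open>\<phi>\<close>.\<close>

definition Dz_tangent ::
    "('x::euclidean_space \<times> 'u \<Rightarrow> real) \<Rightarrow> ('x \<times> 'u \<Rightarrow> ereal) \<Rightarrow> 'x set \<Rightarrow> real \<Rightarrow> real
      \<Rightarrow> 'x \<times> 'x \<Rightarrow> 'u \<Rightarrow> 'x \<times> 'x \<Rightarrow> 'x \<times> 'x" where
  "Dz_tangent f g M \<alpha> \<beta> z u = Dz_apgd f g \<alpha> \<beta> z u \<circ> tproj2 M z"

definition phi ::
    "('x::euclidean_space \<times> 'u::euclidean_space \<Rightarrow> real) \<Rightarrow> ('x \<times> 'u \<Rightarrow> ereal) \<Rightarrow> 'x set
      \<Rightarrow> real \<Rightarrow> real \<Rightarrow> 'x \<times> 'x \<Rightarrow> 'u \<Rightarrow> 'u \<Rightarrow> 'x \<times> 'x" where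
  "phi f g M \<alpha> \<beta> z u =
    inv (\<lambda>v. v - Dz_apgd f g \<alpha> \<beta> z u (tproj2 M z v)) \<circ> Du_apgd f g \<alpha> \<beta> z u"

end

theory Submission
  imports Defs "HOL-Computational_Algebra.Fundamental_Theorem_Algebra"
begin

text \<open>Solving the optimality condition of the proximal subproblem along \<open>M\<close> with the implicit function
  theorem gives a \<open>C\<^sup>1\<close> candidate for the proximal map; partial smoothness and nondegeneracy force the
  residual of the candidate into \<open>\<partial>\<^sub>xg\<close>, so that it is the proximal map. Hence \<open>\<A>\<^sub>\<alpha>\<close> is \<open>C\<^sup>1\<close> with values
  in \<open>M\<close> near \<open>(x\<^sup>*, u\<^sup>*)\<close>. Differentiating the optimality condition shows that \<open>D\<^sub>x\<A>\<^sub>\<alpha>(x\<^sup>*, u\<^sup>*)\<close> is similar to a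
  symmetric operator with spectrum in \<open>(-1, 1)\<close>, and the lower bound on \<open>\<lambda>\<^sub>m\<^sub>i\<^sub>n\<close> is the Schur--Cohn condition
  that keeps the momentum update contractive. Eigenvalues of modulus at least \<open>1\<close> at points of \<open>M\<close> close to
  the base point would accumulate there, so the spectral radius stays below \<open>1\<close> nearby, and a linear
  recursion then converges at any rate above it.\<close>

section \<open>Spectra of real operators\<close>

text \<open>Partial smoothness concerns \<open>g\<close> jointly in \<open>(x, u)\<close>, whereas
  the proximal map sees only the subdifferential of \<open>g\<close> in \<open>x\<close>. The two
  are reconciled by regularity of the epigraph and by the fact that normal vectors of
  \<open>M \<times> \<Omega>\<close> have no \<open>u\<close> part: the \<open>u\<close> part of a
  joint subgradient over \<open>M \<times> \<Omega>\<close> is dictated by a smooth extension of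
  \<open>g\<close>, and every partial subgradient at the base point lifts to a joint one. The
  derivative of the step is not symmetric itself. Convexity of \<open>g\<close> enters through a
  nonnegative Hessian along \<open>M\<close>; (RPD-ii) keeps the eigenvalues below 1 and
  \<open>\<alpha> * L < 2\<close> keeps them above -1. For \<open>x\<close> off the solution curve
  the derivative of the step maps into the tangent space at the image of \<open>x\<close>, not at
  \<open>x\<close>, so there is no invariant subspace to restrict to. All operators are therefore
  composed with the projection and studied on the whole space, and the base point is reached in the
  limit through convergence of the projections. On the curve the image of \<open>x\<close> is
  \<open>x\<close>, and the unprojected recursion enters the tangent space after two steps.\<close>

text \<open>\<open>'a \<times> 'a\<close> plays the role of the complexification of \<open>'a\<close>: \<open>(v, w)\<close> stands for \<open>v + \<i> w\<close>.\<close>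

definition cscale :: "complex \<Rightarrow> 'a::real_vector \<times> 'a \<Rightarrow> 'a \<times> 'a" where
  "cscale c p = (Re c *\<^sub>R fst p - Im c *\<^sub>R snd p, Im c *\<^sub>R fst p + Re c *\<^sub>R snd p)"

definition complexify :: "('a \<Rightarrow> 'a) \<Rightarrow> 'a \<times> 'a \<Rightarrow> 'a \<times> 'a" where
  "complexify A p = (A (fst p), A (snd p))"

lemma complex_eigenvalue_iff:
  fixes A :: "'a::euclidean_space \<Rightarrow> 'a"
  shows "complex_eigenvalue A c \<longleftrightarrow> (\<exists>p. p \<noteq> 0 \<and> complexify A p = cscale c p)"
  unfolding complex_eigenvalue_def complexify_def cscale_def
  by (auto simp: prod_eq_iff)

lemma cscale_simps [simp]:
  "cscale c 0 = 0" "cscale 0 p = 0" "cscale 1 p = p"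
  "cscale c (cscale d p) = cscale (c * d) p"
  by (auto simp: cscale_def prod_eq_iff algebra_simps)

lemma cscale_add_right: "cscale c (p + q) = cscale c p + cscale c q"
  by (auto simp: cscale_def prod_eq_iff algebra_simps)

lemma cscale_add_left: "cscale (c + d) p = cscale c p + cscale d p"
  by (auto simp: cscale_def prod_eq_iff algebra_simps)

lemma linear_cscale: "linear (cscale c)"
  by (rule linearI) (auto simp: cscale_def prod_eq_iff algebra_simps)

lemma norm_cscale:
  fixes p :: "'a::real_inner \<times> 'a"
  shows "norm (cscale c p) = cmod c * norm p"
proof -
  obtain v w where p: "p = (v, w)" by (cases p)
  have "(norm (cscale c p))\<^sup>2 = (cmod c * norm p)\<^sup>2"
    unfolding p cscale_def power_mult_distrib cmod_power2 power2_norm_eq_inner inner_prod_def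
    by (simp add: inner_add_left inner_add_right inner_diff_left
        inner_diff_right inner_commute) (simp add: algebra_simps power2_eq_square)
  then show ?thesis by (metis norm_ge_zero power2_eq_iff_nonneg zero_le_mult_iff)
qed

lemma cscale_eq_0_iff [simp]:
  fixes p :: "'a::real_inner \<times> 'a"
  shows "cscale c p = 0 \<longleftrightarrow> c = 0 \<or> p = 0"
  using norm_cscale[of c p] by (metis mult_eq_0_iff norm_eq_zero)

lemma linear_complexify:
  assumes "linear A" shows "linear (complexify A)"
  using assms by (intro linearI) (auto simp: complexify_def linear_add linear_cmul)

lemma complexify_cscale:
  assumes "linear A"
  shows "complexify A (cscale c p) = cscale c (complexify A p)"
  using assms by (simp add: complexify_def cscale_def linear_add linear_cmul linear_diff)

section \<open>Polynomials in an operator and an annihilating polynomial\<close>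

definition poly_op :: "('a::real_vector \<Rightarrow> 'a) \<Rightarrow> complex poly \<Rightarrow> 'a \<times> 'a \<Rightarrow> 'a \<times> 'a" where
  "poly_op A q = fold_coeffs (\<lambda>a F p. cscale a p + complexify A (F p)) q (\<lambda>_. 0)"

lemma poly_op_0 [simp]: "poly_op A 0 p = 0"
  by (simp add: poly_op_def)

text \<open>Horner's rule, from which all facts about \<open>poly_op A q\<close>, that is
  \<open>q(A)\<close> on the complexification, follow by induction on \<open>q\<close>. Coefficients
  are complex so that polynomials split into linear factors. The case split is there because
  \<open>pCons 0 0\<close> is the zero polynomial and has no coefficient to fold over.\<close>

lemma poly_op_pCons:
  assumes "linear A"
  shows "poly_op A (pCons a q) p = cscale a p + complexify A (poly_op A q p)"
proof (cases "a = 0 \<and> q = 0")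
  case True
  then show ?thesis using linear_0[OF linear_complexify[OF assms]] by simp
next
  case False
  then show ?thesis by (auto simp: poly_op_def)
qed

lemma poly_op_add:
  assumes "linear A"
  shows "poly_op A (q + r) p = poly_op A q p + poly_op A r p"
  by (induction q r rule: poly_induct2)
    (auto simp: poly_op_pCons assms cscale_add_left linear_add[OF linear_complexify[OF assms]])

lemma poly_op_smult:
  assumes "linear A"
  shows "poly_op A (smult c q) p = cscale c (poly_op A q p)"
  by (induction q)
    (auto simp: poly_op_pCons assms cscale_add_right complexify_cscale)

lemma poly_op_mult:
  assumes "linear A"
  shows "poly_op A (q * r) p = poly_op A q (poly_op A r p)"
  by (induction q)
    (auto simp: poly_op_pCons assms poly_op_add poly_op_smult)

lemma linear_poly_op:
  assumes "linear A"
  shows "linear (poly_op A q)"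
proof (induction q)
  case 0
  then show ?case by (intro linearI) auto
next
  case (pCons a q)
  then have "linear (\<lambda>p. cscale a p + complexify A (poly_op A q p))"
    by (intro linear_compose_add linear_cscale linear_compose[OF _ linear_complexify, unfolded o_def] assms)
  then show ?case by (simp add: poly_op_pCons assms fun_eq_iff[symmetric])
qed

lemma poly_op_cscale:
  assumes "linear A"
  shows "poly_op A q (cscale c p) = cscale c (poly_op A q p)"
  by (induction q)
    (auto simp: poly_op_pCons assms cscale_add_right complexify_cscale mult.commute)

lemma poly_op_monom:
  assumes "linear A"
  shows "poly_op A (monom c n) p = cscale c ((complexify A ^^ n) p)"
  by (induction n)
    (auto simp: poly_op_pCons assms monom_0 monom_Suc complexify_cscale
      linear_0[OF linear_complexify[OF assms]])

lemma poly_op_sum: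
  assumes "linear A"
  shows "poly_op A (\<Sum>i\<in>I. q i) p = (\<Sum>i\<in>I. poly_op A (q i) p)"
  by (induction I rule: infinite_finite_induct) (auto simp: poly_op_add assms)

lemma poly_op_eigenvector:
  assumes "linear A" and "complexify A p = cscale c p"
  shows "poly_op A q p = cscale (poly q c) p"
  by (induction q)
    (auto simp: poly_op_pCons assms complexify_cscale cscale_add_left mult.commute)

text \<open>There are more powers than dimensions. They form a family and not a set: if two of them
  coincide, the coefficients 1 and -1 at these indices give the relation, otherwise dependence of
  the set does.\<close>

lemma powers_linearly_dependent:
  fixes A :: "'a::euclidean_space \<Rightarrow> 'a"
  shows "\<exists>a::nat \<Rightarrow> real. (\<exists>i\<le>DIM('a). a i \<noteq> 0) \<and> (\<Sum>i\<le>DIM('a). a i *\<^sub>R (A ^^ i) v) = 0"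
proof (cases "inj_on (\<lambda>i. (A ^^ i) v) {..DIM('a)}")
  case True
  let ?S = "(\<lambda>i. (A ^^ i) v) ` {..DIM('a)}"
  have "card ?S = Suc DIM('a)" using card_image[OF True] by simp
  then have "dependent ?S" using independent_bound[of ?S] by linarith
  then obtain u where u: "\<exists>x\<in>?S. u x \<noteq> 0" "(\<Sum>x\<in>?S. u x *\<^sub>R x) = 0"
    using dependent_finite[of ?S] by auto
  have "(\<Sum>i\<le>DIM('a). u ((A ^^ i) v) *\<^sub>R (A ^^ i) v) = 0"
    using u(2) by (simp add: sum.reindex[OF True])
  then show ?thesis using u(1) by (intro exI[of _ "\<lambda>i. u ((A ^^ i) v)"]) auto
next
  case False
  then obtain i j where ij: "i \<le> DIM('a)" "j \<le> DIM('a)" "i \<noteq> j" "(A ^^ i) v = (A ^^ j) v"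
    by (auto simp: inj_on_def)
  let ?a = "\<lambda>k. if k = i then 1 else if k = j then - 1 else (0::real)"
  have "(\<Sum>k\<le>DIM('a). ?a k *\<^sub>R (A ^^ k) v)
      = (\<Sum>k\<le>DIM('a). (if k = i then (A ^^ i) v else 0) - (if k = j then (A ^^ j) v else 0))"
    using ij by (intro sum.cong) auto
  also have "\<dots> = 0" using ij by (simp add: sum_subtractf)
  finally show ?thesis using ij by (intro exI[of _ ?a]) auto
qed

lemma annihilating_poly_vector:
  fixes A :: "'a::euclidean_space \<Rightarrow> 'a"
  assumes "linear A"
  shows "\<exists>q. q \<noteq> 0 \<and> poly_op A q (v, 0) = 0"
proof -
  obtain a :: "nat \<Rightarrow> real" and j where a: "j \<le> DIM('a)" "a j \<noteq> 0" "(\<Sum>i\<le>DIM('a). a i *\<^sub>R (A ^^ i) v) = 0"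
    using powers_linearly_dependent[of A v] by blast
  define q where "q = (\<Sum>i\<le>DIM('a). monom (complex_of_real (a i)) i)"
  have "coeff q j = of_real (a j)"
    using a(1) by (simp add: q_def coeff_sum coeff_monom)
  then have "q \<noteq> 0" using a(2) by auto
  have pw: "(complexify A ^^ i) (v, 0) = ((A ^^ i) v, 0)" for i
    by (induction i) (auto simp: complexify_def linear_0[OF assms])
  have "poly_op A q (v, 0) = (\<Sum>i\<le>DIM('a). (a i *\<^sub>R (A ^^ i) v, 0))"
    by (simp add: q_def poly_op_sum poly_op_monom assms pw cscale_def)
  also have "\<dots> = 0" using a(3) by (simp add: prod_eq_iff fst_sum snd_sum)
  finally show ?thesis using \<open>q \<noteq> 0\<close> by blast
qed

text \<open>The product of annihilators of the basis vectors annihilates each of them, because the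
  factors can be reordered so that the right one acts first.\<close>

lemma annihilating_poly:
  fixes A :: "'a::euclidean_space \<Rightarrow> 'a"
  assumes "linear A"
  shows "\<exists>q. q \<noteq> 0 \<and> (\<forall>p. poly_op A q p = 0)"
proof -
  obtain Q where Q: "\<And>v. Q v \<noteq> 0" "\<And>v. poly_op A (Q v) (v, 0) = 0"
    using annihilating_poly_vector[OF assms] by metis
  define q where "q = (\<Prod>b\<in>Basis. Q b)"
  have "q \<noteq> 0" by (simp add: q_def Q)
  have b0: "poly_op A q (b, 0) = 0" if "b \<in> Basis" for b
  proof -
    have "q = (\<Prod>b\<in>Basis - {b}. Q b) * Q b"
      unfolding q_def using that by (simp add: prod.remove mult.commute)
    then show ?thesis by (simp add: poly_op_mult assms Q linear_0[OF linear_poly_op[OF assms]])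
  qed
  have "poly_op A q p = 0" for p
  proof -
    \<comment> \<open>The real basis vectors \<open>(b, 0)\<close> span the complexification over
      the complex scalars, and \<open>poly_op\<close> commutes with \<open>cscale\<close>.\<close>
    have "p = (\<Sum>b\<in>Basis. cscale (Complex (fst p \<bullet> b) (snd p \<bullet> b)) (b, 0))"
      by (simp add: prod_eq_iff fst_sum snd_sum cscale_def euclidean_representation)
    then have "poly_op A q p = (\<Sum>b\<in>Basis. poly_op A q (cscale (Complex (fst p \<bullet> b) (snd p \<bullet> b)) (b, 0)))"
      by (metis (no_types, lifting) linear_sum[OF linear_poly_op[OF assms]] sum.cong)
    then show ?thesis by (simp add: poly_op_cscale assms b0)
  qed
  then show ?thesis using \<open>q \<noteq> 0\<close> by blast
qed

text \<open>Every eigenvalue is a root of an annihilating polynomial. Together with the existence of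
  an eigenvalue, finiteness gives the \<open>Max\<close> in \<open>spec_radius\<close> its
  meaning.\<close>

lemma finite_complex_eigenvalues:
  fixes A :: "'a::euclidean_space \<Rightarrow> 'a"
  assumes "linear A"
  shows "finite {c. complex_eigenvalue A c}"
proof -
  obtain q where q: "q \<noteq> 0" "\<And>p. poly_op A q p = 0" using annihilating_poly[OF assms] by blast
  have "{c. complex_eigenvalue A c} \<subseteq> {c. poly q c = 0}"
  proof clarify
    fix c assume "complex_eigenvalue A c"
    then obtain p where p: "p \<noteq> 0" "complexify A p = cscale c p" by (auto simp: complex_eigenvalue_iff)
    then show "poly q c = 0" using poly_op_eigenvector[OF assms p(2), of q] q(2) by simp
  qed
  then show ?thesis using poly_roots_finite[OF q(1)] finite_subset by blast
qed

text \<open>The step splits off one root of the annihilating polynomial.\<close>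

lemma poly_op_induct:
  assumes lin: "linear A" and "q \<noteq> 0" and "poly_op A q p = 0"
    and zero: "R 0"
    and step: "\<And>r p. R (complexify A p - cscale r p) \<Longrightarrow> R p"
  shows "R (p :: 'a::euclidean_space \<times> 'a)"
  using assms(2,3)
proof (induction "degree q" arbitrary: q p rule: less_induct)
  case less
  show ?case
  proof (cases "degree q = 0")
    case True
    then obtain a where "q = [:a:]" by (metis degree_eq_zeroE)
    then have "p = 0" using less.prems by (auto simp: poly_op_pCons lin linear_0[OF linear_complexify[OF lin]])
    then show ?thesis using zero by simp
  next
    case False
    then obtain r where "poly q r = 0"
      by (metis fundamental_theorem_of_algebra constant_degree)
    then obtain q' where q': "q = q' * [:-r, 1:]" by (metis poly_eq_0_iff_dvd dvdE mult.commute)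
    have "q' \<noteq> 0" using q' less.prems by auto
    have deg: "degree q' < degree q" using \<open>q' \<noteq> 0\<close> unfolding q' by (subst degree_mult_eq) auto
    have "poly_op A [:-r, 1:] p = complexify A p - cscale r p"
      by (simp add: poly_op_pCons lin linear_0[OF linear_complexify[OF lin]])
        (simp add: cscale_def prod_eq_iff)
    then have "poly_op A q' (complexify A p - cscale r p) = 0"
      using less.prems(2) unfolding q' poly_op_mult[OF lin] by simp
    then show ?thesis using less.hyps[OF deg \<open>q' \<noteq> 0\<close>] step by blast
  qed
qed

text \<open>Without eigenvalues every \<open>A - r\<close> would be injective on the
  complexification, and splitting off the roots of an annihilating polynomial one by one would show
  every vector to be 0.\<close>

lemma complex_eigenvalue_exists:
  fixes A :: "'a::euclidean_space \<Rightarrow> 'a"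
  assumes "linear A"
  shows "\<exists>c. complex_eigenvalue A c"
proof (rule ccontr)
  assume no: "\<nexists>c. complex_eigenvalue A c"
  obtain q where q: "q \<noteq> 0" "\<And>p. poly_op A q p = 0" using annihilating_poly[OF assms] by blast
  obtain b :: 'a where b: "b \<in> Basis" by (meson SOME_Basis)
  have "(b, 0 :: 'a) = 0"
  proof (rule poly_op_induct[where R = "\<lambda>p. p = 0", OF assms q(1) q(2)])
    fix r p assume "complexify A p - cscale r p = 0"
    then show "p = (0::'a \<times> 'a)" using no complex_eigenvalue_iff[of A r] by (metis right_minus_eq)
  qed simp
  then show False using b by (auto simp: prod_eq_iff)
qed

section \<open>Spectral radius, growth of powers and affine recursions\<close>

lemma spec_radius_less_iff:
  assumes "linear A"
  shows "spec_radius A < s \<longleftrightarrow> (\<forall>c. complex_eigenvalue A c \<longrightarrow> cmod c < s)"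
  unfolding spec_radius_def
  using finite_complex_eigenvalues[OF assms] complex_eigenvalue_exists[OF assms] by (subst Max_less_iff) auto

lemma spec_radius_nonneg:
  assumes "linear A"
  shows "spec_radius A \<ge> 0"
  using spec_radius_less_iff[OF assms, of 0] complex_eigenvalue_exists[OF assms]
  by (meson less_le_not_le linorder_le_less_linear norm_not_less_zero)

lemma funpow_complexify:
  assumes "linear A"
  shows "(complexify A ^^ k) (complexify A p - cscale r p)
     = (complexify A ^^ Suc k) p - cscale r ((complexify A ^^ k) p)"
  by (induction k)
    (auto simp: linear_diff[OF linear_complexify[OF assms]] complexify_cscale[OF assms])

text \<open>A bound on the orbit of \<open>(A - r) p\<close> is carried over to the orbit of
  \<open>p\<close>, one root of the annihilating polynomial at a time. Strictness of
  \<open>spec_radius A < s\<close> absorbs the polynomial factors that nontrivial Jordan blocks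
  produce.\<close>

lemma funpow_bound_complexify:
  fixes A :: "'a::euclidean_space \<Rightarrow> 'a"
  assumes lin: "linear A" and "spec_radius A < s"
  shows "\<exists>C. \<forall>k. norm ((complexify A ^^ k) p) \<le> C * s ^ k"
proof -
  have s: "s > 0" using spec_radius_nonneg[OF lin] assms(2) by simp
  obtain q where q: "q \<noteq> 0" "\<And>p. poly_op A q p = 0" using annihilating_poly[OF lin] by blast
  have lc: "linear (complexify A)" by (rule linear_complexify[OF lin])
  show ?thesis
  proof (rule poly_op_induct[OF lin q(1) q(2)])
    have "(complexify A ^^ k) 0 = 0" for k by (induction k) (auto simp: linear_0[OF lc])
    then show "\<exists>C. \<forall>k. norm ((complexify A ^^ k) 0) \<le> C * s ^ k" by (intro exI[of _ 0]) auto
  next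
    fix r p assume "\<exists>C. \<forall>k. norm ((complexify A ^^ k) (complexify A p - cscale r p)) \<le> C * s ^ k"
    then obtain C where C:
      "\<And>k. norm ((complexify A ^^ Suc k) p - cscale r ((complexify A ^^ k) p)) \<le> C * s ^ k"
      unfolding funpow_complexify[OF lin] by blast
    show "\<exists>C. \<forall>k. norm ((complexify A ^^ k) p) \<le> C * s ^ k"
    proof (cases "complex_eigenvalue A r")
      case True
      then have r: "cmod r < s" using assms(2) spec_radius_less_iff[OF lin] by blast
      \<comment> \<open>The norms along the orbit satisfy
        \<open>x (k + 1) \<le> C * s ^ k + cmod r * x k\<close>, so \<open>D * s ^ k\<close> is a
        majorant once \<open>C + cmod r * D \<le> s * D\<close> and
        \<open>norm p \<le> D\<close>.\<close>
      define D where "D = max (norm p) (C / (s - cmod r))"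
      have D: "C \<le> D * (s - cmod r)" "norm p \<le> D" "D \<ge> 0"
        using r by (auto simp: D_def le_max_iff_disj simp flip: pos_divide_le_eq)
      have "norm ((complexify A ^^ k) p) \<le> D * s ^ k" for k
      proof (induction k)
        case 0
        then show ?case using D by simp
      next
        case (Suc k)
        have "norm ((complexify A ^^ Suc k) p) \<le> C * s ^ k + cmod r * norm ((complexify A ^^ k) p)"
          using C[of k] norm_triangle_sub[of "(complexify A ^^ Suc k) p" "cscale r ((complexify A ^^ k) p)"]
          by (simp add: norm_cscale)
        also have "\<dots> \<le> D * (s - cmod r) * s ^ k + cmod r * (D * s ^ k)"
          using D Suc s by (intro add_mono mult_right_mono mult_left_mono) auto
        finally show ?case by (simp add: algebra_simps)
      qed
      then show ?thesis by blast
    next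
      case False
      \<comment> \<open>The annihilating polynomial need not be minimal, so \<open>r\<close> need
        not be an eigenvalue. Then \<open>A - r\<close> is injective, hence bounded below, and it
        commutes with the powers of \<open>A\<close>.\<close>
      let ?F = "\<lambda>p. complexify A p - cscale r p"
      have lF: "linear ?F" by (intro linear_compose_sub lc linear_cscale)
      have "inj ?F"
        using False complex_eigenvalue_iff[of A r] by (subst linear_inj_iff_eq_0[OF lF]) auto
      then obtain B where B: "B > 0" "\<And>p. B * norm p \<le> norm (?F p)"
        using linear_inj_bounded_below_pos[OF lF] by blast
      have "norm ((complexify A ^^ k) p) \<le> (C / B) * s ^ k" for k
        using B(2)[of "(complexify A ^^ k) p"] C[of k] B(1) by (simp add: field_simps)
      then show ?thesis by blast
    qed
  qed
qed

lemma funpow_bound: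
  fixes A :: "'a::euclidean_space \<Rightarrow> 'a"
  assumes lin: "linear A" and "spec_radius A < s"
  shows "\<exists>C. \<forall>k. norm ((A ^^ k) v) \<le> C * s ^ k"
proof -
  have pw: "(complexify A ^^ i) (v, 0) = ((A ^^ i) v, 0)" for i
    by (induction i) (auto simp: complexify_def linear_0[OF assms(1)])
  show ?thesis using funpow_bound_complexify[OF assms, of "(v, 0)"] by (simp add: pw norm_Pair)
qed

lemma bij_id_minus:
  fixes A :: "'a::euclidean_space \<Rightarrow> 'a"
  assumes lin: "linear A" and "spec_radius A < 1"
  shows "bij (\<lambda>v. v - A v)"
proof -
  have l: "linear (\<lambda>v. v - A v)" by (intro linear_compose_sub linear_id[unfolded id_def] lin)
  have "inj (\<lambda>v. v - A v)"
  proof (subst linear_inj_iff_eq_0[OF l], safe)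
    fix v assume "v - A v = 0"
    then have "v \<noteq> 0 \<Longrightarrow> complex_eigenvalue A 1"
      unfolding complex_eigenvalue_def by (intro exI[of _ v] exI[of _ 0]) (auto simp: linear_0[OF lin])
    then show "v = 0" using assms spec_radius_less_iff[OF lin, of 1] by fastforce
  qed
  then show ?thesis using linear_injective_imp_surjective[OF l] by (simp add: bij_def)
qed

text \<open>The error obeys the homogeneous recursion. This is required only from index
  \<open>m\<close> on, because at a fixed point the ambient recursion agrees with the projected one
  only after some steps; the finitely many earlier terms go into the constant.\<close>

lemma linear_recursion_converges_linearly:
  fixes A :: "'a::euclidean_space \<Rightarrow> 'a"
  assumes lin: "linear A" and rho: "spec_radius A < 1"
    and rec: "\<And>k. k \<ge> m \<Longrightarrow> z (Suc k) = A (z k) + b"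
  shows "converges_linearly z (inv (\<lambda>v. v - A v) b) (spec_radius A)"
proof -
  define l where "l = inv (\<lambda>v. v - A v) b"
  have l: "l = A l + b"
    using surj_f_inv_f[OF bij_is_surj[OF bij_id_minus[OF lin rho]], of b] by (simp add: l_def algebra_simps)
  have pw: "z (m + k) - l = (A ^^ k) (z m - l)" for k
  proof (induction k)
    case (Suc k)
    have "z (m + Suc k) - l = A (z (m + k)) + b - (A l + b)" using rec[of "m + k"] l by simp
    also have "\<dots> = A (z (m + k) - l)" by (simp add: linear_diff[OF lin])
    finally show ?case by (simp add: Suc)
  qed simp
  show ?thesis
    unfolding converges_linearly_def l_def[symmetric]
  proof (intro conjI rho allI impI)
    fix d assume d: "0 < d \<and> d < 1 - spec_radius A"
    let ?s = "spec_radius A + d"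
    have s: "?s > 0" using spec_radius_nonneg[OF lin] d by simp
    obtain C where C: "\<And>k. norm ((A ^^ k) (z m - l)) \<le> C * ?s ^ k"
      using funpow_bound[OF lin, of ?s "z m - l"] d by auto
    \<comment> \<open>\<open>C / ?s ^ m\<close> undoes the index shift; the maximum covers the terms
      up to index \<open>m\<close>.\<close>
    define D where "D = max (C / ?s ^ m) (Max ((\<lambda>k. dist (z k) l / ?s ^ k) ` {..m}))"
    have "dist (z k) l \<le> D * ?s ^ k" for k
    proof (cases "k \<le> m")
      case True
      then have "dist (z k) l / ?s ^ k \<le> Max ((\<lambda>k. dist (z k) l / ?s ^ k) ` {..m})" by (intro Max_ge) auto
      then have "dist (z k) l / ?s ^ k \<le> D" by (simp add: D_def)
      then show ?thesis using s by (simp add: pos_divide_le_eq)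
    next
      case False
      then obtain j where j: "k = m + j" by (metis le_add_diff_inverse nat_le_linear)
      have "dist (z k) l \<le> C * ?s ^ j" using C[of j] pw[of j] by (simp add: dist_norm j)
      also have "\<dots> = (C / ?s ^ m) * ?s ^ k" using s by (simp add: j power_add)
      also have "\<dots> \<le> D * ?s ^ k" using s by (intro mult_right_mono) (auto simp: D_def)
      finally show ?thesis .
    qed
    then show "\<exists>C. \<forall>k. dist (z k) l \<le> C * ?s ^ k" by blast
  qed
qed

section \<open>Continuously differentiable maps\<close>

text \<open>In finite dimension, continuity of \<open>f' x v\<close> in \<open>x\<close> for each
  \<open>v\<close> already is continuity in operator norm, so derivatives can be given as plain
  functions.\<close>

lemma C1_map_onI:
  fixes f :: "'a::euclidean_space \<Rightarrow> 'b::real_normed_vector"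
  assumes der: "\<And>x. x \<in> S \<Longrightarrow> (f has_derivative f' x) (at x)"
    and cont: "\<And>v. continuous_on S (\<lambda>x. f' x v)"
  shows "C1_map_on S f"
proof -
  define h' where "h' x = Blinfun (f' x)" for x
  have h': "blinfun_apply (h' x) = f' x" if "x \<in> S" for x
    unfolding h'_def by (rule bounded_linear_Blinfun_apply has_derivative_bounded_linear der that)+
  have "continuous_on S h'"
    using cont h' by (intro continuous_on_blinfun_componentwise) (simp cong: continuous_on_cong)
  then show ?thesis using der h' unfolding C1_map_on_def by (intro exI[of _ h']) auto
qed

lemma C1_map_onE:
  assumes "C1_map_on S f"
  obtains f' where "\<And>x. x \<in> S \<Longrightarrow> (f has_derivative blinfun_apply (f' x)) (at x)"
    and "continuous_on S f'"
  using assms unfolding C1_map_on_def by blast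

lemma C2_map_onE:
  assumes "C2_map_on S f"
  obtains f' where "\<And>x. x \<in> S \<Longrightarrow> (f has_derivative blinfun_apply (f' x)) (at x)"
    and "C1_map_on S f'"
  using assms unfolding C2_map_on_def by blast

lemma C1_map_on_subset: "C1_map_on S f \<Longrightarrow> T \<subseteq> S \<Longrightarrow> C1_map_on T f"
  unfolding C1_map_on_def using continuous_on_subset by blast

lemma C1_map_on_imp_continuous_on:
  assumes "C1_map_on S f" shows "continuous_on S f"
  using assms unfolding C1_map_on_def
  by (meson has_derivative_at_withinI has_derivative_continuous_on)

lemma C2_map_on_imp_C1:
  assumes "C2_map_on S f" shows "C1_map_on S f"
  using assms C1_map_on_imp_continuous_on unfolding C2_map_on_def C1_map_on_def[of S f] by blast

lemma C1_map_on_cong: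
  assumes "C1_map_on S f" and "open S" and "\<And>x. x \<in> S \<Longrightarrow> f x = g x"
  shows "C1_map_on S g"
  using assms unfolding C1_map_on_def
  by (meson has_derivative_transform_within_open)

lemma C1_map_on_bounded_linear: "bounded_linear f \<Longrightarrow> C1_map_on S f"
  unfolding C1_map_on_def
  by (intro exI[of _ "\<lambda>_. Blinfun f"])
    (auto simp: bounded_linear_Blinfun_apply bounded_linear_imp_has_derivative)

lemma C1_map_on_const: "C1_map_on S (\<lambda>_. c)"
  unfolding C1_map_on_def by (intro exI[of _ "\<lambda>_. 0"]) (auto simp: zero_blinfun.rep_eq)

lemma C1_map_on_compose:
  assumes "C1_map_on S f" and "C1_map_on T g" and "f ` S \<subseteq> T"
  shows "C1_map_on S (\<lambda>x. g (f x))"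
proof -
  obtain f' where f': "\<And>x. x \<in> S \<Longrightarrow> (f has_derivative blinfun_apply (f' x)) (at x)" "continuous_on S f'"
    using assms C1_map_onE by blast
  obtain g' where g': "\<And>x. x \<in> T \<Longrightarrow> (g has_derivative blinfun_apply (g' x)) (at x)" "continuous_on T g'"
    using assms C1_map_onE by blast
  have "((\<lambda>x. g (f x)) has_derivative blinfun_apply (g' (f x) o\<^sub>L f' x)) (at x)" if "x \<in> S" for x
    using diff_chain_at[OF f'(1)[OF that] g'(1)[of "f x"]] assms(3) that
    by (auto simp: o_def blinfun_compose.rep_eq)
  moreover have "continuous_on S (\<lambda>x. g' (f x) o\<^sub>L f' x)"
    by (rule bounded_bilinear.continuous_on[OF bounded_bilinear_blinfun_compose
          continuous_on_compose2[OF g'(2) C1_map_on_imp_continuous_on[OF assms(1)] assms(3)] f'(2)])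
  ultimately show ?thesis
    unfolding C1_map_on_def by (intro exI[of _ "\<lambda>x. g' (f x) o\<^sub>L f' x"]) simp
qed

lemma C1_map_on_bilinear:
  fixes f :: "'a::euclidean_space \<Rightarrow> 'b::real_normed_vector"
  assumes bil: "bounded_bilinear B" and f: "C1_map_on S f" and g: "C1_map_on S g"
  shows "C1_map_on S (\<lambda>x. B (f x) (g x))"
proof -
  obtain f' where f': "\<And>x. x \<in> S \<Longrightarrow> (f has_derivative blinfun_apply (f' x)) (at x)" "continuous_on S f'"
    using f C1_map_onE by blast
  obtain g' where g': "\<And>x. x \<in> S \<Longrightarrow> (g has_derivative blinfun_apply (g' x)) (at x)" "continuous_on S g'"
    using g C1_map_onE by blast
  show ?thesis
  proof (rule C1_map_onI[of _ _ "\<lambda>x h. B (f x) (g' x h) + B (f' x h) (g x)"])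
    show "((\<lambda>x. B (f x) (g x)) has_derivative (\<lambda>h. B (f x) (g' x h) + B (f' x h) (g x))) (at x)"
      if "x \<in> S" for x
      using bounded_bilinear.FDERIV[OF bil f'(1)[OF that] g'(1)[OF that]] .
    show "continuous_on S (\<lambda>x. B (f x) (g' x v) + B (f' x v) (g x))" for v
      by (rule continuous_on_add bounded_bilinear.continuous_on[OF bil] C1_map_on_imp_continuous_on f g
          blinfun.continuous_on continuous_on_const f'(2) g'(2))+
  qed
qed

lemma C1_map_on_Pair:
  fixes f :: "'a::euclidean_space \<Rightarrow> 'b::real_normed_vector"
  assumes f: "C1_map_on S f" and g: "C1_map_on S g"
  shows "C1_map_on S (\<lambda>x. (f x, g x))"
proof -
  obtain f' where f': "\<And>x. x \<in> S \<Longrightarrow> (f has_derivative blinfun_apply (f' x)) (at x)" "continuous_on S f'"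
    using f C1_map_onE by blast
  obtain g' where g': "\<And>x. x \<in> S \<Longrightarrow> (g has_derivative blinfun_apply (g' x)) (at x)" "continuous_on S g'"
    using g C1_map_onE by blast
  show ?thesis
    by (rule C1_map_onI[of _ _ "\<lambda>x h. (f' x h, g' x h)"])
      (auto intro!: has_derivative_Pair f'(1) g'(1) continuous_intros f'(2) g'(2))
qed

lemma C1_map_on_add:
  fixes f :: "'a::euclidean_space \<Rightarrow> 'b::real_normed_vector"
  assumes "C1_map_on S f" and "C1_map_on S g"
  shows "C1_map_on S (\<lambda>x. f x + g x)"
proof -
  have "bounded_linear (\<lambda>p. fst p + snd p :: 'b)"
    by (intro bounded_linear_add bounded_linear_fst bounded_linear_snd)
  from C1_map_on_compose[OF C1_map_on_Pair[OF assms] C1_map_on_bounded_linear[OF this, of UNIV]]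
  show ?thesis by simp
qed

lemma C1_map_on_diff:
  fixes f :: "'a::euclidean_space \<Rightarrow> 'b::real_normed_vector"
  assumes "C1_map_on S f" and "C1_map_on S g"
  shows "C1_map_on S (\<lambda>x. f x - g x)"
proof -
  have "bounded_linear (\<lambda>p. fst p - snd p :: 'b)"
    by (intro bounded_linear_sub bounded_linear_fst bounded_linear_snd)
  from C1_map_on_compose[OF C1_map_on_Pair[OF assms] C1_map_on_bounded_linear[OF this, of UNIV]]
  show ?thesis by simp
qed

lemma C1_map_on_sum:
  fixes f :: "'i \<Rightarrow> 'a::euclidean_space \<Rightarrow> 'b::real_normed_vector"
  assumes "\<And>i. i \<in> I \<Longrightarrow> C1_map_on S (f i)"
  shows "C1_map_on S (\<lambda>x. \<Sum>i\<in>I. f i x)"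
  using assms
  by (induction I rule: infinite_finite_induct) (auto intro: C1_map_on_const C1_map_on_add)

text \<open>The mean value theorem is used only in direction \<open>u\<close>, on the difference of
  \<open>h\<close> along two parallel segments. The resulting difference of first derivatives is
  expanded about \<open>x\<close>, so differentiability of \<open>h'\<close> at the single point
  \<open>x\<close> is enough.\<close>

lemma second_difference_quotient:
  fixes h :: "'a::real_normed_vector \<Rightarrow> real"
  assumes "open S" and "x \<in> S"
    and h': "\<And>y. y \<in> S \<Longrightarrow> (h has_derivative blinfun_apply (h' y)) (at y)"
    and h'': "(h' has_derivative h'') (at x)"
    and "e > 0"
  shows "\<exists>d>0. \<forall>t. 0 < t \<and> t < d \<longrightarrow>
    \<bar>h (x + t *\<^sub>R u + t *\<^sub>R v) - h (x + t *\<^sub>R u) - h (x + t *\<^sub>R v) + h x - t\<^sup>2 * blinfun_apply (h'' v) u\<bar> \<le> e * t\<^sup>2"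
proof -
  define N where "N = norm u + norm v"
  \<comment> \<open>The final error is \<open>\<epsilon> * (2 * N * norm u)\<close> times the square
    of \<open>t\<close>; the \<open>+ 1\<close> keeps the denominator positive.\<close>
  define \<epsilon> where "\<epsilon> = e / (2 * N * norm u + 1)"
  have N: "N \<ge> 0" "norm u \<le> N" by (auto simp: N_def)
  then have pos: "2 * N * norm u + 1 > 0" by (simp add: add_nonneg_pos)
  then have \<epsilon>: "\<epsilon> > 0" using \<open>e > 0\<close> by (simp add: \<epsilon>_def)
  obtain d1 where d1: "d1 > 0" "ball x d1 \<subseteq> S" using assms(1,2) open_contains_ball by blast
  obtain d2 where d2: "d2 > 0"
    "\<And>y. norm (y - x) < d2 \<Longrightarrow> norm (h' y - h' x - h'' (y - x)) \<le> \<epsilon> * norm (y - x)"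
    using h'' \<epsilon> unfolding has_derivative_at_alt by blast
  have l: "bounded_linear h''" using h'' has_derivative_bounded_linear by blast
  \<comment> \<open>For \<open>t < d\<close> the whole parallelogram spanned by
    \<open>t *\<^sub>R u\<close> and \<open>t *\<^sub>R v\<close> at \<open>x\<close> lies within
    both radii.\<close>
  define d where "d = min d1 d2 / (N + 1)"
  have d: "d > 0" using d1 d2 N by (simp add: d_def)
  show ?thesis
  proof (intro exI conjI allI impI)
    show "d > 0" by (rule d)
    fix t assume t: "0 < t \<and> t < d"
    have small: "norm (a *\<^sub>R u + b *\<^sub>R v) \<le> t * N" if "0 \<le> a" "a \<le> t" "0 \<le> b" "b \<le> t" for a b
    proof -
      have "norm (a *\<^sub>R u + b *\<^sub>R v) \<le> a * norm u + b * norm v"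
        using norm_triangle_ineq[of "a *\<^sub>R u" "b *\<^sub>R v"] that by simp
      also have "\<dots> \<le> t * norm u + t * norm v" using that by (intro add_mono mult_right_mono) auto
      finally show ?thesis by (simp add: N_def algebra_simps)
    qed
    have tN: "t * N < min d1 d2"
    proof -
      have "t * N \<le> t * (N + 1)" using t by simp
      also have "\<dots> < d * (N + 1)" using t N by (intro mult_strict_right_mono) auto
      also have "\<dots> = min d1 d2" using N by (simp add: d_def)
      finally show ?thesis .
    qed
    have inS: "x + a *\<^sub>R u + b *\<^sub>R v \<in> S" if "0 \<le> a" "a \<le> t" "0 \<le> b" "b \<le> t" for a b
    proof -
      have "dist (x + (a *\<^sub>R u + b *\<^sub>R v)) x < d1"
        using small[OF that] tN by (simp add: dist_norm)
      then show ?thesis using d1 by (auto simp: add.assoc dist_commute)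
    qed
    define \<phi> where "\<phi> \<tau> = h (x + (t * \<tau>) *\<^sub>R u + t *\<^sub>R v) - h (x + (t * \<tau>) *\<^sub>R u)" for \<tau>
    have bnd: "0 \<le> t * \<tau> \<and> t * \<tau> \<le> t" if "0 \<le> \<tau>" "\<tau> \<le> 1" for \<tau>
      using that t by (simp add: mult_left_le)
    have der: "(\<phi> has_real_derivative
        t * (h' (x + (t * \<tau>) *\<^sub>R u + t *\<^sub>R v) u - h' (x + (t * \<tau>) *\<^sub>R u) u)) (at \<tau>)"
      if "0 \<le> \<tau>" "\<tau> \<le> 1" for \<tau>
    proof -
      have 1: "((\<lambda>\<tau>. x + (t * \<tau>) *\<^sub>R u + t *\<^sub>R v) has_derivative (\<lambda>s. (t * s) *\<^sub>R u)) (at \<tau>)"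
        "((\<lambda>\<tau>. x + (t * \<tau>) *\<^sub>R u) has_derivative (\<lambda>s. (t * s) *\<^sub>R u)) (at \<tau>)"
        by (auto intro!: derivative_eq_intros)
      have 2: "x + (t * \<tau>) *\<^sub>R u + t *\<^sub>R v \<in> S" "x + (t * \<tau>) *\<^sub>R u \<in> S"
        using inS[of "t * \<tau>" t] inS[of "t * \<tau>" 0] bnd[OF that] t by auto
      have "(\<phi> has_derivative (\<lambda>s. h' (x + (t * \<tau>) *\<^sub>R u + t *\<^sub>R v) ((t * s) *\<^sub>R u)
          - h' (x + (t * \<tau>) *\<^sub>R u) ((t * s) *\<^sub>R u))) (at \<tau>)"
        unfolding \<phi>_def
        by (rule has_derivative_diff[OF has_derivative_compose[OF 1(1) h'[OF 2(1)]]
            has_derivative_compose[OF 1(2) h'[OF 2(2)]]])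
      then show ?thesis
        by (rule has_derivative_imp_has_field_derivative)
          (simp add: blinfun.scaleR_right algebra_simps)
    qed
    have "\<exists>\<tau>>0. \<tau> < 1 \<and> \<phi> 1 - \<phi> 0 = (1 - 0) *
        (t * (h' (x + (t * \<tau>) *\<^sub>R u + t *\<^sub>R v) u - h' (x + (t * \<tau>) *\<^sub>R u) u))"
      by (rule MVT2) (simp_all add: der)
    then obtain \<tau> where \<tau>: "0 < \<tau>" "\<tau> < 1" "\<phi> 1 - \<phi> 0 = (1 - 0) *
        (t * (h' (x + (t * \<tau>) *\<^sub>R u + t *\<^sub>R v) u - h' (x + (t * \<tau>) *\<^sub>R u) u))"
      by blast
    define y1 where "y1 = x + (t * \<tau>) *\<^sub>R u + t *\<^sub>R v"
    define y2 where "y2 = x + (t * \<tau>) *\<^sub>R u"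
    have ny1: "norm (y1 - x) \<le> t * N" and ny2: "norm (y2 - x) \<le> t * N"
      using small[of "t * \<tau>" t] small[of "t * \<tau>" 0] bnd[of \<tau>] \<tau> t by (auto simp: y1_def y2_def)
    have r1: "norm (h' y1 - h' x - h'' (y1 - x)) \<le> \<epsilon> * (t * N)"
      by (rule order_trans[OF d2(2) mult_left_mono[OF ny1]]) (use ny1 tN \<epsilon> in auto)
    have r2: "norm (h' y2 - h' x - h'' (y2 - x)) \<le> \<epsilon> * (t * N)"
      by (rule order_trans[OF d2(2) mult_left_mono[OF ny2]]) (use ny2 tN \<epsilon> in auto)
    \<comment> \<open>The two points differ by exactly \<open>t *\<^sub>R v\<close>, so their linear
      parts leave \<open>t *\<^sub>R h'' v\<close> and only the two remainders count as
      error.\<close>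
    have y12: "(y1 - x) - (y2 - x) = t *\<^sub>R v" by (simp add: y1_def y2_def)
    have "h'' (y1 - x) - h'' (y2 - x) = t *\<^sub>R h'' v"
      using y12 linear_diff[OF bounded_linear.linear[OF l]] linear_cmul[OF bounded_linear.linear[OF l]] by metis
    then have split: "h' y1 - h' y2 - t *\<^sub>R h'' v
        = (h' y1 - h' x - h'' (y1 - x)) - (h' y2 - h' x - h'' (y2 - x))" by (simp add: algebra_simps)
    have nr: "norm (h' y1 - h' y2 - t *\<^sub>R h'' v) \<le> 2 * \<epsilon> * t * N"
      unfolding split by (rule order_trans[OF norm_triangle_ineq4]) (use r1 r2 in linarith)
    have "h (x + t *\<^sub>R u + t *\<^sub>R v) - h (x + t *\<^sub>R u) - h (x + t *\<^sub>R v) + h x - t\<^sup>2 * h'' v u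
        = t * blinfun_apply (h' y1 - h' y2 - t *\<^sub>R h'' v) u"
    proof -
      have "h (x + t *\<^sub>R u + t *\<^sub>R v) - h (x + t *\<^sub>R u) - h (x + t *\<^sub>R v) + h x = \<phi> 1 - \<phi> 0"
        by (simp add: \<phi>_def)
      also have "\<dots> = t * (h' y1 u - h' y2 u)" using \<tau>(3) by (simp add: y1_def y2_def)
      finally show ?thesis
        by (simp add: blinfun.diff_left blinfun.scaleR_left power2_eq_square right_diff_distrib)
    qed
    also have "\<bar>\<dots>\<bar> \<le> t * (2 * \<epsilon> * t * N * norm u)"
    proof -
      have "\<bar>blinfun_apply (h' y1 - h' y2 - t *\<^sub>R h'' v) u\<bar> \<le> 2 * \<epsilon> * t * N * norm u"
        using order_trans[OF norm_blinfun mult_right_mono[OF nr norm_ge_zero]] by simp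
      then show ?thesis using t by (simp add: abs_mult mult_left_mono)
    qed
    also have "\<dots> = (\<epsilon> * (2 * N * norm u)) * t\<^sup>2" by (simp add: power2_eq_square algebra_simps)
    also have "\<dots> \<le> e * t\<^sup>2"
    proof (rule mult_right_mono)
      have "\<epsilon> * (2 * N * norm u) \<le> \<epsilon> * (2 * N * norm u + 1)" using \<epsilon> by simp
      also have "\<dots> = e" using pos by (simp add: \<epsilon>_def)
      finally show "\<epsilon> * (2 * N * norm u) \<le> e" .
    qed simp
    finally show "\<bar>h (x + t *\<^sub>R u + t *\<^sub>R v) - h (x + t *\<^sub>R u) - h (x + t *\<^sub>R v) + h x - t\<^sup>2 * h'' v u\<bar> \<le> e * t\<^sup>2" .
  qed
qed

text \<open>The second difference does not change when \<open>u\<close> and \<open>v\<close> are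
  exchanged, yet divided by the square of \<open>t\<close> it approximates both
  \<open>h'' v u\<close> and \<open>h'' u v\<close>.\<close>

lemma second_derivative_symmetric:
  fixes h :: "'a::real_normed_vector \<Rightarrow> real"
  assumes "open S" and "x \<in> S"
    and "\<And>y. y \<in> S \<Longrightarrow> (h has_derivative blinfun_apply (h' y)) (at y)"
    and "(h' has_derivative h'') (at x)"
  shows "blinfun_apply (h'' u) v = blinfun_apply (h'' v) u"
proof -
  have "\<bar>h'' u v - h'' v u\<bar> \<le> e" if e: "e > 0" for e
  proof -
    obtain d where d: "d > 0" "\<And>t. 0 < t \<and> t < d \<Longrightarrow>
        \<bar>h (x + t *\<^sub>R u + t *\<^sub>R v) - h (x + t *\<^sub>R u) - h (x + t *\<^sub>R v) + h x - t\<^sup>2 * h'' v u\<bar> \<le> e / 2 * t\<^sup>2"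
      using second_difference_quotient[OF assms half_gt_zero[OF e], of u v] by blast
    obtain d' where d': "d' > 0" "\<And>t. 0 < t \<and> t < d' \<Longrightarrow>
        \<bar>h (x + t *\<^sub>R v + t *\<^sub>R u) - h (x + t *\<^sub>R v) - h (x + t *\<^sub>R u) + h x - t\<^sup>2 * h'' u v\<bar> \<le> e / 2 * t\<^sup>2"
      using second_difference_quotient[OF assms half_gt_zero[OF e], of v u] by blast
    define t where "t = min d d' / 2"
    have t: "0 < t" "t < d" "t < d'" using d d' by (auto simp: t_def)
    have "\<bar>t\<^sup>2 * (h'' u v - h'' v u)\<bar> \<le> e * t\<^sup>2"
    proof -
      have "x + t *\<^sub>R v + t *\<^sub>R u = x + t *\<^sub>R u + t *\<^sub>R v" by simp
      then show ?thesis
        using d(2)[of t] d'(2)[of t] t unfolding right_diff_distrib by (smt (verit) field_sum_of_halves distrib_right)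
    qed
    then show ?thesis using t by (simp add: abs_mult mult.commute)
  qed
  then have "\<bar>h'' u v - h'' v u\<bar> \<le> 0" by (rule field_le_epsilon[of _ 0, simplified])
  then show ?thesis by simp
qed

text \<open>What is added to \<open>inverse_function_theorem\<close> is continuity of the derivative
  of the inverse. The lower bound \<open>c\<close> of the injective \<open>f' (g y0)\<close>
  survives as \<open>c / 2\<close> for nearby \<open>y\<close>, and \<open>f' (g y)\<close> maps the
  difference \<open>g' y v - g' y0 v\<close> to a residual tending to 0.\<close>

lemma C1_inverse_function:
  fixes f :: "'a::euclidean_space \<Rightarrow> 'a"
  assumes "open U" and "C1_map_on U f" and "x0 \<in> U"
    and "(f has_derivative D) (at x0)" and "inj D"
  obtains U' V g where "open U'" "U' \<subseteq> U" "x0 \<in> U'" "open V" "f x0 \<in> V"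
    "homeomorphism U' V f g" "C1_map_on V g"
proof -
  obtain f' where f': "\<And>x. x \<in> U \<Longrightarrow> (f has_derivative blinfun_apply (f' x)) (at x)" "continuous_on U f'"
    using assms C1_map_onE by blast
  have D: "D = f' x0" using has_derivative_unique assms(4) f'(1)[OF assms(3)] by blast
  obtain i where i: "linear i" "i \<circ> f' x0 = id"
    using linear_injective_left_inverse[of "f' x0"] assms(5) D bounded_linear.linear[OF blinfun.bounded_linear_right] by blast
  then have bi: "bounded_linear i" by (simp add: linear_linear)
  have inv: "Blinfun i o\<^sub>L f' x0 = id_blinfun"
    using i(2) by (intro blinfun_eqI) (simp add: bounded_linear_Blinfun_apply[OF bi] fun_eq_iff)
  obtain U' V g g' where *: "open U'" "U' \<subseteq> U" "x0 \<in> U'" "open V" "f x0 \<in> V" "homeomorphism U' V f g"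
    "\<And>y. y \<in> V \<Longrightarrow> (g has_derivative (g' y)) (at y)"
    "\<And>y. y \<in> V \<Longrightarrow> g' y = inv (blinfun_apply (f' (g y)))"
    "\<And>y. y \<in> V \<Longrightarrow> bij (blinfun_apply (f' (g y)))"
    using inverse_function_theorem[OF assms(1) f' assms(3) inv] by metis
  have gU: "g y \<in> U" if "y \<in> V" for y using *(2,6) that unfolding homeomorphism_def by blast
  have gc: "continuous_on V g" using *(6) unfolding homeomorphism_def by blast
  have fgc: "continuous_on V (\<lambda>y. f' (g y))"
    using continuous_on_compose2[OF f'(2) gc] gU by blast
  have "C1_map_on V g"
  proof (rule C1_map_onI[OF *(7)])
    fix v
    show "continuous_on V (\<lambda>y. g' y v)"
      unfolding continuous_on_eq_continuous_at[OF *(4)]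
    proof
      fix y0 assume y0: "y0 \<in> V"
      have fg: "f' (g y) (g' y v) = v" if "y \<in> V" for y
        using *(8,9)[OF that] by (simp add: bij_is_surj surj_f_inv_f)
      obtain c where c: "c > 0" "\<And>z. c * norm z \<le> norm (f' (g y0) z)"
        using linear_inj_bounded_below_pos[of "f' (g y0)"] *(9)[OF y0] bij_is_inj
          bounded_linear.linear[OF blinfun.bounded_linear_right] by metis
      have cont: "((\<lambda>y. f' (g y)) \<longlongrightarrow> f' (g y0)) (at y0)"
        using fgc y0 continuous_on_eq_continuous_at[OF *(4)] isCont_def by blast
      have ev: "\<forall>\<^sub>F y in at y0. norm (f' (g y) - f' (g y0)) < c / 2"
        using tendstoD[OF cont, of "c / 2"] c(1) by (simp add: dist_norm)
      have evV: "\<forall>\<^sub>F y in at y0. y \<in> V" using *(4) y0 by (rule eventually_at_in_open')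
      have "\<forall>\<^sub>F y in at y0. norm (g' y v - g' y0 v) \<le> norm (v - f' (g y) (g' y0 v)) * (2 / c)"
        using ev evV
      proof eventually_elim
        case (elim y)
        let ?z = "g' y v - g' y0 v"
        have "c * norm ?z \<le> norm (f' (g y0) ?z)" by (rule c)
        also have "\<dots> \<le> norm (f' (g y) ?z) + norm ((f' (g y) - f' (g y0)) ?z)"
          by (metis add.commute blinfun.diff_left norm_minus_commute norm_triangle_sub)
        also have "norm ((f' (g y) - f' (g y0)) ?z) \<le> c / 2 * norm ?z"
          using norm_blinfun[of "f' (g y) - f' (g y0)" ?z] elim(1)
          by (meson less_imp_le mult_right_mono norm_ge_zero order_trans)
        finally have "c / 2 * norm ?z \<le> norm (f' (g y) ?z)" by simp
        then show ?case using fg[OF elim(2)] c(1) by (simp add: blinfun.diff_right field_simps)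
      qed
      moreover have "((\<lambda>y. norm (v - f' (g y) (g' y0 v)) * (2 / c)) \<longlongrightarrow> 0) (at y0)"
      proof -
        have "((\<lambda>y. norm (v - f' (g y) (g' y0 v)) * (2 / c)) \<longlongrightarrow> norm (v - f' (g y0) (g' y0 v)) * (2 / c)) (at y0)"
          by (intro tendsto_intros cont)
        then show ?thesis using fg[OF y0] by simp
      qed
      ultimately have "((\<lambda>y. g' y v - g' y0 v) \<longlongrightarrow> 0) (at y0)" by (rule Lim_null_comparison)
      then show "isCont (\<lambda>y. g' y v) y0" unfolding isCont_def by (simp add: LIM_zero_iff)
    qed
  qed
  then show ?thesis using that * by blast
qed

text \<open>The inverse function theorem is applied to the map sending \<open>q\<close> to
  \<open>(H q, snd q)\<close>. Its derivative is injective as soon as the partial derivative of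
  \<open>H\<close> in the first variable is, and the solution is the first component of the inverse
  at \<open>(0, p)\<close>.\<close>

lemma C1_implicit_function:
  fixes H :: "'a::euclidean_space \<times> 'b::euclidean_space \<Rightarrow> 'a"
  assumes "open W" and "C1_map_on W H" and "(y0, p0) \<in> W" and "H (y0, p0) = 0"
    and D: "(H has_derivative D) (at (y0, p0))" and inj: "\<And>v. D (v, 0) = 0 \<Longrightarrow> v = 0"
  obtains Q Y where "open Q" "p0 \<in> Q" "C1_map_on Q Y" "Y p0 = y0"
    "\<And>p. p \<in> Q \<Longrightarrow> (Y p, p) \<in> W \<and> H (Y p, p) = 0"
proof -
  let ?F = "\<lambda>q. (H q, snd q)"
  have F: "C1_map_on W ?F"
    by (intro C1_map_on_Pair assms C1_map_on_bounded_linear bounded_linear_snd)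
  have DF: "(?F has_derivative (\<lambda>h. (D h, snd h))) (at (y0, p0))"
    by (intro derivative_intros D)
  have "linear (\<lambda>h. (D h, snd h))" using DF has_derivative_linear by blast
  then have "inj (\<lambda>h. (D h, snd h))"
    by (subst linear_inj_iff_eq_0) (auto simp: prod_eq_iff inj)
  from C1_inverse_function[OF assms(1) F assms(3) DF this]
  obtain U' V g where *: "open U'" "U' \<subseteq> W" "(y0, p0) \<in> U'" "open V" "?F (y0, p0) \<in> V"
    "homeomorphism U' V ?F g" "C1_map_on V g" by blast
  define Q where "Q = (\<lambda>p. (0, p)) -` V"
  show ?thesis
  proof (rule that)
    show "open Q" unfolding Q_def by (intro open_vimage *(4) continuous_intros)
    show "p0 \<in> Q" using *(5) assms(4) by (simp add: Q_def)
    have gQ: "C1_map_on Q (\<lambda>p. g (0, p))"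
      by (rule C1_map_on_compose[OF C1_map_on_Pair[OF C1_map_on_const
            C1_map_on_bounded_linear[OF bounded_linear_ident]] *(7)]) (auto simp: Q_def)
    show "C1_map_on Q (\<lambda>p. fst (g (0, p)))"
      using C1_map_on_compose[OF gQ C1_map_on_bounded_linear[OF bounded_linear_fst, of UNIV]] by simp
    have "g (?F (y0, p0)) = (y0, p0)" using *(3,6) unfolding homeomorphism_def by blast
    then show "fst (g (0, p0)) = y0" using assms(4) by simp
    fix p assume "p \<in> Q"
    then have V: "(0, p) \<in> V" by (simp add: Q_def)
    then have g: "g (0, p) \<in> U'" "?F (g (0, p)) = (0, p)" using *(6) unfolding homeomorphism_def by blast+
    then have "g (0, p) = (fst (g (0, p)), p)" by (metis prod.collapse snd_conv)
    then show "(fst (g (0, p)), p) \<in> W \<and> H (fst (g (0, p)), p) = 0" using g *(2)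
      by (metis fst_conv subsetD)
  qed
qed

section \<open>Orthogonal projections and tangent spaces\<close>

lemma closest_point_subspace_eq:
  fixes T :: "'a::euclidean_space set"
  assumes "subspace T" and "p \<in> T" and "\<And>t. t \<in> T \<Longrightarrow> (v - p) \<bullet> t = 0"
  shows "closest_point T v = p"
proof (rule closest_point_unique[symmetric])
  show "convex T" "closed T" "p \<in> T" using assms subspace_imp_convex closed_subspace by auto
  show "\<forall>z\<in>T. dist v p \<le> dist v z"
  proof
    fix z assume "z \<in> T"
    then have "(v - p) \<bullet> (p - z) = 0" using assms subspace_diff by blast
    then have "(norm (v - z))\<^sup>2 = (norm (v - p))\<^sup>2 + (norm (p - z))\<^sup>2"
      using norm_add_Pythagorean[of "v - p" "p - z"] by (simp add: orthogonal_def)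
    then have "(norm (v - p))\<^sup>2 \<le> (norm (v - z))\<^sup>2" by simp
    then show "dist v p \<le> dist v z" by (simp add: dist_norm)
  qed
qed

lemma closest_point_subspace:
  fixes T :: "'a::euclidean_space set"
  assumes "subspace T"
  shows "closest_point T v \<in> T" and "t \<in> T \<Longrightarrow> (v - closest_point T v) \<bullet> t = 0"
proof -
  obtain y z where yz: "y \<in> span T" "\<And>w. w \<in> span T \<Longrightarrow> orthogonal z w" "v = y + z"
    using orthogonal_subspace_decomp_exists[of T v] by metis
  have T: "span T = T" using assms by simp
  have "closest_point T v = y"
    using yz T by (intro closest_point_subspace_eq assms) (auto simp: orthogonal_def)
  then show "closest_point T v \<in> T" and "t \<in> T \<Longrightarrow> (v - closest_point T v) \<bullet> t = 0"
    using yz T by (auto simp: orthogonal_def)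
qed

lemma inner_closest_point_subspace:
  fixes T :: "'a::euclidean_space set"
  assumes "subspace T" and "t \<in> T"
  shows "closest_point T v \<bullet> t = v \<bullet> t"
  using closest_point_subspace(2)[OF assms, of v] by (simp add: inner_diff_left)

lemma linear_closest_point_subspace:
  fixes T :: "'a::euclidean_space set"
  assumes "subspace T"
  shows "linear (closest_point T)"
proof (rule linearI)
  have cp: "(v - closest_point T v) \<bullet> t = 0" if "t \<in> T" for v t
    using closest_point_subspace(2)[OF assms that] .
  show "closest_point T (v + w) = closest_point T v + closest_point T w" for v w
  proof (rule closest_point_subspace_eq[OF assms])
    show "closest_point T v + closest_point T w \<in> T"
      by (intro subspace_add closest_point_subspace(1) assms)
    show "(v + w - (closest_point T v + closest_point T w)) \<bullet> t = 0" if "t \<in> T" for t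
      using cp[OF that, of v] cp[OF that, of w] by (simp add: inner_diff_left inner_add_left)
  qed
  show "closest_point T (c *\<^sub>R v) = c *\<^sub>R closest_point T v" for c v
  proof (rule closest_point_subspace_eq[OF assms])
    show "c *\<^sub>R closest_point T v \<in> T"
      by (intro subspace_scale closest_point_subspace(1) assms)
    show "(c *\<^sub>R v - c *\<^sub>R closest_point T v) \<bullet> t = 0" if "t \<in> T" for t
      using cp[OF that, of v] by (simp flip: scaleR_right_diff_distrib)
  qed
qed

lemma norm_closest_point_subspace_le:
  fixes T :: "'a::euclidean_space set"
  assumes "subspace T"
  shows "norm (closest_point T v) \<le> norm v"
proof -
  have "(norm (closest_point T v))\<^sup>2 = v \<bullet> closest_point T v"
    using inner_closest_point_subspace[OF assms closest_point_subspace(1)[OF assms], of v v]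
    by (simp add: power2_norm_eq_inner)
  also have "\<dots> \<le> norm v * norm (closest_point T v)" by (rule norm_cauchy_schwarz)
  finally have "norm (closest_point T v) * norm (closest_point T v) \<le> norm v * norm (closest_point T v)"
    by (simp only: power2_eq_square)
  then show ?thesis by (cases "norm (closest_point T v) = 0") (simp, metis mult_right_le_imp_le norm_ge_zero order_le_less)
qed

text \<open>Near \<open>x\<close> the map equals its own projection to \<open>S\<close>, so by
  uniqueness of derivatives \<open>f'\<close> does too.\<close>

lemma has_derivative_in_subspace:
  fixes f :: "'a::real_normed_vector \<Rightarrow> 'b::euclidean_space"
  assumes "(f has_derivative f') (at x)" and "open U" and "x \<in> U"
    and "\<And>y. y \<in> U \<Longrightarrow> f y \<in> S" and "subspace S"
  shows "f' h \<in> S"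
proof -
  have bl: "bounded_linear (closest_point S)"
    using linear_closest_point_subspace[OF assms(5)] by (simp add: linear_linear)
  have "((\<lambda>y. closest_point S (f y)) has_derivative (\<lambda>h. closest_point S (f' h))) (at x)"
    by (rule bounded_linear.has_derivative[OF bl assms(1)])
  then have "(f has_derivative (\<lambda>h. closest_point S (f' h))) (at x)"
    by (rule has_derivative_transform_within_open[OF _ assms(2,3)])
      (use assms(4) closest_point_self in blast)
  then have "f' = (\<lambda>h. closest_point S (f' h))"
    using assms(1) has_derivative_unique by blast
  then show ?thesis using closest_point_subspace(1)[OF assms(5)] by metis
qed

section \<open>Tangent and normal spaces, also of products with an open set\<close>

lemma tangent_spaceI:
  assumes "e > 0" and "\<And>t. \<bar>t\<bar> < e \<Longrightarrow> (\<gamma> has_vector_derivative \<gamma>' t) (at t)"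
    and "continuous_on {-e<..<e} \<gamma>'" and "\<And>t. \<bar>t\<bar> < e \<Longrightarrow> \<gamma> t \<in> M"
  shows "\<gamma>' 0 \<in> tangent_space M (\<gamma> 0)"
proof -
  have "\<gamma> C1_differentiable_on {-e<..<e}"
    unfolding C1_differentiable_on_def using assms by (intro exI[of _ \<gamma>']) (auto simp: abs_less_iff)
  moreover have "\<gamma> ` {-e<..<e} \<subseteq> M" using assms by (auto simp: abs_less_iff)
  moreover have "(\<gamma> has_vector_derivative \<gamma>' 0) (at 0)" using assms by simp
  ultimately show ?thesis using assms(1) unfolding tangent_space_def by blast
qed

lemma tangent_spaceE:
  assumes "v \<in> tangent_space M x"
  obtains \<gamma> \<gamma>' e where "e > 0" "\<And>t. \<bar>t\<bar> < e \<Longrightarrow> (\<gamma> has_vector_derivative \<gamma>' t) (at t)"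
    "continuous_on {-e<..<e} \<gamma>'" "\<And>t. \<bar>t\<bar> < e \<Longrightarrow> \<gamma> t \<in> M" "\<gamma> 0 = x" "\<gamma>' 0 = v"
proof -
  obtain \<gamma> e where *: "e > 0" "\<gamma> C1_differentiable_on {-e<..<e}" "\<gamma> ` {-e<..<e} \<subseteq> M" "\<gamma> 0 = x"
    "(\<gamma> has_vector_derivative v) (at 0)" using assms unfolding tangent_space_def by blast
  then obtain D where D: "\<And>t. t \<in> {-e<..<e} \<Longrightarrow> (\<gamma> has_vector_derivative D t) (at t)"
    "continuous_on {-e<..<e} D" unfolding C1_differentiable_on_def by blast
  have "D 0 = v" using D(1)[of 0] *(1,5) vector_derivative_unique_at by auto
  then show ?thesis using that[of e \<gamma> D] * D by (auto simp: abs_less_iff image_subset_iff)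
qed

lemma zero_in_tangent_space: "x \<in> M \<Longrightarrow> 0 \<in> tangent_space M x"
  using tangent_spaceI[of 1 "\<lambda>_. x" "\<lambda>_. 0" M] by auto

lemma tangent_space_Times:
  assumes "x \<in> M" and "open \<Omega>" and "u \<in> \<Omega>"
  shows "tangent_space (M \<times> \<Omega>) (x, u) = tangent_space M x \<times> UNIV"
proof (intro equalityI subsetI)
  fix v assume "v \<in> tangent_space (M \<times> \<Omega>) (x, u)"
  then obtain \<gamma> \<gamma>' e where *: "e > 0" "\<And>t. \<bar>t\<bar> < e \<Longrightarrow> (\<gamma> has_vector_derivative \<gamma>' t) (at t)"
    "continuous_on {-e<..<e} \<gamma>'" "\<And>t. \<bar>t\<bar> < e \<Longrightarrow> \<gamma> t \<in> M \<times> \<Omega>" "\<gamma> 0 = (x, u)" "\<gamma>' 0 = v"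
    by (rule tangent_spaceE) (rule that)
  have "(fst \<circ> \<gamma>') 0 \<in> tangent_space M ((fst \<circ> \<gamma>) 0)"
  proof (rule tangent_spaceI[OF *(1)])
    show "(fst \<circ> \<gamma> has_vector_derivative (fst \<circ> \<gamma>') t) (at t)" if "\<bar>t\<bar> < e" for t
      using bounded_linear.has_vector_derivative[OF bounded_linear_fst *(2)[OF that]] by (simp add: o_def)
    show "continuous_on {-e<..<e} (fst \<circ> \<gamma>')" unfolding o_def by (intro continuous_intros *(3))
    show "(fst \<circ> \<gamma>) t \<in> M" if "\<bar>t\<bar> < e" for t using *(4)[OF that] by auto
  qed
  then show "v \<in> tangent_space M x \<times> UNIV" using * by (cases v) auto
next
  fix p assume p: "p \<in> tangent_space M x \<times> (UNIV :: 'b set)"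
  then obtain v b where vb: "p = (v, b)" "v \<in> tangent_space M x" by auto
  obtain \<gamma> \<gamma>' e where *: "e > 0" "\<And>t. \<bar>t\<bar> < e \<Longrightarrow> (\<gamma> has_vector_derivative \<gamma>' t) (at t)"
    "continuous_on {-e<..<e} \<gamma>'" "\<And>t. \<bar>t\<bar> < e \<Longrightarrow> \<gamma> t \<in> M" "\<gamma> 0 = x" "\<gamma>' 0 = v"
    using vb(2) by (rule tangent_spaceE) (rule that)
  have "open ((\<lambda>t. u + t *\<^sub>R b) -` \<Omega>)" by (intro open_vimage assms continuous_intros)
  moreover have "0 \<in> (\<lambda>t. u + t *\<^sub>R b) -` \<Omega>" using assms(3) by simp
  ultimately obtain e' where ball: "e' > 0" "ball 0 e' \<subseteq> (\<lambda>t. u + t *\<^sub>R b) -` \<Omega>"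
    by (rule openE)
  have e': "e' > 0" "\<And>t. \<bar>t\<bar> < e' \<Longrightarrow> u + t *\<^sub>R b \<in> \<Omega>"
    using ball(1) subsetD[OF ball(2)] by auto
  have "(\<gamma>' 0, b) \<in> tangent_space (M \<times> \<Omega>) (\<gamma> 0, u + 0 *\<^sub>R b)"
  proof (rule tangent_spaceI[of "min e e'" "\<lambda>t. (\<gamma> t, u + t *\<^sub>R b)" "\<lambda>t. (\<gamma>' t, b)"])
    fix t assume t: "\<bar>t\<bar> < min e e'"
    have "((\<lambda>t. u + t *\<^sub>R b) has_vector_derivative b) (at t)"
      by (auto intro!: derivative_eq_intros simp: has_vector_derivative_def)
    then show "((\<lambda>t. (\<gamma> t, u + t *\<^sub>R b)) has_vector_derivative (\<gamma>' t, b)) (at t)"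
      using *(2)[of t] t by (intro has_vector_derivative_Pair) auto
    show "(\<gamma> t, u + t *\<^sub>R b) \<in> M \<times> \<Omega>" using *(4)[of t] e'(2)[of t] t by simp
  next
    have "continuous_on {- min e e'<..<min e e'} \<gamma>'"
      by (rule continuous_on_subset[OF *(3)]) auto
    then show "continuous_on {- min e e'<..<min e e'} (\<lambda>t. (\<gamma>' t, b))"
      by (intro continuous_intros)
  qed (use * e' in auto)
  then show "p \<in> tangent_space (M \<times> \<Omega>) (x, u)" using * vb by simp
qed

lemma normal_space_iff: "a \<in> normal_space M x \<longleftrightarrow> (\<forall>v\<in>tangent_space M x. a \<bullet> v = 0)"
  by (auto simp: normal_space_def orthogonal_comp_def orthogonal_def inner_commute)

text \<open>Tangent vectors of \<open>M \<times> \<Omega>\<close> have arbitrary second components,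
  so normal vectors have none. Applied to \<open>par (subdiff g (x, u))\<close>, this is the
  constraint qualification under which partial subgradients lift to joint ones.\<close>

lemma normal_space_Times:
  assumes "x \<in> M" and "open \<Omega>" and "u \<in> \<Omega>"
  shows "normal_space (M \<times> \<Omega>) (x, u) = normal_space M x \<times> {0}"
proof (intro equalityI subsetI)
  fix p assume p: "p \<in> normal_space (M \<times> \<Omega>) (x, u)"
  obtain a w where aw: "p = (a, w)" by (cases p)
  have *: "a \<bullet> v + w \<bullet> b = 0" if "v \<in> tangent_space M x" for v b
    using p that unfolding aw normal_space_iff tangent_space_Times[OF assms] by auto
  from *[OF zero_in_tangent_space[OF assms(1)], of w] have "w = 0" by simp
  then show "p \<in> normal_space M x \<times> {0}" using *[of _ 0] by (auto simp: aw normal_space_iff)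
qed (auto simp: normal_space_iff tangent_space_Times[OF assms])

text \<open>A flattening chart together with its derivatives as bounded linear functions, so that
  their continuity can be stated. \<open>P'\<close> is continuously differentiable because it occurs
  in the optimality condition in chart coordinates, which is differentiated again.\<close>

locale C2_chart =
  fixes M V :: "'a::euclidean_space set" and \<phi> P :: "'a \<Rightarrow> 'a" and S :: "'a set"
    and \<phi>' P' :: "'a \<Rightarrow> 'a \<Rightarrow>\<^sub>L 'a"
  assumes open_V: "open V" and open_image: "open (\<phi> ` V)" and homeo: "homeomorphism V (\<phi> ` V) \<phi> P"
    and \<phi>': "\<And>x. x \<in> V \<Longrightarrow> (\<phi> has_derivative \<phi>' x) (at x)" and cont_\<phi>': "continuous_on V \<phi>'"
    and P': "\<And>y. y \<in> \<phi> ` V \<Longrightarrow> (P has_derivative P' y) (at y)" and C1_P': "C1_map_on (\<phi> ` V) P'"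
    and S: "subspace S" and flat: "\<phi> ` (M \<inter> V) = \<phi> ` V \<inter> S"

lemma C2_manifold_around_chart:
  assumes "C2_manifold_around d M x"
  obtains V \<phi> P S \<phi>' P' where "C2_chart M V \<phi> P S \<phi>' P'" and "x \<in> V"
proof -
  obtain V S and \<phi> P :: "'a \<Rightarrow> 'a" where *: "open V" "x \<in> V" "open (\<phi> ` V)" "homeomorphism V (\<phi> ` V) \<phi> P"
       "C2_map_on V \<phi>" "C2_map_on (\<phi> ` V) P" "subspace S" "\<phi> ` (M \<inter> V) = \<phi> ` V \<inter> S"
    using assms unfolding C2_manifold_around_def by blast
  obtain P' where P': "\<And>y. y \<in> \<phi> ` V \<Longrightarrow> (P has_derivative blinfun_apply (P' y)) (at y)" "C1_map_on (\<phi> ` V) P'"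
    using *(6) by (rule C2_map_onE) (rule that)
  obtain \<phi>' where \<phi>': "\<And>y. y \<in> V \<Longrightarrow> (\<phi> has_derivative blinfun_apply (\<phi>' y)) (at y)" "continuous_on V \<phi>'"
    using C2_map_on_imp_C1[OF *(5)] by (rule C1_map_onE) (rule that)
  have "C2_chart M V \<phi> P S \<phi>' P'" by unfold_locales (use * P' \<phi>' in auto)
  then show ?thesis using that *(2) by blast
qed

context C2_chart
begin

lemma P_\<phi>: "x \<in> V \<Longrightarrow> P (\<phi> x) = x" and \<phi>_P: "y \<in> \<phi> ` V \<Longrightarrow> \<phi> (P y) = y" and P_in: "y \<in> \<phi> ` V \<Longrightarrow> P y \<in> V"
  using homeo unfolding homeomorphism_def by auto

lemma P_in_M_iff:
  assumes y: "y \<in> \<phi> ` V"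
  shows "P y \<in> M \<longleftrightarrow> y \<in> S"
proof -
  show "P y \<in> M \<longleftrightarrow> y \<in> S"
  proof
    assume "P y \<in> M"
    then have "\<phi> (P y) \<in> \<phi> ` (M \<inter> V)" using P_in[OF y] by blast
    then show "y \<in> S" using flat \<phi>_P[OF y] by simp
  next
    assume "y \<in> S"
    then obtain x where "x \<in> M \<inter> V" "y = \<phi> x" using y flat by blast
    then show "P y \<in> M" using P_\<phi> by simp
  qed
qed

lemma \<phi>_in_S: "x \<in> V \<Longrightarrow> x \<in> M \<Longrightarrow> \<phi> x \<in> S"
  using flat imageI[of x "M \<inter> V" \<phi>] by simp

lemma cont_\<phi>: "continuous_on V \<phi>" and cont_P: "continuous_on (\<phi> ` V) P"
  using homeo unfolding homeomorphism_def by auto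

lemma cont_P': "continuous_on (\<phi> ` V) P'"
  using C1_P' by (rule C1_map_on_imp_continuous_on)

lemma C1_P: "C1_map_on (\<phi> ` V) P"
  using P' cont_P' unfolding C1_map_on_def by blast

lemma P'_\<phi>': assumes "x \<in> V" shows "P' (\<phi> x) (\<phi>' x v) = v"
proof -
  have "(P \<circ> \<phi> has_derivative P' (\<phi> x) \<circ> \<phi>' x) (at x)"
    using diff_chain_at[OF \<phi>'[OF assms] P'] assms by blast
  then have "((\<lambda>x. x) has_derivative P' (\<phi> x) \<circ> \<phi>' x) (at x)"
    by (rule has_derivative_transform_within_open[OF _ open_V assms]) (simp add: P_\<phi>)
  then have "P' (\<phi> x) \<circ> \<phi>' x = (\<lambda>x. x)" using has_derivative_ident has_derivative_unique by blast
  then show ?thesis by (metis comp_apply)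
qed

lemma \<phi>'_P': assumes "y \<in> \<phi> ` V" shows "\<phi>' (P y) (P' y v) = v"
proof -
  have "(\<phi> \<circ> P has_derivative \<phi>' (P y) \<circ> P' y) (at y)"
    using diff_chain_at[OF P'[OF assms] \<phi>'[OF P_in[OF assms]]] .
  then have "((\<lambda>x. x) has_derivative \<phi>' (P y) \<circ> P' y) (at y)"
    by (rule has_derivative_transform_within_open[OF _ open_image assms]) (simp add: \<phi>_P)
  then have "\<phi>' (P y) \<circ> P' y = (\<lambda>x. x)" using has_derivative_ident has_derivative_unique by blast
  then show ?thesis by (metis comp_apply)
qed

text \<open>\<open>\<phi>\<close> sends a curve in \<open>M\<close> to a curve in the subspace
  \<open>S\<close>, whose velocity lies in \<open>S\<close>; conversely \<open>P\<close> bends the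
  segment \<open>y + t *\<^sub>R s\<close> into a curve in \<open>M\<close> with velocity
  \<open>P' y s\<close>.\<close>

lemma tangent_space_eq:
  assumes "y \<in> \<phi> ` V" and "y \<in> S"
  shows "tangent_space M (P y) = P' y ` S"
proof (intro equalityI subsetI)
  fix v assume "v \<in> tangent_space M (P y)"
  then obtain \<gamma> \<gamma>' e where *: "e > 0" "\<And>t. \<bar>t\<bar> < e \<Longrightarrow> (\<gamma> has_vector_derivative \<gamma>' t) (at t)"
    "continuous_on {-e<..<e} \<gamma>'" "\<And>t. \<bar>t\<bar> < e \<Longrightarrow> \<gamma> t \<in> M" "\<gamma> 0 = P y" "\<gamma>' 0 = v"
    by (rule tangent_spaceE) (rule that)
  have der: "(\<gamma> has_derivative (\<lambda>h. h *\<^sub>R v)) (at 0)"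
    using *(2)[of 0] *(1,6) by (simp add: has_vector_derivative_def)
  have Py: "P y \<in> V" by (rule P_in[OF assms(1)])
  have cont: "continuous_on {-e<..<e} \<gamma>"
    using has_vector_derivative_continuous[OF *(2)]
    by (intro continuous_at_imp_continuous_on) (auto simp: abs_less_iff)
  define U where "U = \<gamma> -` V \<inter> {-e<..<e}"
  have U: "open U" unfolding U_def using cont continuous_on_open_vimage[of "{-e<..<e}"] open_V by auto
  have "0 \<in> U" using * Py by (simp add: U_def)
  have "(\<phi> \<circ> \<gamma> has_derivative \<phi>' (P y) \<circ> (\<lambda>h. h *\<^sub>R v)) (at 0)"
    using diff_chain_at[OF der, of \<phi>] \<phi>'[OF Py] *(5) by simp
  then have "(\<phi>' (P y) \<circ> (\<lambda>h. h *\<^sub>R v)) 1 \<in> S"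
    by (rule has_derivative_in_subspace[OF _ U \<open>0 \<in> U\<close> _ S]) (use *(4) \<phi>_in_S in \<open>auto simp: U_def abs_less_iff\<close>)
  then have "\<phi>' (P y) v \<in> S" by simp
  moreover have "v = P' y (\<phi>' (P y) v)" using P'_\<phi>'[OF Py, of v] \<phi>_P[OF assms(1)] by simp
  ultimately show "v \<in> P' y ` S" by blast
next
  fix v assume "v \<in> P' y ` S"
  then obtain s where s: "s \<in> S" "v = P' y s" by blast
  have "open ((\<lambda>t. y + t *\<^sub>R s) -` (\<phi> ` V))" by (intro open_vimage open_image continuous_intros)
  moreover have "0 \<in> (\<lambda>t. y + t *\<^sub>R s) -` (\<phi> ` V)" using assms(1) by simp
  ultimately obtain e where ball: "e > 0" "ball 0 e \<subseteq> (\<lambda>t. y + t *\<^sub>R s) -` (\<phi> ` V)"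
    by (rule openE)
  have e: "e > 0" "\<And>t. \<bar>t\<bar> < e \<Longrightarrow> y + t *\<^sub>R s \<in> \<phi> ` V"
    using ball(1) subsetD[OF ball(2)] by (auto simp del: image_iff)
  have "P' (y + 0 *\<^sub>R s) s \<in> tangent_space M (P (y + 0 *\<^sub>R s))"
  proof (rule tangent_spaceI[OF e(1), where \<gamma> = "\<lambda>t. P (y + t *\<^sub>R s)" and \<gamma>' = "\<lambda>t. P' (y + t *\<^sub>R s) s"])
    fix t assume t: "\<bar>t\<bar> < e"
    have "((\<lambda>t. y + t *\<^sub>R s) has_derivative (\<lambda>h. h *\<^sub>R s)) (at t)" by (auto intro!: derivative_eq_intros)
    from has_derivative_compose[OF this P'[OF e(2)[OF t]]]
    show "((\<lambda>t. P (y + t *\<^sub>R s)) has_vector_derivative P' (y + t *\<^sub>R s) s) (at t)"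
      by (simp add: has_vector_derivative_def blinfun.scaleR_right)
    show "P (y + t *\<^sub>R s) \<in> M"
      using P_in_M_iff[OF e(2)[OF t]] assms(2) s S by (simp add: subspace_add subspace_scale)
  next
    show "continuous_on {-e<..<e} (\<lambda>t. P' (y + t *\<^sub>R s) s)"
      using e(2)
      by (intro blinfun.continuous_on continuous_on_const continuous_on_compose2[OF cont_P'] continuous_intros)
        (auto simp: abs_less_iff)
  qed
  then show "v \<in> tangent_space M (P y)" using s by simp
qed

lemma subspace_tangent_space:
  assumes "x \<in> M" and "x \<in> V"
  shows "subspace (tangent_space M x)"
proof -
  have "tangent_space M x = P' (\<phi> x) ` S"
    using tangent_space_eq[of "\<phi> x"] assms P_\<phi> \<phi>_in_S by simp
  then show ?thesis
    using linear_subspace_image[OF bounded_linear.linear[OF blinfun.bounded_linear_right] S] by simp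
qed

context
  fixes xn :: "nat \<Rightarrow> 'a" and x
  assumes xn: "xn \<longlonglongrightarrow> x" "\<And>n. xn n \<in> M" and x: "x \<in> M" "x \<in> V"
begin

lemma eventually_in_chart: "\<forall>\<^sub>F n in sequentially. xn n \<in> V"
  using topological_tendstoD[OF xn(1) open_V x(2)] .

lemma tendsto_\<phi>: "(\<lambda>n. \<phi> (xn n)) \<longlonglongrightarrow> \<phi> x"
  using continuous_on_tendsto_compose[OF cont_\<phi> xn(1) x(2) eventually_in_chart] .

lemma tendsto_P': "(\<lambda>n. P' (\<phi> (xn n))) \<longlonglongrightarrow> P' (\<phi> x)"
  by (rule continuous_on_tendsto_compose[OF cont_P' tendsto_\<phi>])
    (use x eventually_in_chart in \<open>auto elim: eventually_mono\<close>)

lemma tendsto_\<phi>': "(\<lambda>n. \<phi>' (xn n)) \<longlonglongrightarrow> \<phi>' x"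
  using continuous_on_tendsto_compose[OF cont_\<phi>' xn(1) x(2) eventually_in_chart] .

text \<open>The tangent spaces move, but \<open>\<phi>'\<close> takes all of them to the one closed
  subspace \<open>S\<close>.\<close>

lemma tangent_space_limit:
  assumes "\<And>n. v n \<in> tangent_space M (xn n)" and "v \<longlonglongrightarrow> w"
  shows "w \<in> tangent_space M x"
proof -
  have "(\<lambda>n. \<phi>' (xn n) (v n)) \<longlonglongrightarrow> \<phi>' x w"
    by (intro tendsto_intros tendsto_\<phi>' assms)
  moreover have "\<forall>\<^sub>F n in sequentially. \<phi>' (xn n) (v n) \<in> S"
    using eventually_in_chart
  proof eventually_elim
    case (elim n)
    then have "tangent_space M (xn n) = P' (\<phi> (xn n)) ` S"
      using tangent_space_eq[of "\<phi> (xn n)"] xn(2) P_\<phi> \<phi>_in_S by simp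
    then obtain s where s: "s \<in> S" "v n = P' (\<phi> (xn n)) s" using assms(1) by blast
    then show ?case using \<phi>'_P'[of "\<phi> (xn n)" s] elim P_\<phi> by simp
  qed
  ultimately have "\<phi>' x w \<in> S"
    using closed_subspace[OF S] Lim_in_closed_set[of S] by force
  moreover have "w = P' (\<phi> x) (\<phi>' x w)" using P'_\<phi>' x by simp
  moreover have "tangent_space M x = P' (\<phi> x) ` S"
    using tangent_space_eq[of "\<phi> x"] x P_\<phi> \<phi>_in_S by simp
  ultimately show ?thesis by blast
qed

text \<open>Every tangent vector at \<open>x\<close> is the limit of tangent vectors
  \<open>P' (\<phi> (xn n)) s\<close> with the same \<open>s\<close>, so orthogonality passes to the
  limit.\<close>

lemma normal_space_limit:
  assumes "\<And>n. v n \<in> normal_space M (xn n)" and "v \<longlonglongrightarrow> w"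
  shows "w \<in> normal_space M x"
  unfolding normal_space_iff
proof
  fix t assume "t \<in> tangent_space M x"
  then obtain s where s: "s \<in> S" "t = P' (\<phi> x) s" 
    using tangent_space_eq[of "\<phi> x"] x P_\<phi> \<phi>_in_S by auto
  have "(\<lambda>n. v n \<bullet> P' (\<phi> (xn n)) s) \<longlonglongrightarrow> w \<bullet> P' (\<phi> x) s"
    by (intro tendsto_intros tendsto_P' assms)
  moreover have "\<forall>\<^sub>F n in sequentially. v n \<bullet> P' (\<phi> (xn n)) s = 0"
    using eventually_in_chart
  proof eventually_elim
    case (elim n)
    then have "P' (\<phi> (xn n)) s \<in> tangent_space M (xn n)"
      using tangent_space_eq[of "\<phi> (xn n)"] xn(2) P_\<phi> \<phi>_in_S s by simp
    then show ?case using assms(1) by (simp add: normal_space_iff)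
  qed
  ultimately show "w \<bullet> t = 0"
    unfolding s(2) using tendsto_cong[of "\<lambda>n. v n \<bullet> P' (\<phi> (xn n)) s" "\<lambda>_. 0" sequentially]
    by (metis LIMSEQ_const_iff)
qed

text \<open>The projections are bounded, and a cluster point \<open>q\<close> is tangent with
  \<open>w - q\<close> normal, which characterizes the projection of \<open>w\<close>. Convergence
  of the full sequence follows in \<open>tendsto_tproj\<close>.\<close>

lemma tproj_limit:
  assumes sub: "\<And>n. subspace (tangent_space M (xn n))" and "v \<longlonglongrightarrow> w"
  shows "\<exists>r. strict_mono r \<and> (\<lambda>n. tproj M (xn (r n)) (v (r n))) \<longlonglongrightarrow> tproj M x w"
proof -
  define p where "p n = tproj M (xn n) (v n)" for n
  have p: "p n \<in> tangent_space M (xn n)" "v n - p n \<in> normal_space M (xn n)" for n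
    using closest_point_subspace[OF sub] by (auto simp: p_def tproj_def normal_space_iff)
  obtain B where B: "\<And>n. norm (v n) \<le> B"
    using convergent_imp_Bseq[of v] assms(2) convergent_def unfolding Bseq_def by blast
  have "p n \<in> cball 0 B" for n
    using norm_closest_point_subspace_le[OF sub[of n], of "v n"] B[of n] by (simp add: p_def tproj_def)
  then obtain q r where r: "strict_mono r" "(p \<circ> r) \<longlonglongrightarrow> q"
    using compact_cball[of 0 B] unfolding compact_def by metis
  have xr: "(\<lambda>n. xn (r n)) \<longlonglongrightarrow> x" and vr: "(\<lambda>n. v (r n)) \<longlonglongrightarrow> w"
    using LIMSEQ_subseq_LIMSEQ[OF xn(1) r(1)] LIMSEQ_subseq_LIMSEQ[OF assms(2) r(1)] by (auto simp: o_def)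
  have pr: "(\<lambda>n. p (r n)) \<longlonglongrightarrow> q" using r(2) by (simp add: o_def)
  have "q \<in> tangent_space M x"
    using C2_chart.tangent_space_limit[OF C2_chart_axioms xr xn(2) x, of "\<lambda>n. p (r n)"] p pr by blast
  moreover have "w - q \<in> normal_space M x"
    using C2_chart.normal_space_limit[OF C2_chart_axioms xr xn(2) x, of "\<lambda>n. v (r n) - p (r n)"]
      p tendsto_diff[OF vr pr] by blast
  ultimately have "tproj M x w = q"
    unfolding tproj_def
    by (intro closest_point_subspace_eq subspace_tangent_space x) (auto simp: normal_space_iff)
  then show ?thesis using r(1) pr unfolding p_def by blast
qed

end

end

section \<open>Regular subgradients and partial smoothness\<close>

lemma regular_normals_scale:
  assumes "v \<in> regular_normals C x" and "c \<ge> 0"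
  shows "c *\<^sub>R v \<in> regular_normals C x"
  unfolding regular_normals_def
proof (intro CollectI allI impI)
  fix e :: real assume e: "e > 0"
  then have "e / (c + 1) > 0" using assms(2) by simp
  then obtain d where d: "d > 0" "\<And>y. y \<in> C \<Longrightarrow> dist y x < d \<Longrightarrow> v \<bullet> (y - x) \<le> e / (c + 1) * norm (y - x)"
    using assms(1) unfolding regular_normals_def by blast
  have "c *\<^sub>R v \<bullet> (y - x) \<le> e * norm (y - x)" if "y \<in> C" "dist y x < d" for y
  proof -
    have "c *\<^sub>R v \<bullet> (y - x) \<le> c * (e / (c + 1) * norm (y - x))"
      using mult_left_mono[OF d(2)[OF that] assms(2)] by simp
    also have "\<dots> = (c / (c + 1)) * (e * norm (y - x))" by simp
    also have "\<dots> \<le> 1 * (e * norm (y - x))" using assms(2) e by (intro mult_right_mono) auto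
    finally show ?thesis by simp
  qed
  then show "\<exists>d>0. \<forall>y\<in>C. dist y x < d \<longrightarrow> c *\<^sub>R v \<bullet> (y - x) \<le> e * norm (y - x)" using d(1) by blast
qed

lemma regular_normals_add:
  assumes "v \<in> regular_normals C x" and "w \<in> regular_normals C x"
  shows "v + w \<in> regular_normals C x"
  unfolding regular_normals_def
proof (intro CollectI allI impI)
  fix e :: real assume "e > 0"
  then have e: "e / 2 > 0" by simp
  obtain d where d: "d > 0" "\<And>y. y \<in> C \<Longrightarrow> dist y x < d \<Longrightarrow> v \<bullet> (y - x) \<le> e / 2 * norm (y - x)"
    using assms(1) e unfolding regular_normals_def by blast
  obtain d' where d': "d' > 0" "\<And>y. y \<in> C \<Longrightarrow> dist y x < d' \<Longrightarrow> w \<bullet> (y - x) \<le> e / 2 * norm (y - x)"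
    using assms(2) e unfolding regular_normals_def by blast
  have "(v + w) \<bullet> (y - x) \<le> e * norm (y - x)" if "y \<in> C" "dist y x < min d d'" for y
    using d(2)[of y] d'(2)[of y] that by (simp add: inner_add_left)
  then show "\<exists>d>0. \<forall>y\<in>C. dist y x < d \<longrightarrow> (v + w) \<bullet> (y - x) \<le> e * norm (y - x)"
    using d(1) d'(1) by (metis min_less_iff_conj)
qed

lemma regular_subdiffE:
  assumes "v \<in> regular_subdiff h x"
  obtains hx where "h x = ereal hx"
    and "\<And>e. e > 0 \<Longrightarrow> \<exists>d>0. \<forall>y. dist y x < d \<longrightarrow> ereal (hx + v \<bullet> (y - x) - e * norm (y - x)) \<le> h y"
proof -
  obtain hx where hx: "h x = ereal hx" using assms unfolding regular_subdiff_def by auto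
  show ?thesis
  proof (rule that[OF hx])
    fix e :: real assume "e > 0"
    then obtain d where "d > 0" "\<And>y. dist y x < d \<Longrightarrow> h x + ereal (v \<bullet> (y - x) - e * norm (y - x)) \<le> h y"
      using assms unfolding regular_subdiff_def by blast
    then show "\<exists>d>0. \<forall>y. dist y x < d \<longrightarrow> ereal (hx + v \<bullet> (y - x) - e * norm (y - x)) \<le> h y"
      by (intro exI[of _ d]) (auto simp: hx add_diff_eq)
  qed
qed

lemma regular_subdiffD:
  assumes "v \<in> regular_subdiff h x" and "h x = ereal hx" and "e > 0"
  shows "\<exists>d>0. \<forall>y. dist y x < d \<longrightarrow> ereal (hx + v \<bullet> (y - x) - e * norm (y - x)) \<le> h y"
  by (rule regular_subdiffE[OF assms(1)]) (use assms in simp)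

lemma regular_subdiffI:
  assumes "h x = ereal hx"
    and "\<And>e. e > 0 \<Longrightarrow> \<exists>d>0. \<forall>y. dist y x < d \<longrightarrow> ereal (hx + v \<bullet> (y - x) - e * norm (y - x)) \<le> h y"
  shows "v \<in> regular_subdiff h x"
  using assms unfolding regular_subdiff_def by (auto simp: add_diff_eq)

lemma regular_subdiff_imp_normal:
  assumes "v \<in> regular_subdiff h x"
  shows "(v, -1) \<in> regular_normals (epi h) (x, real_of_ereal (h x))"
proof -
  obtain hx where hx: "h x = ereal hx"
    "\<And>e. e > 0 \<Longrightarrow> \<exists>d>0. \<forall>y. dist y x < d \<longrightarrow> ereal (hx + v \<bullet> (y - x) - e * norm (y - x)) \<le> h y"
    using assms by (rule regular_subdiffE) (rule that)
  show ?thesis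
    unfolding regular_normals_def
  proof (intro CollectI allI impI)
    fix e :: real assume e: "e > 0"
    obtain d where d: "d > 0" "\<And>y. dist y x < d \<Longrightarrow> ereal (hx + v \<bullet> (y - x) - e * norm (y - x)) \<le> h y"
      using hx(2)[OF e] by blast
    have "(v, -1) \<bullet> (p - (x, hx)) \<le> e * norm (p - (x, hx))" if p: "p \<in> epi h" "dist p (x, hx) < d" for p
    proof -
      obtain y r where yr: "p = (y, r)" by (cases p)
      have "dist y x < d" using p(2) dist_fst_le[of p "(x, hx)"] by (simp add: yr)
      then have "ereal (hx + v \<bullet> (y - x) - e * norm (y - x)) \<le> ereal r"
        using d(2) p(1) order_trans unfolding yr epi_def by blast
      then have "(v, -1) \<bullet> (p - (x, hx)) \<le> e * norm (y - x)" by (simp add: yr)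
      also have "\<dots> \<le> e * norm (p - (x, hx))"
        using norm_fst_le[of "y - x" "r - hx"] e by (intro mult_left_mono) (auto simp: yr)
      finally show ?thesis .
    qed
    then show "\<exists>d>0. \<forall>p\<in>epi h. dist p (x, real_of_ereal (h x)) < d \<longrightarrow>
        (v, -1) \<bullet> (p - (x, real_of_ereal (h x))) \<le> e * norm (p - (x, real_of_ereal (h x)))"
      using d(1) by (auto simp: hx(1))
  qed
qed

text \<open>If the minorant exceeded \<open>h\<close> at \<open>y\<close>, the point of its graph
  over \<open>y\<close> would lie in the epigraph. There the normal inequality gives
  \<open>e * norm (y - x) \<le> e / 2 * norm (y - x)\<close>, so \<open>y = x\<close>, where the
  minorant equals \<open>h\<close>.\<close>

lemma normal_imp_regular_subdiff:
  assumes "(v, -1) \<in> regular_normals (epi h) (x, hx)" and hx: "h x = ereal hx"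
  shows "v \<in> regular_subdiff h x"
proof (rule regular_subdiffI[where h = h and x = x, OF hx])
  fix e :: real assume e: "e > 0"
  \<comment> \<open>\<open>K\<close> bounds the distance of that graph point from
    \<open>(x, hx)\<close> in units of \<open>norm (y - x)\<close>.\<close>
  define K where "K = 1 + norm v + e"
  have K: "K > 0" using e by (simp add: K_def add_pos_nonneg add_nonneg_pos)
  have "e / (2 * K) > 0" using e K by simp
  then obtain d where d: "d > 0" "\<And>p. p \<in> epi h \<Longrightarrow> dist p (x, hx) < d \<Longrightarrow>
      (v, -1) \<bullet> (p - (x, hx)) \<le> e / (2 * K) * norm (p - (x, hx))"
    using assms(1) unfolding regular_normals_def by blast
  have "ereal (hx + v \<bullet> (y - x) - e * norm (y - x)) \<le> h y" if y: "dist y x < d / K" for y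
  proof (rule ccontr)
    define r where "r = hx + v \<bullet> (y - x) - e * norm (y - x)"
    assume "\<not> ereal (hx + v \<bullet> (y - x) - e * norm (y - x)) \<le> h y"
    then have less: "h y < ereal r" by (simp add: r_def)
    then have epi: "(y, r) \<in> epi h" by (simp add: epi_def)
    have "\<bar>r - hx\<bar> \<le> \<bar>v \<bullet> (y - x)\<bar> + \<bar>e * norm (y - x)\<bar>"
      unfolding r_def by linarith
    also have "\<dots> \<le> norm v * norm (y - x) + e * norm (y - x)"
      using Cauchy_Schwarz_ineq2[of v "y - x"] e by simp
    finally have "norm ((y, r) - (x, hx)) \<le> K * norm (y - x)"
      using norm_Pair_le[of "y - x" "r - hx"] by (simp add: K_def algebra_simps)
    moreover have "K * norm (y - x) < d" using y K by (simp add: dist_norm field_simps)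
    ultimately have "(v, -1) \<bullet> ((y, r) - (x, hx)) \<le> e / (2 * K) * (K * norm (y - x))"
      using d(2)[OF epi] e K
      by (smt (verit) dist_norm divide_nonneg_pos mult_left_mono mult_pos_pos)
    then have "e * norm (y - x) \<le> e / 2 * norm (y - x)" using K by (simp add: r_def)
    then have "y = x" using e by (simp add: mult_le_cancel_right)
    then show False using less hx by (simp add: r_def)
  qed
  then show "\<exists>d>0. \<forall>y. dist y x < d \<longrightarrow> ereal (hx + v \<bullet> (y - x) - e * norm (y - x)) \<le> h y"
    using d(1) K by (intro exI[of _ "d / K"]) auto
qed

text \<open>A limiting subgradient \<open>v\<close> makes \<open>(v, -1)\<close> a limiting normal
  of the epigraph, which regularity turns into a regular one. This gives \<open>subdiff\<close> the
  convexity and closedness of \<open>regular_subdiff\<close>, on which nearest points and separation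
  rest.\<close>

lemma subdiff_eq_regular_subdiff:
  assumes "regular_fun_at h x"
  shows "subdiff h x = regular_subdiff h x"
proof (intro equalityI subsetI)
  fix v assume "v \<in> subdiff h x"
  then obtain xs vs where seq: "\<bar>h x\<bar> \<noteq> \<infinity>" "\<forall>n. vs n \<in> regular_subdiff h (xs n)" "xs \<longlonglongrightarrow> x"
    "(\<lambda>n. h (xs n)) \<longlonglongrightarrow> h x" "vs \<longlonglongrightarrow> v"
    unfolding subdiff_def by (elim CollectE conjE exE) (rule that)
  note * = seq(1) seq(2)[rule_format] seq(3-)
  obtain hx where hx: "h x = ereal hx" using *(1) by auto
  define rs where "rs n = real_of_ereal (h (xs n))" for n
  have rs: "h (xs n) = ereal (rs n)" for n
    by (rule regular_subdiffE[OF *(2)[of n]]) (simp add: rs_def)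
  have "rs \<longlonglongrightarrow> hx" using *(4) unfolding hx rs by simp
  have "(v, -1) \<in> general_normals (epi h) (x, hx)"
    unfolding general_normals_def
  proof (rule CollectI, rule exI[of _ "\<lambda>n. (xs n, rs n)"], rule exI[of _ "\<lambda>n. (vs n, -1)"], intro conjI allI)
    fix n
    show "(xs n, rs n) \<in> epi h" by (simp add: epi_def rs)
    show "(vs n, -1) \<in> regular_normals (epi h) (xs n, rs n)"
      by (rule regular_subdiff_imp_normal[OF *(2), folded rs_def])
  next
    show "(\<lambda>n. (xs n, rs n)) \<longlonglongrightarrow> (x, hx)" by (rule tendsto_Pair[OF *(3) \<open>rs \<longlonglongrightarrow> hx\<close>])
    show "(\<lambda>n. (vs n, - 1)) \<longlonglongrightarrow> (v, - 1 :: real)" by (rule tendsto_Pair[OF *(5) tendsto_const])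
  qed
  then have "(v, -1) \<in> regular_normals (epi h) (x, hx)"
    using assms hx unfolding regular_fun_at_def regular_set_at_def by simp
  then show "v \<in> regular_subdiff h x" using hx by (rule normal_imp_regular_subdiff)
next
  fix v assume v: "v \<in> regular_subdiff h x"
  then have "\<bar>h x\<bar> \<noteq> \<infinity>" by (rule regular_subdiffE) simp
  then show "v \<in> subdiff h x"
    unfolding subdiff_def using v by (intro CollectI conjI exI[of _ "\<lambda>_. x"] exI[of _ "\<lambda>_. v"]) auto
qed

lemma convex_regular_subdiff: "convex (regular_subdiff h x)"
proof (rule convexI)
  fix v w and a b :: real
  assume v: "v \<in> regular_subdiff h x" and w: "w \<in> regular_subdiff h x" and ab: "0 \<le> a" "0 \<le> b" "a + b = 1"
  obtain hx where hx: "h x = ereal hx"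
    "\<And>e. e > 0 \<Longrightarrow> \<exists>d>0. \<forall>y. dist y x < d \<longrightarrow> ereal (hx + v \<bullet> (y - x) - e * norm (y - x)) \<le> h y"
    using v by (rule regular_subdiffE) (rule that)
  note hw = regular_subdiffD[OF w hx(1)]
  show "a *\<^sub>R v + b *\<^sub>R w \<in> regular_subdiff h x"
  proof (rule regular_subdiffI[where h = h and x = x, OF hx(1)])
    fix e :: real assume e: "e > 0"
    obtain d where d: "d > 0" "\<And>y. dist y x < d \<Longrightarrow> ereal (hx + v \<bullet> (y - x) - e * norm (y - x)) \<le> h y"
      using hx(2)[OF e] by blast
    obtain d' where d': "d' > 0" "\<And>y. dist y x < d' \<Longrightarrow> ereal (hx + w \<bullet> (y - x) - e * norm (y - x)) \<le> h y"
      using hw[OF e] by blast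
    have "ereal (hx + (a *\<^sub>R v + b *\<^sub>R w) \<bullet> (y - x) - e * norm (y - x)) \<le> h y" if "dist y x < min d d'" for y
    proof -
      let ?p = "hx + v \<bullet> (y - x) - e * norm (y - x)" and ?q = "hx + w \<bullet> (y - x) - e * norm (y - x)"
      have b: "b = 1 - a" using ab by simp
      have "hx + (a *\<^sub>R v + b *\<^sub>R w) \<bullet> (y - x) - e * norm (y - x) = a * ?p + b * ?q"
        unfolding b by (simp add: inner_add_left algebra_simps)
      also have "\<dots> \<le> max ?p ?q" by (rule convex_bound_le) (use ab in auto)
      finally show ?thesis using d(2)[of y] d'(2)[of y] that
        by (smt (verit) ereal_less_eq(3) max_def min_less_iff_conj order_trans)
    qed
    then show "\<exists>d>0. \<forall>y. dist y x < d \<longrightarrow> ereal (hx + (a *\<^sub>R v + b *\<^sub>R w) \<bullet> (y - x) - e * norm (y - x)) \<le> h y"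
      using d(1) d'(1) by (intro exI[of _ "min d d'"]) auto
  qed
qed

lemma closed_regular_subdiff: "closed (regular_subdiff h x)"
  unfolding closed_sequential_limits
proof (intro allI impI, elim conjE)
  fix vs v assume vs: "\<forall>n. vs n \<in> regular_subdiff h x" "vs \<longlonglongrightarrow> v"
  obtain hx where hx: "h x = ereal hx"
    using vs(1)[rule_format, of 0] by (rule regular_subdiffE) (rule that)
  show "v \<in> regular_subdiff h x"
  proof (rule regular_subdiffI[where h = h and x = x, OF hx])
    fix e :: real assume "e > 0"
    then have e: "e / 2 > 0" by simp
    then obtain n where n: "norm (vs n - v) < e / 2"
      using LIMSEQ_D[OF vs(2) e] by blast
    have "\<exists>d>0. \<forall>y. dist y x < d \<longrightarrow> ereal (hx + vs n \<bullet> (y - x) - e / 2 * norm (y - x)) \<le> h y"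
      by (rule regular_subdiffD[OF vs(1)[rule_format] hx e])
    then obtain d where d: "d > 0" "\<And>y. dist y x < d \<Longrightarrow> ereal (hx + vs n \<bullet> (y - x) - e / 2 * norm (y - x)) \<le> h y"
      by blast
    have "ereal (hx + v \<bullet> (y - x) - e * norm (y - x)) \<le> h y" if "dist y x < d" for y
    proof -
      have "v \<bullet> (y - x) - vs n \<bullet> (y - x) \<le> norm (vs n - v) * norm (y - x)"
        using Cauchy_Schwarz_ineq2[of "vs n - v" "y - x"] by (simp add: inner_diff_left)
      also have "\<dots> \<le> e / 2 * norm (y - x)" using n by (intro mult_right_mono) auto
      finally have "ereal (hx + v \<bullet> (y - x) - e * norm (y - x)) \<le> ereal (hx + vs n \<bullet> (y - x) - e / 2 * norm (y - x))"
        by simp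
      then show ?thesis using d(2)[OF that] order_trans by blast
    qed
    then show "\<exists>d>0. \<forall>y. dist y x < d \<longrightarrow> ereal (hx + v \<bullet> (y - x) - e * norm (y - x)) \<le> h y"
      using d(1) by blast
  qed
qed

lemma has_derivative_quotient_at_right:
  assumes "(F has_derivative F') (at x)"
  shows "((\<lambda>s. (F (x + s *\<^sub>R h) - F x) /\<^sub>R s) \<longlongrightarrow> F' h) (at_right 0)"
proof -
  have line: "((\<lambda>s. x + s *\<^sub>R h) has_derivative (\<lambda>s. s *\<^sub>R h)) (at 0)" by (auto intro!: derivative_eq_intros)
  have F': "(F has_derivative F') (at (x + 0 *\<^sub>R h))" using assms by simp
  have "((\<lambda>s. F (x + s *\<^sub>R h)) has_derivative (\<lambda>s. F' (s *\<^sub>R h))) (at 0)"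
    by (rule has_derivative_compose[OF line F'])
  from has_derivative_at_withinI[OF this, of "{0<..}"]
  have "((\<lambda>s. (F (x + s *\<^sub>R h) - F (x + 0 *\<^sub>R h) - F' ((s - 0) *\<^sub>R h)) /\<^sub>R norm (s - 0)) \<longlongrightarrow> 0) (at_right 0)"
    unfolding has_derivative_at_within by blast
  from tendsto_add[OF this tendsto_const[of "F' h"]]
  have "((\<lambda>s. (F (x + s *\<^sub>R h) - F (x + 0 *\<^sub>R h) - F' ((s - 0) *\<^sub>R h)) /\<^sub>R norm (s - 0) + F' h) \<longlongrightarrow> F' h) (at_right 0)"
    by simp
  then show ?thesis
    by (rule Lim_transform_eventually)
      (use eventually_at_right_less[of 0] in eventually_elim,
        simp add: linear_cmul[OF has_derivative_linear[OF assms]] scaleR_right_diff_distrib)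
qed

text \<open>Along a curve in \<open>M\<close> with velocity \<open>t\<close> the subgradient
  inequality compares differentiable functions of \<open>s\<close>; dividing by \<open>s\<close> and
  letting it tend to 0 from the right leaves an error of \<open>e * norm t\<close>. Used for
  \<open>t\<close> and \<open>- t\<close>, the estimate fixes the tangential part of a
  subgradient.\<close>

lemma regular_subdiff_tangent_le:
  assumes v: "v \<in> regular_subdiff h x" and "open V" and "x \<in> V"
    and k: "\<And>y. y \<in> M \<inter> V \<Longrightarrow> h y = ereal (k y)" and k': "(k has_derivative k') (at x)"
    and t: "t \<in> tangent_space M x"
  shows "v \<bullet> t \<le> k' t"
proof -
  obtain \<gamma> \<gamma>' e0 where *: "e0 > 0" "\<And>t. \<bar>t\<bar> < e0 \<Longrightarrow> (\<gamma> has_vector_derivative \<gamma>' t) (at t)"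
    "continuous_on {-e0<..<e0} \<gamma>'" "\<And>t. \<bar>t\<bar> < e0 \<Longrightarrow> \<gamma> t \<in> M" "\<gamma> 0 = x" "\<gamma>' 0 = t"
    using t by (rule tangent_spaceE) (rule that)
  have \<gamma>: "(\<gamma> has_derivative (\<lambda>s. s *\<^sub>R t)) (at 0)"
    using *(2)[of 0] *(1,6) by (simp add: has_vector_derivative_def)
  have hx: "h x = ereal (k x)" using k[of x] *(1,4,5) assms(3) by (metis IntI abs_zero)
  define F where "F s = k (\<gamma> s) - v \<bullet> (\<gamma> s - x) - k x" for s
  have k0: "(k has_derivative k') (at (\<gamma> 0))" using k' *(5) by simp
  have "((\<lambda>s. k (\<gamma> s)) has_derivative (\<lambda>s. k' (s *\<^sub>R t))) (at 0)"
    by (rule has_derivative_compose[OF \<gamma> k0])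
  then have "(F has_derivative (\<lambda>s. k' (s *\<^sub>R t) - v \<bullet> (s *\<^sub>R t))) (at 0)"
    unfolding F_def by (auto intro!: derivative_eq_intros \<gamma>)
  then have "(F has_real_derivative (k' t - v \<bullet> t)) (at 0)"
    by (rule has_derivative_imp_has_field_derivative)
      (simp add: linear_cmul[OF has_derivative_linear[OF k']] algebra_simps)
  then have "(\<lambda>s. (F (0 + s) - F 0) / s) \<midarrow>0\<rightarrow> k' t - v \<bullet> t" unfolding DERIV_def .
  then have F: "((\<lambda>s. F s / s) \<longlongrightarrow> k' t - v \<bullet> t) (at_right 0)"
    by (simp add: F_def *(5) filterlim_at_split)
  have q: "((\<lambda>s. (\<gamma> s - x) /\<^sub>R s) \<longlongrightarrow> t) (at_right 0)"
    using has_derivative_quotient_at_right[OF \<gamma>, of 1] by (simp add: *(5))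
  have cont: "(\<gamma> \<longlongrightarrow> x) (at_right 0)"
    using has_derivative_continuous[OF \<gamma>] *(5) unfolding isCont_def by (simp add: filterlim_at_split)
  have "- (e * norm t) \<le> k' t - v \<bullet> t" if e: "e > 0" for e
  proof -
    obtain d where d: "d > 0" "\<And>y. dist y x < d \<Longrightarrow> ereal (k x + v \<bullet> (y - x) - e * norm (y - x)) \<le> h y"
      using regular_subdiffD[OF v hx e] by blast
    have "\<forall>\<^sub>F s in at_right 0. s < e0" using *(1) by (rule eventually_at_right_real[THEN eventually_mono]) auto
    moreover have "\<forall>\<^sub>F s in at_right 0. (0::real) < s" by (rule eventually_at_right_less)
    moreover have "\<forall>\<^sub>F s in at_right 0. dist (\<gamma> s) x < d" using tendstoD[OF cont d(1)] .
    moreover have "\<forall>\<^sub>F s in at_right 0. \<gamma> s \<in> V" using topological_tendstoD[OF cont assms(2,3)] .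
    ultimately have "\<forall>\<^sub>F s in at_right 0. - (e * norm ((\<gamma> s - x) /\<^sub>R s)) \<le> F s / s"
    proof eventually_elim
      case (elim s)
      have "h (\<gamma> s) = ereal (k (\<gamma> s))" using k *(4)[of s] elim by auto
      then have "- (e * norm (\<gamma> s - x)) \<le> F s" using d(2)[of "\<gamma> s"] elim by (simp add: F_def)
      then have "- (e * norm (\<gamma> s - x)) / s \<le> F s / s" using elim by (intro divide_right_mono) auto
      then show ?case using elim by (simp add: divide_inverse mult_ac)
    qed
    then show ?thesis
      by (rule tendsto_le[OF trivial_limit_at_right_real F tendsto_minus[OF tendsto_mult[OF tendsto_const tendsto_norm[OF q]]]])
  qed
  then have le: "- (k' t - v \<bullet> t) \<le> e * norm t" if "e > 0" for e
    using \<open>\<And>e. e > 0 \<Longrightarrow> - (e * norm t) \<le> k' t - v \<bullet> t\<close>[OF that] by linarith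
  have "- (k' t - v \<bullet> t) \<le> e" if "e > 0" for e
  proof -
    have n: "norm t + 1 > 0" by (simp add: add_nonneg_pos)
    have "- (k' t - v \<bullet> t) \<le> e / (norm t + 1) * norm t" using le[of "e / (norm t + 1)"] that n by simp
    also have "\<dots> \<le> e / (norm t + 1) * (norm t + 1)" using that n by (intro mult_left_mono) auto
    finally show ?thesis using n by simp
  qed
  then have "- (k' t - v \<bullet> t) \<le> 0" by (rule field_le_epsilon[of _ 0, simplified])
  then show ?thesis by simp
qed

section \<open>Parallel subspaces and identification of nearby subgradients\<close>

lemma par_properties:
  assumes "A \<noteq> {}"
  shows "subspace (par A)" and "affine_parallel (affine hull A) (par A)"
proof -
  have "\<exists>!L. subspace L \<and> affine_parallel (affine hull A) L"
    using affine_parallel_subspace[of "affine hull A"] assms by (simp add: affine_affine_hull)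
  from theI'[OF this] show "subspace (par A)" and "affine_parallel (affine hull A) (par A)"
    unfolding par_def by auto
qed

lemma diff_in_par:
  assumes "v \<in> A" and "w \<in> A"
  shows "v - w \<in> par A"
proof -
  have ne: "A \<noteq> {}" using assms by blast
  obtain a where "par A = (\<lambda>x. a + x) ` (affine hull A)"
    using par_properties(2)[OF ne] unfolding affine_parallel_def by blast
  then have "a + v \<in> par A" "a + w \<in> par A" using assms by (auto simp: hull_inc)
  from subspace_diff[OF par_properties(1)[OF ne] this] show ?thesis by simp
qed

lemma add_par_in_affine_hull:
  assumes "v \<in> A" and "d \<in> par A"
  shows "v + d \<in> affine hull A"
proof -
  have ne: "A \<noteq> {}" using assms by blast
  obtain a where a: "par A = (\<lambda>x. a + x) ` (affine hull A)"
    using par_properties(2)[OF ne] unfolding affine_parallel_def by blast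
  then have "a + v \<in> par A" using assms by (auto simp: hull_inc)
  from subspace_add[OF par_properties(1)[OF ne] this assms(2)] show ?thesis
    unfolding a by (auto simp: image_iff algebra_simps)
qed

lemma setmap_continuous_atD:
  assumes "setmap_continuous_at F M x" and "\<And>n. xs n \<in> M" and "xs \<longlonglongrightarrow> x" and "v \<in> F x"
  shows "\<exists>vs. (\<forall>\<^sub>F n in sequentially. vs n \<in> F (xs n)) \<and> vs \<longlonglongrightarrow> v"
  using assms(1)[unfolded setmap_continuous_at_def, THEN spec, of xs] assms(2-4) by simp

text \<open>If \<open>q\<^sub>n\<close> missed \<open>\<partial>h(p\<^sub>n)\<close> for all \<open>n\<close>, the unit normals separating them would accumulate at a
  direction in which \<open>\<partial>h(p)\<close> does not extend beyond the limit \<open>q\<close>.\<close>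

lemma partly_smooth_identification:
  fixes h :: "'a::euclidean_space \<Rightarrow> ereal"
  assumes "C2_manifold_around d M p" and cont: "setmap_continuous_at (subdiff h) M p" and p: "p \<in> M"
    and pn: "\<And>n. pn n \<in> M" "pn \<longlonglongrightarrow> p"
    and sub: "\<And>n. convex (subdiff h (pn n))" "\<And>n. closed (subdiff h (pn n))"
    and N: "\<And>n. normal_space M (pn n) = par (subdiff h (pn n))"
    and c: "\<And>n. c n \<in> subdiff h (pn n)" and qc: "\<And>n. qn n - c n \<in> normal_space M (pn n)"
    and q: "qn \<longlonglongrightarrow> q" "\<And>a. a \<in> normal_space M p \<Longrightarrow> \<exists>\<epsilon>>0. q + \<epsilon> *\<^sub>R a \<in> subdiff h p"
  shows "\<exists>n. qn n \<in> subdiff h (pn n)"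
proof (rule ccontr)
  assume "\<nexists>n. qn n \<in> subdiff h (pn n)"
  then have no: "\<And>n. qn n \<notin> subdiff h (pn n)" by blast
  obtain V \<phi> P S \<phi>' P' where chart: "C2_chart M V \<phi> P S \<phi>' P'" and pV: "p \<in> V"
    using C2_manifold_around_chart[OF assms(1)] by blast
  define c' where "c' n = closest_point (subdiff h (pn n)) (qn n)" for n
  define a where "a n = (qn n - c' n) /\<^sub>R norm (qn n - c' n)" for n
  have c': "c' n \<in> subdiff h (pn n)" for n
    unfolding c'_def by (rule closest_point_in_set[OF sub(2)]) (use c in blast)
  have pos: "norm (qn n - c' n) > 0" for n using no[of n] c'[of n] by (metis right_minus_eq zero_less_norm_iff)
  have norm_a: "norm (a n) = 1" for n using pos[of n] by (simp add: a_def)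
  have subN: "subspace (normal_space M (pn n))" for n
    unfolding normal_space_def by (rule subspace_orthogonal_comp)
  \<comment> \<open>The normal space is parallel to the affine hull of the subdifferential, so
    passing from the reference subgradient \<open>c n\<close> to the nearest point
    \<open>c' n\<close> changes the residual only by a normal vector.\<close>
  have aN: "a n \<in> normal_space M (pn n)" for n
  proof -
    have "c n - c' n \<in> normal_space M (pn n)" unfolding N by (rule diff_in_par[OF c c'])
    from subspace_add[OF subN qc this] show ?thesis
      unfolding a_def by (intro subspace_scale[OF subN]) simp
  qed
  have sep: "a n \<bullet> (y - qn n) \<le> 0" if "y \<in> subdiff h (pn n)" for n y
  proof -
    have "(qn n - c' n) \<bullet> (y - c' n) \<le> 0"
      unfolding c'_def by (rule closest_point_dot[OF sub that])
    moreover have "(qn n - c' n) \<bullet> (c' n - qn n) \<le> 0"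
      by (metis inner_ge_zero inner_minus_right minus_diff_eq neg_le_0_iff_le)
    ultimately have "(qn n - c' n) \<bullet> (y - qn n) \<le> 0" by (simp add: inner_diff_right)
    then show ?thesis using pos[of n] by (simp add: a_def mult_le_0_iff)
  qed
  have "a n \<in> sphere 0 1" for n using norm_a by simp
  then obtain b r where r: "strict_mono r" "(a \<circ> r) \<longlonglongrightarrow> b"
    using compact_sphere[of 0 1] unfolding compact_def by metis
  have ar: "(\<lambda>n. a (r n)) \<longlonglongrightarrow> b" using r(2) by (simp add: o_def)
  have pr: "(\<lambda>n. pn (r n)) \<longlonglongrightarrow> p" and qr: "(\<lambda>n. qn (r n)) \<longlonglongrightarrow> q"
    using LIMSEQ_subseq_LIMSEQ[OF pn(2) r(1)] LIMSEQ_subseq_LIMSEQ[OF q(1) r(1)] by (auto simp: o_def)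
  have "norm b = 1" using tendsto_norm[OF ar] norm_a by (simp add: LIMSEQ_const_iff)
  have "b \<in> normal_space M p"
    by (rule C2_chart.normal_space_limit[OF chart pr pn(1) p pV aN ar])
  then obtain \<epsilon> where \<epsilon>: "\<epsilon> > 0" "q + \<epsilon> *\<^sub>R b \<in> subdiff h p" using q(2) by blast
  \<comment> \<open>Inner semicontinuity supplies subgradients reaching beyond \<open>q\<close> in
    direction \<open>b\<close>, while \<open>sep\<close> lets none of them pass \<open>qn\<close> in
    direction \<open>a\<close>.\<close>
  obtain vs where vs: "\<forall>\<^sub>F n in sequentially. vs n \<in> subdiff h (pn (r n))" "vs \<longlonglongrightarrow> q + \<epsilon> *\<^sub>R b"
    using setmap_continuous_atD[OF cont pn(1) pr \<epsilon>(2)] by blast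
  have "(\<lambda>n. a (r n) \<bullet> (vs n - qn (r n))) \<longlonglongrightarrow> b \<bullet> (q + \<epsilon> *\<^sub>R b - q)"
    by (intro tendsto_intros ar vs qr)
  moreover have "\<forall>\<^sub>F n in sequentially. a (r n) \<bullet> (vs n - qn (r n)) \<le> 0"
    using vs(1) by eventually_elim (rule sep)
  ultimately have "b \<bullet> (q + \<epsilon> *\<^sub>R b - q) \<le> 0"
    using tendsto_upperbound by (metis trivial_limit_sequentially)
  then show False using \<epsilon>(1) \<open>norm b = 1\<close> by (simp add: dot_square_norm)
qed

section \<open>Partial subgradients\<close>

lemma lsc_fun_iff: "lsc_fun h \<longleftrightarrow> (\<forall>p c. c < h p \<longrightarrow> (\<forall>\<^sub>F y in nhds p. c < h y))"
  unfolding lsc_fun_def le_Liminf_iff eventually_nhds_conv_at by blast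

text \<open>If every point of \<open>K\<close> were beaten by another, the interiors of the sets
  where \<open>h\<close> exceeds \<open>h y\<close> would cover \<open>K\<close>. In a finite
  subcover, the index point with the least value is not covered.\<close>

lemma lsc_attains_min:
  fixes h :: "'a::topological_space \<Rightarrow> 'b::linorder"
  assumes "compact K" and "K \<noteq> {}" and lsc: "\<And>p c. p \<in> K \<Longrightarrow> c < h p \<Longrightarrow> \<forall>\<^sub>F y in nhds p. c < h y"
  shows "\<exists>p\<in>K. \<forall>y\<in>K. h p \<le> h y"
proof (rule ccontr)
  assume "\<not> (\<exists>p\<in>K. \<forall>y\<in>K. h p \<le> h y)"
  then have less: "\<And>p. p \<in> K \<Longrightarrow> \<exists>y\<in>K. h y < h p" by (auto simp: not_le)
  define G where "G y = interior {p. h y < h p}" for y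
  have G: "p \<in> G y" if less: "p \<in> K" "h y < h p" for p y
  proof -
    obtain T where "open T" "p \<in> T" "\<And>z. z \<in> T \<Longrightarrow> h y < h z"
      using lsc[OF less] unfolding eventually_nhds by blast
    then show ?thesis unfolding G_def by (intro interiorI[of T]) auto
  qed
  have cover: "K \<subseteq> (\<Union>y\<in>K. G y)"
  proof
    fix p assume "p \<in> K"
    moreover obtain y where "y \<in> K" "h y < h p" using less[OF \<open>p \<in> K\<close>] by blast
    ultimately show "p \<in> (\<Union>y\<in>K. G y)" using G by blast
  qed
  have "open (G y)" for y by (simp add: G_def)
  then obtain C where C: "C \<subseteq> K" "finite C" "K \<subseteq> (\<Union>y\<in>C. G y)"
    by (rule compactE_image[OF assms(1) _ cover]) (rule that)
  have "C \<noteq> {}" using C(3) assms(2) by auto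
  then obtain y where y: "y \<in> C" "\<And>z. z \<in> C \<Longrightarrow> h y \<le> h z"
    using ex_min_if_finite[of "h ` C"] C(2) by (auto simp: not_less)
  obtain z where "z \<in> C" "y \<in> G z" using C(1,3) y(1) by blast
  then have "h z < h y" using interior_subset unfolding G_def by blast
  then show False using y(2)[OF \<open>z \<in> C\<close>] by simp
qed

lemma lsc_add_continuous:
  fixes h :: "'a::t2_space \<Rightarrow> ereal" and q :: "'a \<Rightarrow> real"
  assumes lsc: "\<And>c. c < h p \<Longrightarrow> \<forall>\<^sub>F y in nhds p. c < h y" and no: "\<And>y. h y \<noteq> - \<infinity>"
    and q: "isCont q p" and c: "c < h p + ereal (q p)"
  shows "\<forall>\<^sub>F y in nhds p. c < h y + ereal (q y)"
proof (cases c)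
  case (real r)
  have "ereal (r - q p) < h p" using c no[of p] unfolding real by (cases "h p") auto
  then obtain b where b: "ereal (r - q p) < b" "b < h p" using dense by blast
  then obtain b' where b': "b = ereal b'" by (cases b) auto
  have "\<forall>\<^sub>F y in nhds p. r - b' < q y"
    using q b(1) unfolding b' isCont_def tendsto_at_iff_tendsto_nhds by (intro order_tendstoD(1)) auto
  moreover have "\<forall>\<^sub>F y in nhds p. ereal b' < h y" using lsc b(2) b' by simp
  ultimately show ?thesis
  proof eventually_elim
    case (elim y)
    then show ?case unfolding real by (cases "h y") auto
  qed
next
  case PInf
  then show ?thesis using c by simp
next
  case MInf
  have "c < h y + ereal (q y)" for y unfolding MInf using no[of y] by (cases "h y") auto
  then show ?thesis by simp
qed

text \<open>The subgradient is minus the gradient of \<open>q\<close> at \<open>p\<close>. As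
  \<open>q\<close> is quadratic, its expansion at \<open>p\<close> leaves a remainder of at most
  \<open>1 + n\<close> times the squared distance, which is below \<open>e * norm (y - p)\<close>
  within radius \<open>e / (1 + n)\<close>.\<close>

lemma quadratic_minimum_regular_subgradient:
  fixes g :: "'x::euclidean_space \<times> 'u::euclidean_space \<Rightarrow> ereal"
  assumes q_def: "\<And>p. q p = - (v \<bullet> (fst p - x0)) + (norm (fst p - x0))\<^sup>2 + n * (norm (snd p - u0))\<^sup>2"
    and gp: "g p = ereal a" and "open K" and "p \<in> K" and "n \<ge> 0"
    and min: "\<And>y. y \<in> K \<Longrightarrow> g p + ereal (q p) \<le> g y + ereal (q y)"
  shows "(v - 2 *\<^sub>R (fst p - x0), - (2 * n) *\<^sub>R (snd p - u0)) \<in> regular_subdiff g p"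
proof (rule regular_subdiffI[where h = g and x = p, OF gp])
  let ?\<xi> = "(v - 2 *\<^sub>R (fst p - x0), - (2 * n) *\<^sub>R (snd p - u0))"
  fix e :: real assume e: "e > 0"
  obtain d where d: "d > 0" "ball p d \<subseteq> K" using assms(3,4) by (meson openE)
  have "ereal (a + ?\<xi> \<bullet> (y - p) - e * norm (y - p)) \<le> g y" if y: "dist y p < min d (e / (1 + n))" for y
  proof -
    have "y \<in> K" using d y by (auto simp: dist_commute subset_eq)
    from min[OF this] have le: "ereal (a + q p - q y) \<le> g y" unfolding gp by (cases "g y") auto
    have expand: "(norm (b + c))\<^sup>2 = (norm b)\<^sup>2 + 2 * (b \<bullet> c) + (norm c)\<^sup>2" for b c :: "'z::real_inner"
      by (simp add: power2_norm_eq_inner inner_add_left inner_add_right inner_commute)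
    obtain y1 y2 where y12: "y = (y1, y2)" by (cases y)
    obtain p1 p2 where p12: "p = (p1, p2)" by (cases p)
    have q_y: "q y = q p - ?\<xi> \<bullet> (y - p) + (norm (y1 - p1))\<^sup>2 + n * (norm (y2 - p2))\<^sup>2"
    proof -
      have "(norm (y1 - x0))\<^sup>2 = (norm (p1 - x0))\<^sup>2 + 2 * ((p1 - x0) \<bullet> (y1 - p1)) + (norm (y1 - p1))\<^sup>2"
        and "(norm (y2 - u0))\<^sup>2 = (norm (p2 - u0))\<^sup>2 + 2 * ((p2 - u0) \<bullet> (y2 - p2)) + (norm (y2 - p2))\<^sup>2"
        using expand[of "p1 - x0" "y1 - p1"] expand[of "p2 - u0" "y2 - p2"] by simp_all
      then show ?thesis
        unfolding q_def y12 p12 by (simp add: inner_diff_left distrib_left) (simp add: inner_diff_right)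
    qed
    have "(norm (y1 - p1))\<^sup>2 + n * (norm (y2 - p2))\<^sup>2 \<le> (norm (y - p))\<^sup>2 + n * (norm (y - p))\<^sup>2"
      using norm_fst_le[of "y1 - p1" "y2 - p2"] norm_snd_le[of "y2 - p2" "y1 - p1"] assms(5)
      by (intro add_mono power_mono mult_left_mono) (auto simp: y12 p12)
    also have "\<dots> = ((1 + n) * norm (y - p)) * norm (y - p)" by (simp add: power2_eq_square algebra_simps)
    also have "\<dots> \<le> e * norm (y - p)"
      using y assms(5) by (intro mult_right_mono) (auto simp: dist_norm field_simps)
    finally have "a + ?\<xi> \<bullet> (y - p) - e * norm (y - p) \<le> a + q p - q y" unfolding q_y by linarith
    then show ?thesis using le by (meson ereal_less_eq(3) order_trans)
  qed
  then show "\<exists>d>0. \<forall>y. dist y p < d \<longrightarrow> ereal (a + ?\<xi> \<bullet> (y - p) - e * norm (y - p)) \<le> g y"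
    using d(1) e assms(5) by (intro exI[of _ "min d (e / (1 + n))"]) auto
qed

text \<open>Penalizing \<open>u \<noteq> u\<^sub>0\<close> produces regular subgradients \<open>(v\<^sub>n, \<lambda>\<^sub>n)\<close> near \<open>(x\<^sub>0, u\<^sub>0)\<close> with \<open>v\<^sub>n \<rightarrow> v\<close>.
  Regularity of the epigraph turns a bounded limit of \<open>\<lambda>\<^sub>n\<close> into the desired subgradient, and an unbounded
  one into a recession direction \<open>(0, w)\<close> of \<open>\<partial>g(x\<^sub>0, u\<^sub>0)\<close>, which the constraint qualification excludes.\<close>

lemma partial_subgradient_lift:
  fixes g :: "'x::euclidean_space \<times> 'u::euclidean_space \<Rightarrow> ereal"
  assumes lsc: "lsc_fun g" and no: "\<And>p. g p \<noteq> - \<infinity>" and reg: "regular_fun_at g (x0, u0)"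
    and v: "v \<in> convex_subdiff (\<lambda>x. g (x, u0)) x0" and c: "c \<in> subdiff g (x0, u0)"
    and cq: "\<And>w. (0, w) \<in> par (subdiff g (x0, u0)) \<Longrightarrow> w = 0"
  shows "\<exists>w. (v, w) \<in> subdiff g (x0, u0)"
proof -
  obtain g0 where g0: "g (x0, u0) = ereal g0" using v unfolding convex_subdiff_def by auto
  have v_le: "ereal (g0 + v \<bullet> (x - x0)) \<le> g (x, u0)" for x
    using v unfolding convex_subdiff_def g0 by simp
  note lsc' = lsc[unfolded lsc_fun_iff, rule_format]
  define K where "K = cball (x0, u0) 1"
  have K: "compact K" "(x0, u0) \<in> K" by (auto simp: K_def)
  \<comment> \<open>The square in \<open>x\<close> makes \<open>x0\<close> the strict minimizer of
    \<open>g + q n\<close> on the slice \<open>u = u0\<close>, so that the penalized minimizers can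
    accumulate only at \<open>(x0, u0)\<close>.\<close>
  define q where "q n p = - (v \<bullet> (fst p - x0)) + (norm (fst p - x0))\<^sup>2 + n * (norm (snd p - u0))\<^sup>2" for n and p :: "'x \<times> 'u"
  have q0: "q n (x0, u0) = 0" for n by (simp add: q_def)
  have qc: "isCont (q n) p" for n p unfolding q_def by (intro continuous_intros)
  have "\<exists>p\<in>K. \<forall>y\<in>K. g p + ereal (q (real n) p) \<le> g y + ereal (q (real n) y)" for n
    by (rule lsc_attains_min[OF K(1)]) (use K(2) lsc_add_continuous[OF lsc' no qc] in auto)
  then obtain p where p: "\<And>n. p n \<in> K"
    "\<And>n y. y \<in> K \<Longrightarrow> g (p n) + ereal (q (real n) (p n)) \<le> g y + ereal (q (real n) y)" by metis
  have le0: "g (p n) + ereal (q (real n) (p n)) \<le> ereal g0" for n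
    using p(2)[OF K(2), of n] by (simp add: g0 q0)
  define a where "a n = real_of_ereal (g (p n))" for n
  have ga: "g (p n) = ereal (a n)" for n
    using le0[of n] no[of "p n"] by (cases "g (p n)") (auto simp: a_def)
  have aq: "a n + q (real n) (p n) \<le> g0" for n using le0[of n] by (simp add: ga)
  obtain b where b: "b \<in> K" "\<And>y. y \<in> K \<Longrightarrow> g b \<le> g y"
    using lsc_attains_min[OF K(1) _ lsc'] K(2) by blast
  obtain B where B: "g b = ereal B"
    using b(2)[OF K(2)] no[of b] unfolding g0 by (cases "g b") auto
  have aB: "B \<le> a n" for n using b(2)[OF p(1), of n] by (simp add: ga B)
  have normK: "norm (fst p - x0) \<le> 1" if "p \<in> K" for p
    using that dist_fst_le[of p "(x0, u0)"] by (simp add: K_def dist_norm norm_minus_commute)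
  have ub: "real n * (norm (snd (p n) - u0))\<^sup>2 \<le> g0 - B + norm v" for n
  proof -
    have "v \<bullet> (fst (p n) - x0) \<le> norm v * norm (fst (p n) - x0)" by (rule norm_cauchy_schwarz)
    also have "\<dots> \<le> norm v" using normK[OF p(1)] by (simp add: mult_left_le)
    finally show ?thesis using aq[of n] aB[of n] zero_le_power2[of "norm (fst (p n) - x0)"] unfolding q_def by linarith
  qed
  define l where "l n = - (2 * real n) *\<^sub>R (snd (p n) - u0)" for n
  \<comment> \<open>With this scaling \<open>\<mu> n + norm (\<mu> n *\<^sub>R l n) = 1\<close>. A
    convergent subsequence therefore exists and its limit \<open>(m, w)\<close> is nonzero;
    \<open>m = 0\<close> means that the multipliers \<open>l n\<close> are unbounded along
    it.\<close>
  define \<mu> where "\<mu> n = 1 / (1 + norm (l n))" for n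
  have l_pos: "1 + norm (l n) > 0" for n by (simp add: add_pos_nonneg)
  have \<mu>: "0 < \<mu> n" "\<mu> n \<le> 1" "norm (\<mu> n *\<^sub>R l n) \<le> 1" "\<mu> n + norm (\<mu> n *\<^sub>R l n) = 1" for n
    using l_pos[of n] by (auto simp: \<mu>_def field_simps)
  have "compact (K \<times> {0..1::real} \<times> cball (0::'u) 1)" by (intro compact_Times K compact_Icc compact_cball)
  moreover have "(p n, \<mu> n, \<mu> n *\<^sub>R l n) \<in> K \<times> {0..1} \<times> cball 0 1" for n
    using p(1) \<mu>[of n] by auto
  ultimately obtain L r where r: "strict_mono (r :: nat \<Rightarrow> nat)" "((\<lambda>n. (p n, \<mu> n, \<mu> n *\<^sub>R l n)) \<circ> r) \<longlonglongrightarrow> L" "L \<in> K \<times> {0..1} \<times> cball 0 1"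
    unfolding compact_def by (metis (no_types, lifting))
  obtain pl m w where L: "L = (pl, m, w)" by (cases L)
  have lim: "(\<lambda>n. p (r n)) \<longlonglongrightarrow> pl" "(\<lambda>n. \<mu> (r n)) \<longlonglongrightarrow> m" "(\<lambda>n. \<mu> (r n) *\<^sub>R l (r n)) \<longlonglongrightarrow> w"
    using tendsto_fst[OF r(2)] tendsto_fst[OF tendsto_snd[OF r(2)]] tendsto_snd[OF tendsto_snd[OF r(2)]]
    by (auto simp: L o_def)
  have u_lim: "snd pl = u0"
  proof -
    have "(norm (snd (p n) - u0))\<^sup>2 \<le> (g0 - B + norm v) * inverse (real n)" if "n > 0" for n
      using ub[of n] that by (simp add: field_simps)
    then have "norm ((norm (snd (p (r n)) - u0))\<^sup>2) \<le> (g0 - B + norm v) * inverse (real (r n))" if "0 < n" for n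
      using that seq_suble[OF r(1), of n] by simp
    then have "\<forall>\<^sub>F n in sequentially. norm ((norm (snd (p (r n)) - u0))\<^sup>2) \<le> (g0 - B + norm v) * inverse (real (r n))"
      by (rule eventually_mono[OF eventually_gt_at_top[of 0]])
    moreover have "(\<lambda>n. (g0 - B + norm v) * inverse (real (r n))) \<longlonglongrightarrow> 0"
      using LIMSEQ_subseq_LIMSEQ[OF tendsto_mult_right_zero[OF lim_inverse_n] r(1)] by (simp add: o_def)
    ultimately have "(\<lambda>n. (norm (snd (p (r n)) - u0))\<^sup>2) \<longlonglongrightarrow> 0" by (rule Lim_null_comparison)
    moreover have "(\<lambda>n. (norm (snd (p (r n)) - u0))\<^sup>2) \<longlonglongrightarrow> (norm (snd pl - u0))\<^sup>2"
      by (intro tendsto_intros lim)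
    ultimately have "(norm (snd pl - u0))\<^sup>2 = 0" using LIMSEQ_unique by blast
    then show ?thesis by simp
  qed
  have a_le: "a n \<le> g0 + v \<bullet> (fst (p n) - x0) - (norm (fst (p n) - x0))\<^sup>2" for n
  proof -
    have "0 \<le> real n * (norm (snd (p n) - u0))\<^sup>2" by simp
    then show ?thesis using aq[of n] unfolding q_def by linarith
  qed
  \<comment> \<open>By \<open>a_le\<close> the values lie below the affine minorant by the squared
    distance to \<open>x0\<close>. Lower semicontinuity does not let such a gap persist in the
    limit.\<close>
  have x_lim: "fst pl = x0"
  proof (rule ccontr)
    assume ne: "fst pl \<noteq> x0"
    define s where "s = g0 + v \<bullet> (fst pl - x0) - (norm (fst pl - x0))\<^sup>2 / 2"
    have pos: "(norm (fst pl - x0))\<^sup>2 > 0" using ne by simp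
    have "ereal s < ereal (g0 + v \<bullet> (fst pl - x0))" using pos by (simp add: s_def)
    also have "\<dots> \<le> g pl" using v_le[of "fst pl"] u_lim by (metis prod.collapse)
    finally have "ereal s < g pl" .
    then have "\<forall>\<^sub>F y in nhds pl. ereal s < g y" by (rule lsc')
    then have 1: "\<forall>\<^sub>F n in sequentially. ereal s < g (p (r n))"
      using lim(1) unfolding filterlim_iff by blast
    have "(\<lambda>n. g0 + v \<bullet> (fst (p (r n)) - x0) - (norm (fst (p (r n)) - x0))\<^sup>2)
        \<longlonglongrightarrow> g0 + v \<bullet> (fst pl - x0) - (norm (fst pl - x0))\<^sup>2"
      by (intro tendsto_intros lim)
    moreover have "g0 + v \<bullet> (fst pl - x0) - (norm (fst pl - x0))\<^sup>2 < s" using pos by (simp add: s_def)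
    ultimately have 2: "\<forall>\<^sub>F n in sequentially. g0 + v \<bullet> (fst (p (r n)) - x0) - (norm (fst (p (r n)) - x0))\<^sup>2 < s"
      by (rule order_tendstoD(2))
    have "\<forall>\<^sub>F n in sequentially. False"
      using 1 2
    proof eventually_elim
      case (elim n)
      then show ?case using a_le[of "r n"] by (simp add: ga)
    qed
    then show False by simp
  qed
  have pl: "pl = (x0, u0)" using u_lim x_lim by (simp add: prod_eq_iff)
  \<comment> \<open>Limiting normals of the epigraph at \<open>((x0, u0), g0)\<close> also need
    convergence of the function values: lower semicontinuity bounds them from below,
    \<open>a_le\<close> from above.\<close>
  have a_lim: "(\<lambda>n. a (r n)) \<longlonglongrightarrow> g0"
  proof (rule order_tendstoI)
    fix s assume "s < g0"
    then have "\<forall>\<^sub>F y in nhds pl. ereal s < g y" by (intro lsc') (simp add: pl g0)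
    then have "\<forall>\<^sub>F n in sequentially. ereal s < g (p (r n))"
      using lim(1) unfolding filterlim_iff by blast
    then show "\<forall>\<^sub>F n in sequentially. s < a (r n)" by (simp add: ga)
  next
    fix s assume "g0 < s"
    moreover have "(\<lambda>n. g0 + v \<bullet> (fst (p (r n)) - x0) - (norm (fst (p (r n)) - x0))\<^sup>2)
        \<longlonglongrightarrow> g0 + v \<bullet> (fst pl - x0) - (norm (fst pl - x0))\<^sup>2"
      by (intro tendsto_intros lim)
    ultimately have "\<forall>\<^sub>F n in sequentially. g0 + v \<bullet> (fst (p (r n)) - x0) - (norm (fst (p (r n)) - x0))\<^sup>2 < s"
      by (intro order_tendstoD(2)) (simp_all add: x_lim)
    then show "\<forall>\<^sub>F n in sequentially. a (r n) < s"
      by (rule eventually_mono) (rule le_less_trans[OF a_le])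
  qed
  \<comment> \<open>From some index on the minimizers are interior to \<open>K\<close>, hence local
    minimizers, and so yield regular subgradients.\<close>
  have "\<forall>\<^sub>F n in sequentially. p (r n) \<in> ball (x0, u0) 1"
    using topological_tendstoD[OF lim(1) open_ball] by (simp add: pl)
  then obtain N where N: "\<And>n. p (r (n + N)) \<in> ball (x0, u0) 1"
    unfolding eventually_sequentially by (metis le_add2)
  define k where "k n = r (n + N)" for n
  have sub: "(v - 2 *\<^sub>R (fst (p (k n)) - x0), l (k n)) \<in> regular_subdiff g (p (k n))" for n
    unfolding l_def
    by (rule quadratic_minimum_regular_subgradient[where q = "q (real (k n))" and v = v and ?x0.0 = x0
          and ?u0.0 = u0 and n = "real (k n)" and g = g and a = "a (k n)" and K = "ball (x0, u0) 1"])
      (use N p(2) in \<open>auto simp: k_def K_def q_def ga\<close>)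
  let ?z = "\<lambda>n. \<mu> (k n) *\<^sub>R ((v - 2 *\<^sub>R (fst (p (k n)) - x0), l (k n)), - 1 :: real)"
  have kl: "(\<lambda>n. p (k n)) \<longlonglongrightarrow> pl" "(\<lambda>n. \<mu> (k n)) \<longlonglongrightarrow> m" "(\<lambda>n. \<mu> (k n) *\<^sub>R l (k n)) \<longlonglongrightarrow> w"
    "(\<lambda>n. a (k n)) \<longlonglongrightarrow> g0"
    unfolding k_def using lim a_lim by (auto intro: LIMSEQ_ignore_initial_segment)
  have z_lim: "?z \<longlonglongrightarrow> ((m *\<^sub>R v, w), - m)"
  proof -
    have "(\<lambda>n. ((\<mu> (k n) *\<^sub>R (v - 2 *\<^sub>R (fst (p (k n)) - x0)), \<mu> (k n) *\<^sub>R l (k n)), - \<mu> (k n)))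
        \<longlonglongrightarrow> ((m *\<^sub>R (v - 2 *\<^sub>R (fst pl - x0)), w), - m)"
      by (intro tendsto_intros kl)
    then show ?thesis by (simp add: x_lim)
  qed
  have "((m *\<^sub>R v, w), - m) \<in> general_normals (epi g) ((x0, u0), g0)"
    unfolding general_normals_def
  proof (rule CollectI, rule exI[of _ "\<lambda>n. (p (k n), a (k n))"], rule exI[of _ ?z], intro conjI allI)
    fix n
    show "(p (k n), a (k n)) \<in> epi g" by (simp add: epi_def ga)
    show "?z n \<in> regular_normals (epi g) (p (k n), a (k n))"
      by (rule regular_normals_scale[OF regular_subdiff_imp_normal[OF sub, folded a_def]])
        (use \<mu>(1) in \<open>simp add: less_imp_le\<close>)
  next
    show "(\<lambda>n. (p (k n), a (k n))) \<longlonglongrightarrow> ((x0, u0), g0)"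
      using tendsto_Pair[OF kl(1,4)] by (simp add: pl)
  qed (rule z_lim)
  then have nrm: "((m *\<^sub>R v, w), - m) \<in> regular_normals (epi g) ((x0, u0), g0)"
    using reg g0 unfolding regular_fun_at_def regular_set_at_def by simp
  have eq: "subdiff g (x0, u0) = regular_subdiff g (x0, u0)" by (rule subdiff_eq_regular_subdiff[OF reg])
  show ?thesis
  proof (cases "m = 0")
    case True
    \<comment> \<open>Adding the horizontal normal \<open>((0, w), 0)\<close> to
      \<open>(c, -1)\<close> makes \<open>c + (0, w)\<close> a subgradient, so \<open>(0, w)\<close>
      is a difference of two subgradients.\<close>
    have "(c, -1) \<in> regular_normals (epi g) ((x0, u0), g0)"
      using regular_subdiff_imp_normal[of c g "(x0, u0)"] c by (simp add: eq g0)
    from regular_normals_add[OF this nrm] have "(c + (0, w), -1) \<in> regular_normals (epi g) ((x0, u0), g0)"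
      using True by simp
    then have "c + (0, w) \<in> subdiff g (x0, u0)" unfolding eq using g0 by (rule normal_imp_regular_subdiff)
    from diff_in_par[OF this c] have "w = 0" using cq by simp
    moreover have "(\<lambda>n. \<mu> (k n) + norm (\<mu> (k n) *\<^sub>R l (k n))) \<longlonglongrightarrow> m + norm w"
      by (intro tendsto_intros kl)
    then have "m + norm w = 1" unfolding \<mu>(4) by (simp add: LIMSEQ_const_iff)
    ultimately show ?thesis using True by simp
  next
    case False
    then have m: "m > 0" using r(3) by (auto simp: L)
    have "inverse m *\<^sub>R ((m *\<^sub>R v, w), - m) \<in> regular_normals (epi g) ((x0, u0), g0)"
      by (rule regular_normals_scale[OF nrm]) (use m in simp)
    then have "((v, inverse m *\<^sub>R w), - 1) \<in> regular_normals (epi g) ((x0, u0), g0)" using m by simp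
    then have "(v, inverse m *\<^sub>R w) \<in> subdiff g (x0, u0)"
      unfolding eq using g0 by (rule normal_imp_regular_subdiff)
    then show ?thesis by blast
  qed
qed

lemma regular_subdiff_partial:
  assumes "(v, w) \<in> regular_subdiff g (x, u)"
  shows "v \<in> regular_subdiff (\<lambda>x. g (x, u)) x"
proof -
  obtain gx where gx: "g (x, u) = ereal gx" using assms by (rule regular_subdiffE) (rule that)
  show ?thesis
  proof (rule regular_subdiffI[where h = "\<lambda>x. g (x, u)" and x = x, OF gx])
    fix e :: real assume "e > 0"
    from regular_subdiffD[OF assms gx this] obtain d where d: "d > 0"
      "\<And>y. dist y (x, u) < d \<Longrightarrow> ereal (gx + (v, w) \<bullet> (y - (x, u)) - e * norm (y - (x, u))) \<le> g y" by blast
    have "ereal (gx + v \<bullet> (y - x) - e * norm (y - x)) \<le> g (y, u)" if "dist y x < d" for y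
      using d(2)[of "(y, u)"] that by (simp add: dist_Pair_Pair norm_Pair)
    then show "\<exists>d>0. \<forall>y. dist y x < d \<longrightarrow> ereal (gx + v \<bullet> (y - x) - e * norm (y - x)) \<le> g (y, u)"
      using d(1) by blast
  qed
qed

lemma le_of_le_add_epsilon_mult:
  fixes a b c :: real
  assumes "\<And>e. e > 0 \<Longrightarrow> a \<le> b + e * c" and "c \<ge> 0"
  shows "a \<le> b"
proof (rule field_le_epsilon)
  fix e :: real assume e: "e > 0"
  have "a \<le> b + e / (c + 1) * c" using assms(1)[of "e / (c + 1)"] assms(2) e by simp
  also have "e / (c + 1) * c \<le> e / (c + 1) * (c + 1)" using assms(2) e by (intro mult_left_mono) auto
  also have "\<dots> = e" using assms(2) by simp
  finally show "a \<le> b + e" by simp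
qed

text \<open>For small \<open>t\<close> the point \<open>x + t *\<^sub>R (y - x)\<close> lies where
  the local inequality holds. By convexity the increase of \<open>h\<close> there is at most
  proportional to \<open>t\<close>, so \<open>t\<close> cancels.\<close>

lemma convex_regular_imp_convex_subgradient:
  assumes conv: "convex_fun h" and v: "v \<in> regular_subdiff h x"
  shows "v \<in> convex_subdiff h x"
proof -
  obtain hx where hx: "h x = ereal hx" using v by (rule regular_subdiffE) (rule that)
  \<comment> \<open>Tested against real bounds \<open>r\<close> of \<open>h y\<close>, since
    convexity is that of the epigraph; the extended real value \<open>h y\<close> itself is reached
    afterwards by density.\<close>
  have le: "hx + v \<bullet> (y - x) \<le> r" if r: "h y \<le> ereal r" for y r
  proof -
    have "v \<bullet> (y - x) \<le> r - hx + e * norm (y - x)" if e: "e > 0" for e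
    proof -
      obtain d where d: "d > 0" "\<And>z. dist z x < d \<Longrightarrow> ereal (hx + v \<bullet> (z - x) - e * norm (z - x)) \<le> h z"
        using regular_subdiffD[OF v hx e] by blast
      define t where "t = min 1 (d / (norm (y - x) + 1))"
      have n: "norm (y - x) + 1 > 0" by (simp add: add_nonneg_pos)
      have t: "0 < t" "t \<le> 1" using d(1) n by (auto simp: t_def)
      let ?z = "x + t *\<^sub>R (y - x)"
      have "(1 - t) *\<^sub>R (x, hx) + t *\<^sub>R (y, r) \<in> epi h"
        by (rule convexD[OF conv[unfolded convex_fun_def]]) (use r t in \<open>auto simp: epi_def hx\<close>)
      then have "h ?z \<le> ereal (hx + t * (r - hx))" by (simp add: epi_def algebra_simps)
      moreover have "dist ?z x < d"
      proof -
        have "dist ?z x = t * norm (y - x)" using t by (simp add: dist_norm)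
        also have "\<dots> < t * (norm (y - x) + 1)" using t by simp
        also have "\<dots> \<le> d / (norm (y - x) + 1) * (norm (y - x) + 1)" using n by (intro mult_right_mono) (auto simp: t_def)
        finally show ?thesis using n by simp
      qed
      ultimately have "ereal (hx + v \<bullet> (?z - x) - e * norm (?z - x)) \<le> ereal (hx + t * (r - hx))"
        using d(2) order_trans by blast
      moreover have "norm (?z - x) = t * norm (y - x)" "v \<bullet> (?z - x) = t * (v \<bullet> (y - x))" using t by simp_all
      ultimately have "hx + t * (v \<bullet> (y - x)) - e * (t * norm (y - x)) \<le> hx + t * (r - hx)"
        by (simp only: ereal_less_eq)
      then have "t * (v \<bullet> (y - x)) \<le> t * (r - hx + e * norm (y - x))"
        by (simp only: distrib_left mult.left_commute[of t e])
      then show ?thesis using t by simp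
    qed
    from le_of_le_add_epsilon_mult[OF this norm_ge_zero] show ?thesis by simp
  qed
  have "ereal (hx + v \<bullet> (y - x)) \<le> h y" for y
  proof (rule ccontr)
    assume "\<not> ereal (hx + v \<bullet> (y - x)) \<le> h y"
    then obtain s where s: "h y < s" "s < ereal (hx + v \<bullet> (y - x))" using dense by (metis not_le)
    then obtain r where "s = ereal r" by (cases s) auto
    then show False using s le[of y r] less_imp_le[OF s(1)] by simp
  qed
  then show ?thesis unfolding convex_subdiff_def hx by simp
qed

section \<open>Convex sum rule and proximal points\<close>

lemma convex_fun_ereal:
  assumes "convex_on UNIV f"
  shows "convex_fun (\<lambda>x. ereal (f x))"
  unfolding convex_fun_def
proof (rule convexI)
  fix p q :: "'a \<times> real" and a b :: real
  assume *: "p \<in> epi (\<lambda>x. ereal (f x))" "q \<in> epi (\<lambda>x. ereal (f x))" "0 \<le> a" "0 \<le> b" "a + b = 1"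
  have "f (a *\<^sub>R fst p + b *\<^sub>R fst q) \<le> a * f (fst p) + b * f (fst q)"
    using assms *(3-5) unfolding convex_on_def by auto
  also have "\<dots> \<le> a * snd p + b * snd q"
    using * by (intro add_mono mult_left_mono) (auto simp: epi_def)
  finally show "a *\<^sub>R p + b *\<^sub>R q \<in> epi (\<lambda>x. ereal (f x))" by (simp add: epi_def case_prod_beta)
qed

text \<open>Subtracting the gradient of the smooth part leaves only a local first-order inequality
  for \<open>g\<close>, which convexity of \<open>g\<close> makes global.\<close>

lemma convex_subdiff_objective:
  fixes f :: "'x::euclidean_space \<times> 'u \<Rightarrow> real"
  assumes conv_f: "convex_on UNIV (\<lambda>x. f (x, u))" and conv_g: "convex_fun (\<lambda>x. g (x, u))"
    and G: "((\<lambda>x. f (x, u)) has_derivative (\<lambda>h. G \<bullet> h)) (at x)"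
  shows "convex_subdiff (objective f g u) x = (\<lambda>v. G + v) ` convex_subdiff (\<lambda>x. g (x, u)) x"
proof (intro equalityI subsetI)
  fix v assume v: "v \<in> convex_subdiff (objective f g u) x"
  obtain gx where gx: "g (x, u) = ereal gx"
    using v unfolding convex_subdiff_def objective_def by (cases "g (x, u)") auto
  have v_le: "ereal (f (x, u) + gx + v \<bullet> (y - x)) \<le> ereal (f (y, u)) + g (y, u)" for y
    using v unfolding convex_subdiff_def objective_def by (simp add: gx)
  have "v - G \<in> regular_subdiff (\<lambda>x. g (x, u)) x"
  proof (rule regular_subdiffI[where h = "\<lambda>x. g (x, u)" and x = x, OF gx])
    fix e :: real assume "e > 0"
    then obtain d where d: "d > 0"
      "\<And>y. norm (y - x) < d \<Longrightarrow> norm (f (y, u) - f (x, u) - G \<bullet> (y - x)) \<le> e * norm (y - x)"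
      using G unfolding has_derivative_at_alt by blast
    have "ereal (gx + (v - G) \<bullet> (y - x) - e * norm (y - x)) \<le> g (y, u)" if "dist y x < d" for y
    proof -
      have "f (y, u) - f (x, u) - G \<bullet> (y - x) \<le> e * norm (y - x)"
        using d(2)[of y] that by (simp add: dist_norm)
      then show ?thesis using v_le[of y] by (cases "g (y, u)") (auto simp: inner_diff_left)
    qed
    then show "\<exists>d>0. \<forall>y. dist y x < d \<longrightarrow> ereal (gx + (v - G) \<bullet> (y - x) - e * norm (y - x)) \<le> g (y, u)"
      using d(1) by blast
  qed
  then have "v - G \<in> convex_subdiff (\<lambda>x. g (x, u)) x" by (rule convex_regular_imp_convex_subgradient[OF conv_g])
  then show "v \<in> (\<lambda>v. G + v) ` convex_subdiff (\<lambda>x. g (x, u)) x" by (intro image_eqI[of _ _ "v - G"]) auto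
next
  fix v' assume "v' \<in> (\<lambda>v. G + v) ` convex_subdiff (\<lambda>x. g (x, u)) x"
  then obtain v where v: "v \<in> convex_subdiff (\<lambda>x. g (x, u)) x" "v' = G + v" by blast
  have "G \<in> regular_subdiff (\<lambda>x. ereal (f (x, u))) x"
  proof (rule regular_subdiffI[OF refl])
    fix e :: real assume "e > 0"
    then obtain d where d: "d > 0"
      "\<And>y. norm (y - x) < d \<Longrightarrow> norm (f (y, u) - f (x, u) - G \<bullet> (y - x)) \<le> e * norm (y - x)"
      using G unfolding has_derivative_at_alt by blast
    have "ereal (f (x, u) + G \<bullet> (y - x) - e * norm (y - x)) \<le> ereal (f (y, u))" if "dist y x < d" for y
      using d(2)[of y] that by (simp add: dist_norm)
    then show "\<exists>d>0. \<forall>y. dist y x < d \<longrightarrow> ereal (f (x, u) + G \<bullet> (y - x) - e * norm (y - x)) \<le> ereal (f (y, u))"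
      using d(1) by blast
  qed
  from convex_regular_imp_convex_subgradient[OF convex_fun_ereal[OF conv_f] this]
  have f_le: "f (x, u) + G \<bullet> (y - x) \<le> f (y, u)" for y unfolding convex_subdiff_def by simp
  obtain gx where gx: "g (x, u) = ereal gx"
    using v unfolding convex_subdiff_def by auto
  have "ereal (f (x, u)) + g (x, u) + ereal (v' \<bullet> (y - x)) \<le> ereal (f (y, u)) + g (y, u)" for y
  proof -
    have "ereal (gx + v \<bullet> (y - x)) \<le> g (y, u)" using v(1) unfolding convex_subdiff_def by (simp add: gx)
    then show ?thesis using f_le[of y] unfolding v(2) gx by (cases "g (y, u)") (auto simp: inner_add_left)
  qed
  then show "v' \<in> convex_subdiff (objective f g u) x"
    unfolding convex_subdiff_def objective_def by (simp add: gx)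
qed

text \<open>\<open>arg_min\<close> is a choice operator, so uniqueness is needed to evaluate it: the
  subgradient inequality leaves a surplus of half the squared distance to \<open>x\<close>.\<close>

lemma prox_eqI:
  fixes g :: "'x::euclidean_space \<times> 'u \<Rightarrow> ereal"
  assumes "\<alpha> > 0" and v: "(w - x) /\<^sub>R \<alpha> \<in> convex_subdiff (\<lambda>x. g (x, u)) x"
  shows "prox g \<alpha> w u = x"
proof -
  define \<Phi> where "\<Phi> y = ereal \<alpha> * g (y, u) + ereal (1 / 2 * (norm (y - w))\<^sup>2)" for y
  obtain gx where gx: "g (x, u) = ereal gx" using v unfolding convex_subdiff_def by auto
  have less: "\<Phi> x < \<Phi> y" if "y \<noteq> x" for y
  proof -
    have le: "ereal (gx + ((w - x) /\<^sub>R \<alpha>) \<bullet> (y - x)) \<le> g (y, u)"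
      using v unfolding convex_subdiff_def by (simp add: gx)
    show ?thesis
    proof (cases "g (y, u)")
      case (real gy)
      have "\<alpha> * (gx + ((w - x) /\<^sub>R \<alpha>) \<bullet> (y - x)) \<le> \<alpha> * gy"
        using le assms(1) unfolding real by (intro mult_left_mono) auto
      then have 1: "\<alpha> * gx + (w - x) \<bullet> (y - x) \<le> \<alpha> * gy" using assms(1) by (simp add: distrib_left flip: mult.assoc)
      have 2: "(norm (y - w))\<^sup>2 = (norm (x - w))\<^sup>2 - 2 * ((w - x) \<bullet> (y - x)) + (norm (y - x))\<^sup>2"
        by (simp add: power2_norm_eq_inner inner_diff_left inner_diff_right inner_commute)
      have "(norm (y - x))\<^sup>2 > 0" using that by simp
      then have "\<alpha> * gx + 1 / 2 * (norm (x - w))\<^sup>2 < \<alpha> * gy + 1 / 2 * (norm (y - w))\<^sup>2" using 1 2 by linarith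
      then show ?thesis unfolding \<Phi>_def gx real by simp
    qed (use le assms(1) in \<open>auto simp: \<Phi>_def gx\<close>)
  qed
  have "is_arg_min \<Phi> (\<lambda>_. True) y \<longleftrightarrow> y = x" for y
    unfolding is_arg_min_def using less by (metis less_asym less_irrefl)
  then show ?thesis unfolding prox_def \<Phi>_def[symmetric] arg_min_def by (intro some_equality) auto
qed

section \<open>The proximal map along the manifold\<close>

lemma not_eventually_nhds_sequence:
  fixes a :: "'a::metric_space"
  assumes "\<not> (\<forall>\<^sub>F x in nhds a. R x)"
  obtains s where "s \<longlonglongrightarrow> a" "\<And>n::nat. \<not> R (s n)"
proof -
  have "\<exists>x. dist x a < inverse (real (Suc n)) \<and> \<not> R x" for n
    using assms unfolding eventually_nhds_metric by (metis inverse_positive_iff_positive of_nat_0_less_iff zero_less_Suc)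
  then obtain s where s: "\<And>n. dist (s n) a < inverse (real (Suc n))" "\<And>n. \<not> R (s n)" by metis
  have "s \<longlonglongrightarrow> a"
    by (rule tendsto_dist_iff[THEN iffD2], rule tendsto_sandwich[OF _ _ tendsto_const LIMSEQ_inverse_real_of_nat])
      (use s(1) in \<open>auto intro!: always_eventually less_imp_le\<close>)
  then show ?thesis using that s(2) by blast
qed

text \<open>Minimality is asked for along one line only, because the function in chart coordinates
  is known to be minimal on the subspace \<open>S\<close> and not on a full neighbourhood.\<close>

lemma line_minimum_conditions:
  fixes h :: "'a::real_normed_vector \<Rightarrow> real"
  assumes "open D" and "y0 \<in> D"
    and h': "\<And>y. y \<in> D \<Longrightarrow> (h has_derivative blinfun_apply (h' y)) (at y)"
    and h'': "(h' has_derivative h'') (at y0)"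
    and min: "\<And>t. y0 + t *\<^sub>R s \<in> D \<Longrightarrow> h y0 \<le> h (y0 + t *\<^sub>R s)"
  shows "h' y0 s = 0" and "blinfun_apply (h'' s) s \<ge> 0"
proof -
  have "open ((\<lambda>t. y0 + t *\<^sub>R s) -` D)" by (intro open_vimage assms(1) continuous_intros)
  moreover have "0 \<in> (\<lambda>t. y0 + t *\<^sub>R s) -` D" using assms(2) by simp
  ultimately obtain e where "e > 0" "ball 0 e \<subseteq> (\<lambda>t. y0 + t *\<^sub>R s) -` D" by (rule openE)
  then have e: "e > 0" "\<And>t. \<bar>t\<bar> < e \<Longrightarrow> y0 + t *\<^sub>R s \<in> D" by (auto simp: subset_eq)
  define F where "F t = h (y0 + t *\<^sub>R s)" for t
  define F' where "F' t = h' (y0 + t *\<^sub>R s) s" for t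
  have line: "((\<lambda>t. y0 + t *\<^sub>R s) has_derivative (\<lambda>r. r *\<^sub>R s)) (at t)" for t
    by (auto intro!: derivative_eq_intros)
  have F: "(F has_real_derivative F' t) (at t)" if "\<bar>t\<bar> < e" for t
    using has_derivative_compose[OF line h'[OF e(2)[OF that]]]
    unfolding F_def F'_def
    by (rule has_derivative_imp_has_field_derivative) (simp add: blinfun.scaleR_right)
  have F'0: "F' 0 = 0"
    by (rule DERIV_local_min[OF F[of 0] e(1)]) (use e min in \<open>auto simp: F_def\<close>)
  then show "h' y0 s = 0" by (simp add: F'_def)
  have h''0: "(h' has_derivative h'') (at (y0 + 0 *\<^sub>R s))" using h'' by simp
  have "((\<lambda>t. h' (y0 + t *\<^sub>R s) s) has_derivative (\<lambda>r. blinfun_apply (h'' (r *\<^sub>R s)) s)) (at 0)"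
    using blinfun.FDERIV[OF has_derivative_compose[OF line h''0] has_derivative_const[of s]]
    by (simp add: blinfun.zero_right)
  then have F'': "(F' has_real_derivative h'' s s) (at 0)"
    unfolding F'_def
    by (rule has_derivative_imp_has_field_derivative)
      (simp add: linear_cmul[OF has_derivative_linear[OF h'']] blinfun.scaleR_left)
  show "blinfun_apply (h'' s) s \<ge> 0"
  proof (rule ccontr)
    \<comment> \<open>A negative second derivative makes the first derivative negative just to the
      right of 0, and the mean value theorem then gives a smaller value.\<close>
    assume "\<not> blinfun_apply (h'' s) s \<ge> 0"
    then obtain d where d: "d > 0" "\<And>r. r > 0 \<Longrightarrow> r < d \<Longrightarrow> F' (0 + r) < F' 0"
      using DERIV_neg_dec_right[OF F''] by auto
    define r where "r = min d e / 2"
    have r: "0 < r" "r < d" "r < e" using d(1) e(1) by (auto simp: r_def)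
    have "\<exists>z>0. z < r \<and> F r - F 0 = (r - 0) * F' z"
      by (rule MVT2) (use r F in auto)
    then obtain z where z: "0 < z" "z < r" "F r - F 0 = r * F' z" by auto
    have "F' z < 0" using d(2)[of z] z r F'0 by simp
    then have "F r < F 0" using z(3) mult_pos_neg[OF r(1)] by fastforce
    then show False using min[of r] e(2)[of r] r by (simp add: F_def)
  qed
qed

text \<open>\<open>v\<close> is the subgradient in \<open>x\<close> that makes \<open>xs\<close> the
  proximal point of \<open>xs + \<alpha> *\<^sub>R v\<close>, and \<open>k\<close> is a smooth
  extension of \<open>g\<close> along \<open>M \<times> \<Omega>\<close>. The assumption
  \<open>identification\<close> encapsulates partial smoothness and nondegeneracy;
  \<open>partly_smooth_problem.identification\<close> supplies it.\<close>

locale prox_chart = C2_chart M V \<phi> P S \<phi>' P'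
  for M V :: "'x::euclidean_space set" and \<phi> P S \<phi>' P' +
  fixes g :: "'x \<times> 'u::euclidean_space \<Rightarrow> ereal" and \<Omega> :: "'u set" and k :: "'x \<times> 'u \<Rightarrow> real"
    and k' :: "'x \<times> 'u \<Rightarrow> ('x \<times> 'u) \<Rightarrow>\<^sub>L real" and Vk :: "('x \<times> 'u) set"
    and \<alpha> :: real and xs :: 'x and us :: 'u and v :: 'x
  assumes \<alpha>: "\<alpha> > 0" and xs: "xs \<in> M" "xs \<in> V" and us: "us \<in> \<Omega>" and open_\<Omega>: "open \<Omega>"
    and Vk: "open Vk" "(xs, us) \<in> Vk"
    and k': "\<And>p. p \<in> Vk \<Longrightarrow> (k has_derivative k' p) (at p)" and C1_k': "C1_map_on Vk k'"
    and gk: "\<And>x u. x \<in> M \<Longrightarrow> u \<in> \<Omega> \<Longrightarrow> (x, u) \<in> Vk \<Longrightarrow> g (x, u) = ereal (k (x, u))"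
    and sub: "v \<in> convex_subdiff (\<lambda>x. g (x, us)) xs"
    and identification: "\<And>xn un vn. (\<And>n. xn n \<in> M) \<Longrightarrow> (\<And>n. un n \<in> \<Omega>) \<Longrightarrow> (\<And>n. (xn n, un n) \<in> Vk) \<Longrightarrow>
      xn \<longlonglongrightarrow> xs \<Longrightarrow> un \<longlonglongrightarrow> us \<Longrightarrow> vn \<longlonglongrightarrow> v \<Longrightarrow>
      (\<And>n t. t \<in> tangent_space M (xn n) \<Longrightarrow> vn n \<bullet> t = k' (xn n, un n) (t, 0)) \<Longrightarrow>
      \<exists>n::nat. vn n \<in> convex_subdiff (\<lambda>x. g (x, un n)) (xn n)"
begin

abbreviation "y0 \<equiv> \<phi> xs"

abbreviation "w0 \<equiv> xs + \<alpha> *\<^sub>R v"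

definition "D0 = {y \<in> \<phi> ` V. (P y, us) \<in> Vk}"

text \<open>This is \<open>g\<close> along \<open>M\<close> in chart coordinates, tilted by
  \<open>v\<close>. The subgradient inequality makes \<open>y0\<close> a minimizer on
  \<open>S\<close>, so that in directions of \<open>S\<close> the first derivative at
  \<open>y0\<close> vanishes and the second is nonnegative.\<close>

definition "h y = k (P y, us) - v \<bullet> P y"

definition h' :: "'x \<Rightarrow> 'x \<Rightarrow>\<^sub>L real" where
  "h' y = ((k' (P y, us) o\<^sub>L Blinfun (\<lambda>x. (x, 0))) - blinfun_inner_right v) o\<^sub>L P' y"

lemma y0: "y0 \<in> \<phi> ` V" "y0 \<in> S" "P y0 = xs"
  using xs \<phi>_in_S P_\<phi> by auto

lemma bounded_linear_Pair_0: "bounded_linear (\<lambda>x. (x, 0))"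
  by (rule bounded_linear_Pair[OF bounded_linear_ident bounded_linear_zero])

lemma h'_apply: "h' y s = k' (P y, us) (P' y s, 0) - v \<bullet> P' y s"
  by (simp add: h'_def blinfun.diff_left bounded_linear_Blinfun_apply[OF bounded_linear_Pair_0])

lemma y0_in_D0: "y0 \<in> D0"
  using y0 Vk by (simp add: D0_def)

lemma open_D0: "open D0"
proof -
  have "continuous_on (\<phi> ` V) (\<lambda>y. (P y, us))" by (intro continuous_intros cont_P)
  then have "open ((\<lambda>y. (P y, us)) -` Vk \<inter> \<phi> ` V)"
    using continuous_on_open_vimage[OF open_image] Vk(1) by blast
  moreover have "D0 = (\<lambda>y. (P y, us)) -` Vk \<inter> \<phi> ` V" by (auto simp: D0_def)
  ultimately show ?thesis by simp
qed

lemma h': assumes "y \<in> D0" shows "(h has_derivative h' y) (at y)"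
proof -
  have y: "y \<in> \<phi> ` V" "(P y, us) \<in> Vk" using assms by (auto simp: D0_def)
  have Pu: "((\<lambda>y. (P y, us)) has_derivative (\<lambda>s. (P' y s, 0))) (at y)"
    by (intro derivative_intros P' y)
  have "(h has_derivative (\<lambda>s. k' (P y, us) (P' y s, 0) - v \<bullet> P' y s)) (at y)"
    unfolding h_def
    by (rule has_derivative_diff[OF has_derivative_compose[OF Pu k'[OF y(2)]]
          has_derivative_inner_right[OF P'[OF y(1)]]])
  then show ?thesis unfolding h'_apply[abs_def, symmetric] .
qed

lemma C1_h': "C1_map_on D0 h'"
proof -
  have sub: "D0 \<subseteq> \<phi> ` V" by (auto simp: D0_def)
  have "C1_map_on D0 (\<lambda>y. (P y, us))"
    by (rule C1_map_on_Pair[OF C1_map_on_subset[OF C1_P sub] C1_map_on_const])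
  then have "C1_map_on D0 (\<lambda>y. k' (P y, us))"
    by (rule C1_map_on_compose[OF _ C1_k']) (auto simp: D0_def)
  then show ?thesis
    unfolding h'_def
    by (rule C1_map_on_bilinear[OF bounded_bilinear_blinfun_compose
          C1_map_on_diff[OF C1_map_on_bilinear[OF bounded_bilinear_blinfun_compose _ C1_map_on_const] C1_map_on_const]
          C1_map_on_subset[OF C1_P' sub]])
qed

definition "h'' = frechet_derivative h' (at y0)"

lemma h'': "(h' has_derivative h'') (at y0)"
proof -
  obtain D where "\<And>x. x \<in> D0 \<Longrightarrow> (h' has_derivative blinfun_apply (D x)) (at x)"
    using C1_h' by (rule C1_map_onE) (rule that)
  then show ?thesis
    unfolding h''_def using y0_in_D0 differentiableI frechet_derivative_works by blast
qed

lemma h''_symmetric: "h'' s t = h'' t s"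
  by (rule second_derivative_symmetric[OF open_D0 y0_in_D0 h' h''])

lemma h_min:
  assumes "y \<in> D0" and "y \<in> S"
  shows "h y0 \<le> h y"
proof -
  have y: "P y \<in> M" "(P y, us) \<in> Vk" using assms P_in_M_iff by (auto simp: D0_def)
  have "g (xs, us) + ereal (v \<bullet> (P y - xs)) \<le> g (P y, us)" using sub unfolding convex_subdiff_def by blast
  then show ?thesis
    unfolding gk[OF xs(1) us Vk(2)] gk[OF y(1) us y(2)]
    by (simp add: h_def y0 inner_diff_right)
qed

lemma h'_y0: "s \<in> S \<Longrightarrow> h' y0 s = 0" and h''_nonneg: "s \<in> S \<Longrightarrow> h'' s s \<ge> 0"
  using line_minimum_conditions[OF open_D0 y0_in_D0 h' h'', of s] h_min y0(2) S
  by (simp_all add: subspace_add subspace_scale)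

abbreviation "\<pi> \<equiv> closest_point S"

text \<open>The derivative in direction \<open>s\<close> of the proximal objective in chart
  coordinates, \<open>\<alpha> * k (P y, u)\<close> plus half the squared distance from
  \<open>P y\<close> to \<open>w\<close>.\<close>

definition E :: "'x \<Rightarrow> 'x \<Rightarrow> 'u \<Rightarrow> 'x \<Rightarrow> real" where
  "E y w u s = \<alpha> * k' (P y, u) (P' y s, 0) + (P y - w) \<bullet> P' y s"

text \<open>For \<open>y \<in> S\<close> this vanishes iff \<open>E y w u\<close> does on \<open>S\<close>; the second summand pins \<open>y\<close> to \<open>S\<close>, so that
  the implicit function theorem applies on the whole space.\<close>

definition H :: "'x \<times> 'x \<times> 'u \<Rightarrow> 'x" where
  "H q = (\<Sum>b\<in>Basis. E (fst q) (fst (snd q)) (snd (snd q)) (\<pi> b) *\<^sub>R b) + (fst q - \<pi> (fst q))"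

lemma linear_E: "linear (E y w u)"
proof (rule linearI)
  have "(P' y (a + b), 0 :: 'u) = (P' y a, 0) + (P' y b, 0)" for a b by (simp add: blinfun.add_right)
  then show "E y w u (a + b) = E y w u a + E y w u b" for a b
    unfolding E_def by (simp only: blinfun.add_right inner_add_right distrib_left add_ac)
  have "(P' y (c *\<^sub>R a), 0 :: 'u) = c *\<^sub>R (P' y a, 0)" for a c by (simp add: blinfun.scaleR_right)
  then show "E y w u (c *\<^sub>R a) = c *\<^sub>R E y w u a" for a c
    unfolding E_def by (simp only: blinfun.scaleR_right inner_scaleR_right real_scaleR_def distrib_left mult.left_commute)
qed

lemma E_us: "E y w us s = \<alpha> * h' y s + (P y - w + \<alpha> *\<^sub>R v) \<bullet> P' y s"
  by (simp add: E_def h'_apply inner_add_left algebra_simps)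

lemma H_inner: "H (y, w, u) \<bullet> s = E y w u (\<pi> s) + (y - \<pi> y) \<bullet> s"
proof -
  have "\<pi> s = (\<Sum>b\<in>Basis. (s \<bullet> b) *\<^sub>R \<pi> b)"
    using linear_sum[OF linear_closest_point_subspace[OF S]] linear_cmul[OF linear_closest_point_subspace[OF S]]
    by (metis (no_types, lifting) euclidean_representation sum.cong)
  then have "E y w u (\<pi> s) = (\<Sum>b\<in>Basis. E y w u (\<pi> b) * (b \<bullet> s))"
    by (simp add: linear_sum[OF linear_E] linear_cmul[OF linear_E] mult.commute inner_commute[of s])
  then show ?thesis
    by (simp add: H_def inner_add_left inner_sum_left)
qed

lemma H_eq_0:
  assumes "H (y, w, u) = 0"
  shows "y \<in> S" and "s \<in> S \<Longrightarrow> E y w u s = 0"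
proof -
  \<comment> \<open>Testing with the normal part of \<open>y\<close> removes \<open>E\<close>,
    because this part projects to 0, and leaves its own square.\<close>
  have "\<pi> (y - \<pi> y) = 0"
    by (rule closest_point_subspace_eq[OF S])
      (use closest_point_subspace(2)[OF S] subspace_0[OF S] in auto)
  then have "(y - \<pi> y) \<bullet> (y - \<pi> y) = 0"
    using H_inner[of y w u "y - \<pi> y"] assms linear_0[OF linear_E] by simp
  then show y: "y \<in> S" using closest_point_subspace(1)[OF S, of y] by simp
  show "E y w u s = 0" if "s \<in> S"
    using H_inner[of y w u s] assms closest_point_self[OF that] closest_point_self[OF y] by simp
qed

definition W0 :: "('x \<times> 'x \<times> 'u) set" where
  "W0 = {q. fst q \<in> \<phi> ` V \<and> (P (fst q), snd (snd q)) \<in> Vk \<and> snd (snd q) \<in> \<Omega>}"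

lemma open_W0: "open W0"
proof -
  have o: "open (fst -` (\<phi> ` V) \<inter> (\<lambda>q. snd (snd q)) -` \<Omega> :: ('x \<times> 'x \<times> 'u) set)"
    by (intro open_Int open_vimage open_image open_\<Omega> continuous_intros)
  have "continuous_on (fst -` (\<phi> ` V) \<inter> (\<lambda>q. snd (snd q)) -` \<Omega>) (\<lambda>q :: 'x \<times> 'x \<times> 'u. (P (fst q), snd (snd q)))"
    by (intro continuous_intros continuous_on_compose2[OF cont_P]) auto
  then have "open ((\<lambda>q. (P (fst q), snd (snd q))) -` Vk \<inter> (fst -` (\<phi> ` V) \<inter> (\<lambda>q. snd (snd q)) -` \<Omega> :: ('x \<times> 'x \<times> 'u) set))"
    using continuous_on_open_vimage[OF o] Vk(1) by blast
  moreover have "W0 = (\<lambda>q. (P (fst q), snd (snd q))) -` Vk \<inter> (fst -` (\<phi> ` V) \<inter> (\<lambda>q. snd (snd q)) -` \<Omega>)"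
    by (auto simp: W0_def)
  ultimately show ?thesis by simp
qed

lemma C1_H: "C1_map_on W0 H"
proof -
  have bl: "bounded_linear \<pi>"
    using linear_closest_point_subspace[OF S] by (simp add: linear_linear)
  have fst: "C1_map_on W0 (\<lambda>q. fst q)" by (rule C1_map_on_bounded_linear[OF bounded_linear_fst])
  have w: "C1_map_on W0 (\<lambda>q. fst (snd q))"
    by (rule C1_map_on_bounded_linear[OF bounded_linear_compose[OF bounded_linear_fst bounded_linear_snd]])
  have u: "C1_map_on W0 (\<lambda>q. snd (snd q))"
    by (rule C1_map_on_bounded_linear[OF bounded_linear_compose[OF bounded_linear_snd bounded_linear_snd]])
  have P: "C1_map_on W0 (\<lambda>q. P (fst q))"
    by (rule C1_map_on_compose[OF fst C1_P]) (auto simp: W0_def)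
  have "C1_map_on W0 (\<lambda>q. P' (fst q))"
    by (rule C1_map_on_compose[OF fst C1_P']) (auto simp: W0_def)
  then have P's: "C1_map_on W0 (\<lambda>q. P' (fst q) s)" for s
    by (rule C1_map_on_bilinear[OF bounded_bilinear_blinfun_apply _ C1_map_on_const])
  have k: "C1_map_on W0 (\<lambda>q. k' (P (fst q), snd (snd q)))"
    by (rule C1_map_on_compose[OF C1_map_on_Pair[OF P u] C1_k']) (auto simp: W0_def)
  have "C1_map_on W0 (\<lambda>q. E (fst q) (fst (snd q)) (snd (snd q)) s)" for s
    unfolding E_def
    by (rule C1_map_on_add[OF C1_map_on_bilinear[OF bounded_bilinear_mult C1_map_on_const
            C1_map_on_bilinear[OF bounded_bilinear_blinfun_apply k C1_map_on_Pair[OF P's C1_map_on_const]]]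
          C1_map_on_bilinear[OF bounded_bilinear_inner C1_map_on_diff[OF P w] P's]])
  then have "C1_map_on W0 (\<lambda>q. (\<Sum>b\<in>Basis. E (fst q) (fst (snd q)) (snd (snd q)) (\<pi> b) *\<^sub>R b) + (fst q - \<pi> (fst q)))"
    by (intro C1_map_on_add C1_map_on_sum C1_map_on_diff fst C1_map_on_compose[OF fst C1_map_on_bounded_linear[OF bl, of UNIV]]
        C1_map_on_bilinear[OF bounded_bilinear_scaleR _ C1_map_on_const]) auto
  then show ?thesis unfolding H_def[abs_def] .
qed

lemma base_in_W0: "(y0, w0, us) \<in> W0"
  using y0 Vk us by (simp add: W0_def)

lemma H_base: "H (y0, w0, us) = 0"
proof -
  have "H (y0, w0, us) \<bullet> s = 0" for s
    unfolding H_inner E_us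
    by (simp add: h'_y0[OF closest_point_subspace(1)[OF S]] y0 closest_point_self)
  then show ?thesis by (metis inner_eq_zero_iff)
qed

text \<open>Testing the linearized equation with the normal part of \<zeta> puts \<zeta> into
  \<open>S\<close>; testing with \<zeta> itself gives a vanishing sum of two nonnegative terms, the
  second being the square of \<open>norm (P' y0 \<zeta>)\<close>.\<close>

lemma H_derivative_injective:
  assumes D: "(H has_derivative D) (at (y0, w0, us))" and z: "D (\<zeta>, 0) = 0"
  shows "\<zeta> = 0"
proof -
  have y: "((\<lambda>y. (y, w0, us)) has_derivative (\<lambda>\<zeta>. (\<zeta>, 0, 0))) (at y0)" by (intro derivative_intros)
  have Ds: "((\<lambda>y. H (y, w0, us) \<bullet> s) has_derivative (\<lambda>\<zeta>. D (\<zeta>, 0, 0) \<bullet> s)) (at y0)" for s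
    by (rule has_derivative_inner_left[OF has_derivative_compose[OF y D]])
  have z': "D (\<zeta>, 0, 0) = 0" using z by (simp add: zero_prod_def)
  have bl: "bounded_linear \<pi>"
    using linear_closest_point_subspace[OF S] by (simp add: linear_linear)
  have "\<zeta> \<in> S"
  proof -
    define s where "s = \<zeta> - \<pi> \<zeta>"
    have \<pi>s: "\<pi> s = 0"
      unfolding s_def by (rule closest_point_subspace_eq[OF S])
        (use closest_point_subspace(2)[OF S] subspace_0[OF S] in auto)
    have eq: "(\<lambda>y. H (y, w0, us) \<bullet> s) = (\<lambda>y. (y - \<pi> y) \<bullet> s)"
      by (rule ext) (simp add: H_inner \<pi>s linear_0[OF linear_E])
    have "((\<lambda>y. (y - \<pi> y) \<bullet> s) has_derivative (\<lambda>\<zeta>. (\<zeta> - \<pi> \<zeta>) \<bullet> s)) (at y0)"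
      by (intro derivative_intros bounded_linear_imp_has_derivative bl)
    then have "(\<lambda>\<zeta>. D (\<zeta>, 0, 0) \<bullet> s) = (\<lambda>\<zeta>. (\<zeta> - \<pi> \<zeta>) \<bullet> s)"
      using Ds[of s] has_derivative_unique unfolding eq by blast
    from fun_cong[OF this, of \<zeta>] have "s = 0" using z' by (simp add: s_def)
    then show ?thesis using closest_point_subspace(1)[OF S, of \<zeta>] by (simp add: s_def)
  qed
  \<comment> \<open>By the choice of \<open>w0\<close> the factor \<open>P y - xs\<close> vanishes
    at \<open>y0\<close>, and with it the term containing the derivative of
    \<open>P'\<close>.\<close>
  have "((\<lambda>y. \<alpha> * h' y \<zeta> + (P y - xs) \<bullet> P' y \<zeta>) has_derivative
      (\<lambda>t. \<alpha> * h'' t \<zeta> + P' y0 t \<bullet> P' y0 \<zeta>)) (at y0)"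
  proof -
    obtain P'' where P'': "\<And>y. y \<in> \<phi> ` V \<Longrightarrow> (P' has_derivative blinfun_apply (P'' y)) (at y)"
      using C1_P' by (rule C1_map_onE) (rule that)
    have 1: "((\<lambda>y. h' y \<zeta>) has_derivative (\<lambda>t. h'' t \<zeta>)) (at y0)"
      using blinfun.FDERIV[OF h'' has_derivative_const[of \<zeta>]] by (simp add: blinfun.zero_right)
    have 2: "((\<lambda>y. P' y \<zeta>) has_derivative (\<lambda>t. P'' y0 t \<zeta>)) (at y0)"
      using blinfun.FDERIV[OF P''[OF y0(1)] has_derivative_const[of \<zeta>]] by (simp add: blinfun.zero_right)
    have 3: "((\<lambda>y. P y - xs) has_derivative (\<lambda>t. P' y0 t)) (at y0)"
      by (auto intro!: derivative_eq_intros P'[OF y0(1)])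
    show ?thesis
      using has_derivative_add[OF has_derivative_mult_right[OF 1, of \<alpha>] bounded_bilinear.FDERIV[OF bounded_bilinear_inner 3 2]]
      by (simp add: y0)
  qed
  moreover have "((\<lambda>y. \<alpha> * h' y \<zeta> + (P y - xs) \<bullet> P' y \<zeta>) has_derivative (\<lambda>t. D (t, 0, 0) \<bullet> \<zeta>)) (at y0)"
  proof -
    have "(y - \<pi> y) \<bullet> \<zeta> = 0" for y by (rule closest_point_subspace(2)[OF S \<open>\<zeta> \<in> S\<close>])
    then have "(\<lambda>y. H (y, w0, us) \<bullet> \<zeta>) = (\<lambda>y. \<alpha> * h' y \<zeta> + (P y - xs) \<bullet> P' y \<zeta>)"
      by (intro ext) (simp add: H_inner E_us closest_point_self[OF \<open>\<zeta> \<in> S\<close>])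
    then show ?thesis using Ds[of \<zeta>] by simp
  qed
  ultimately have "(\<lambda>t. D (t, 0, 0) \<bullet> \<zeta>) = (\<lambda>t. \<alpha> * h'' t \<zeta> + P' y0 t \<bullet> P' y0 \<zeta>)"
    using has_derivative_unique by blast
  from fun_cong[OF this, of \<zeta>] have "\<alpha> * h'' \<zeta> \<zeta> + P' y0 \<zeta> \<bullet> P' y0 \<zeta> = 0" using z' by simp
  moreover have "\<alpha> * h'' \<zeta> \<zeta> \<ge> 0" using h''_nonneg[OF \<open>\<zeta> \<in> S\<close>] \<alpha> by simp
  ultimately have "P' y0 \<zeta> = 0"
    by (smt (verit) inner_eq_zero_iff inner_ge_zero)
  then show ?thesis using \<phi>'_P'[OF y0(1), of \<zeta>] by (simp add: blinfun.zero_right)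
qed

text \<open>The equation \<open>E = 0\<close> only controls the residual
  \<open>(w - P (Y (w, u))) /\<^sub>R \<alpha>\<close> on tangent vectors;
  \<open>identification\<close> has to supply its normal part. The equation is exported for the
  parameter \<open>us\<close>, where it is later differentiated in \<open>x\<close>.\<close>

theorem prox_in_chart:
  obtains W Y where "open W" "(w0, us) \<in> W" "C1_map_on W Y" "Y (w0, us) = y0"
    "\<And>w u. (w, u) \<in> W \<Longrightarrow> Y (w, u) \<in> \<phi> ` V \<and> Y (w, u) \<in> S \<and> u \<in> \<Omega> \<and> prox g \<alpha> w u = P (Y (w, u))"
    "\<And>w s. (w, us) \<in> W \<Longrightarrow> s \<in> S \<Longrightarrow> E (Y (w, us)) w us s = 0"
proof -
  obtain H' where H': "\<And>x. x \<in> W0 \<Longrightarrow> (H has_derivative blinfun_apply (H' x)) (at x)"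
    using C1_H by (rule C1_map_onE) (rule that)
  obtain Q Y where Q: "open Q" "(w0, us) \<in> Q" "C1_map_on Q Y" "Y (w0, us) = y0"
    "\<And>p. p \<in> Q \<Longrightarrow> (Y p, p) \<in> W0 \<and> H (Y p, p) = 0"
    using C1_implicit_function[OF open_W0 C1_H base_in_W0 H_base H'[OF base_in_W0]]
      H_derivative_injective[OF H'[OF base_in_W0]] by metis
  have Y: "Y (w, u) \<in> \<phi> ` V" "(P (Y (w, u)), u) \<in> Vk" "u \<in> \<Omega>" "Y (w, u) \<in> S"
    "\<And>s. s \<in> S \<Longrightarrow> E (Y (w, u)) w u s = 0" if "(w, u) \<in> Q" for w u
    using Q(5)[OF that] H_eq_0[of "Y (w, u)" w u] by (auto simp: W0_def)
  define R where "R p \<longleftrightarrow> p \<in> Q \<and> (fst p - P (Y p)) /\<^sub>R \<alpha> \<in> convex_subdiff (\<lambda>x. g (x, snd p)) (P (Y p))" for p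
  have "\<forall>\<^sub>F p in nhds (w0, us). R p"
  proof (rule ccontr)
    assume no: "\<not> (\<forall>\<^sub>F p in nhds (w0, us). R p)"
    have evQ: "\<forall>\<^sub>F p in nhds (w0, us). p \<in> Q" using Q(1,2) by (rule eventually_nhds_in_open)
    \<comment> \<open>The sequence of counterexamples has to stay in \<open>Q\<close>, where the
      equation for \<open>Y\<close> is available, so \<open>R\<close> is negated relative to
      \<open>Q\<close>.\<close>
    have "\<not> (\<forall>\<^sub>F p in nhds (w0, us). p \<in> Q \<longrightarrow> R p)"
    proof
      assume "\<forall>\<^sub>F p in nhds (w0, us). p \<in> Q \<longrightarrow> R p"
      from eventually_mp[OF this evQ] show False using no by simp
    qed
    then obtain s where s: "s \<longlonglongrightarrow> (w0, us)" "\<And>n::nat. \<not> (s n \<in> Q \<longrightarrow> R (s n))"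
      by (rule not_eventually_nhds_sequence) (rule that)
    then have sQ: "\<And>n. s n \<in> Q" and nR: "\<And>n. \<not> R (s n)" by auto
    define xn where "xn n = P (Y (s n))" for n
    define un where "un n = snd (s n)" for n
    define vn where "vn n = (fst (s n) - xn n) /\<^sub>R \<alpha>" for n
    have sY: "Y (s n) \<in> \<phi> ` V" "(xn n, un n) \<in> Vk" "un n \<in> \<Omega>" "Y (s n) \<in> S"
      "\<And>t. t \<in> S \<Longrightarrow> E (Y (s n)) (fst (s n)) (un n) t = 0" for n
      using Y[of "fst (s n)" "snd (s n)"] sQ[of n] by (auto simp: xn_def un_def)
    have Ylim: "(\<lambda>n. Y (s n)) \<longlonglongrightarrow> y0"
      using continuous_on_tendsto_compose[OF C1_map_on_imp_continuous_on[OF Q(3)] s(1) Q(2)] sQ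
      by (simp add: Q(4) always_eventually)
    have xlim: "xn \<longlonglongrightarrow> xs"
      using continuous_on_tendsto_compose[OF cont_P Ylim y0(1)] sY(1)
      by (simp add: xn_def[abs_def] y0 always_eventually)
    have "vn \<longlonglongrightarrow> (w0 - xs) /\<^sub>R \<alpha>"
      unfolding vn_def using tendsto_fst[OF s(1)] xlim by (intro tendsto_intros) simp_all
    then have vlim: "vn \<longlonglongrightarrow> v" using \<alpha> by simp
    have xM: "xn n \<in> M" for n using P_in_M_iff[OF sY(1)] sY(4) by (simp add: xn_def)
    have "vn n \<bullet> t = k' (xn n, un n) (t, 0)" if t: "t \<in> tangent_space M (xn n)" for n t
    proof -
      have "t \<in> P' (Y (s n)) ` S"
        using t tangent_space_eq[OF sY(1)[of n] sY(4)[of n]] by (simp add: xn_def)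
      then obtain r where r: "r \<in> S" "t = P' (Y (s n)) r" by blast
      have "\<alpha> * k' (xn n, un n) (t, 0) + (xn n - fst (s n)) \<bullet> t = 0"
        using sY(5)[OF r(1), of n] by (simp add: E_def r(2) xn_def)
      then have "\<alpha> * k' (xn n, un n) (t, 0) = (fst (s n) - xn n) \<bullet> t" by (simp add: inner_diff_left)
      then have "vn n \<bullet> t = inverse \<alpha> * (\<alpha> * k' (xn n, un n) (t, 0))" by (simp add: vn_def)
      then show ?thesis using \<alpha> by simp
    qed
    note crit = this
    have ulim: "un \<longlonglongrightarrow> us" using tendsto_snd[OF s(1)] by (simp add: un_def[abs_def])
    obtain n where "vn n \<in> convex_subdiff (\<lambda>x. g (x, un n)) (xn n)"
      using identification[OF xM sY(3,2) xlim ulim vlim crit] by blast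
    then show False using nR[of n] sQ[of n] by (simp add: R_def vn_def xn_def un_def)
  qed
  then obtain W where W: "open W" "(w0, us) \<in> W" "\<And>p. p \<in> W \<Longrightarrow> R p"
    unfolding eventually_nhds by blast
  have WQ: "W \<subseteq> Q" using W(3) by (auto simp: R_def)
  show ?thesis
  proof (rule that[OF W(1,2) C1_map_on_subset[OF Q(3) WQ] Q(4)])
    fix w u assume wu: "(w, u) \<in> W"
    have "prox g \<alpha> w u = P (Y (w, u))"
      by (rule prox_eqI[OF \<alpha>]) (use W(3)[OF wu] in \<open>simp add: R_def\<close>)
    then show "Y (w, u) \<in> \<phi> ` V \<and> Y (w, u) \<in> S \<and> u \<in> \<Omega> \<and> prox g \<alpha> w u = P (Y (w, u))"
      using Y wu WQ by blast
  next
    fix w s assume "(w, us) \<in> W" "s \<in> S"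
    then show "E (Y (w, us)) w us s = 0" using Y(5) WQ by blast
  qed
qed

end

section \<open>Identification for the parametric problem\<close>

lemma inner_sum_Basis_functional:
  fixes F :: "'a::euclidean_space \<Rightarrow> real"
  assumes "linear F"
  shows "(\<Sum>b\<in>Basis. F b *\<^sub>R b) \<bullet> h = F h"
proof -
  have "F h = F (\<Sum>b\<in>Basis. (h \<bullet> b) *\<^sub>R b)" by (simp add: euclidean_representation)
  also have "\<dots> = (\<Sum>b\<in>Basis. (h \<bullet> b) * F b)" by (simp add: linear_sum[OF assms] linear_cmul[OF assms])
  finally show ?thesis by (simp add: inner_sum_left inner_commute[of h] mult.commute)
qed

lemma C2_partial_gradient:
  fixes f :: "'x::euclidean_space \<times> 'u::euclidean_space \<Rightarrow> real"
  assumes "C2_map_on UNIV f"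
  obtains G where "C1_map_on UNIV G"
    and "\<And>x u. ((\<lambda>y. f (y, u)) has_derivative (\<lambda>h. G (x, u) \<bullet> h)) (at x)"
    and "\<And>x u. grad (\<lambda>y. f (y, u)) x = G (x, u)"
proof -
  obtain f' where f': "\<And>p. (f has_derivative blinfun_apply (f' p)) (at p)" "C1_map_on UNIV f'"
    using C2_map_onE[OF assms] by (metis UNIV_I)
  define G where "G p = (\<Sum>b\<in>Basis. f' p (b, 0) *\<^sub>R b)" for p
  have lin: "linear (\<lambda>h. f' p (h, 0))" for p
  proof -
    have "bounded_linear (\<lambda>h. f' p (h, 0))"
      by (rule bounded_linear_compose[OF blinfun.bounded_linear_right
            bounded_linear_Pair[OF bounded_linear_ident bounded_linear_zero]])
    then show ?thesis by (rule bounded_linear.linear)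
  qed
  have C1: "C1_map_on UNIV G"
    unfolding G_def
    by (rule C1_map_on_sum, rule C1_map_on_bilinear[OF bounded_bilinear_scaleR
          C1_map_on_bilinear[OF bounded_bilinear_blinfun_apply f'(2) C1_map_on_const] C1_map_on_const])
  have der: "((\<lambda>y. f (y, u)) has_derivative (\<lambda>h. G (x, u) \<bullet> h)) (at x)" for x u
  proof -
    have "((\<lambda>y. (y, u)) has_derivative (\<lambda>h. (h, 0))) (at x)" by (intro derivative_intros)
    from has_derivative_compose[OF this f'(1)] show ?thesis
      unfolding G_def inner_sum_Basis_functional[OF lin] .
  qed
  have "grad (\<lambda>y. f (y, u)) x = G (x, u)" for x u
    unfolding grad_def
  proof (rule the_equality)
    show "GDERIV (\<lambda>y. f (y, u)) x :> G (x, u)" using der by (simp add: gderiv_def inner_commute)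
    fix D assume "GDERIV (\<lambda>y. f (y, u)) x :> D"
    then have "(\<lambda>h. h \<bullet> D) = (\<lambda>h. G (x, u) \<bullet> h)"
      unfolding gderiv_def using der has_derivative_unique by blast
    then have "h \<bullet> (D - G (x, u)) = 0" for h by (metis inner_commute inner_diff_right right_minus_eq)
    then show "D = G (x, u)" by (metis inner_eq_zero_iff right_minus_eq)
  qed
  with C1 der show ?thesis by (rule that)
qed

lemma lipschitz_derivative_bound:
  assumes "L-lipschitz_on UNIV F" and F': "(F has_derivative F') (at x)"
  shows "norm (F' h) \<le> L * norm h"
proof (rule tendsto_upperbound[OF tendsto_norm[OF has_derivative_quotient_at_right[OF F', of h]]])
  show "\<forall>\<^sub>F s in at_right 0. norm ((F (x + s *\<^sub>R h) - F x) /\<^sub>R s) \<le> L * norm h"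
    using eventually_at_right_less[of "0::real"]
  proof eventually_elim
    case (elim s)
    have "norm (F (x + s *\<^sub>R h) - F x) \<le> L * norm (s *\<^sub>R h)"
      using lipschitz_onD[OF assms(1), of "x + s *\<^sub>R h" x] by (simp add: dist_norm)
    then have "norm (F (x + s *\<^sub>R h) - F x) \<le> s * (L * norm h)" using elim by (simp add: mult_ac)
    then have "inverse s * norm (F (x + s *\<^sub>R h) - F x) \<le> inverse s * (s * (L * norm h))"
      using elim by (intro mult_left_mono) auto
    also have "\<dots> = L * norm h" using elim by simp
    finally show ?case using elim by simp
  qed
qed simp

lemma gradient_derivative_symmetric:
  fixes f :: "'a::euclidean_space \<Rightarrow> real"
  assumes f: "\<And>x. (f has_derivative (\<lambda>h. G x \<bullet> h)) (at x)" and G: "(G has_derivative G') (at x)"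
  shows "G' a \<bullet> b = a \<bullet> G' b"
proof -
  have 1: "(f has_derivative blinfun_apply (blinfun_inner_right (G x))) (at x)" for x
    using f by (simp add: blinfun_inner_right.rep_eq)
  have 2: "((\<lambda>x. blinfun_inner_right (G x)) has_derivative (\<lambda>h. blinfun_inner_right (G' h))) (at x)"
    by (rule bounded_linear.has_derivative[OF bounded_linear_blinfun_inner_right G])
  from second_derivative_symmetric[OF open_UNIV UNIV_I 1 2, of a b] show ?thesis
    by (simp add: inner_commute)
qed

lemma subspace_tangent_space_submanifold:
  assumes "C2_submanifold M" and "x \<in> M"
  shows "subspace (tangent_space M x)"
proof -
  obtain d where "C2_manifold_around d M x" using assms unfolding C2_submanifold_def by blast
  then obtain V \<phi> P S \<phi>' P' where "C2_chart M V \<phi> P S \<phi>' P'" "x \<in> V" by (rule C2_manifold_around_chart) (rule that)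
  then show ?thesis using C2_chart.subspace_tangent_space assms(2) by blast
qed

locale partly_smooth_problem =
  fixes M :: "'x::euclidean_space set" and \<Omega> :: "'u::euclidean_space set" and g :: "'x \<times> 'u \<Rightarrow> ereal"
  assumes M: "C2_submanifold M" and open_\<Omega>: "open \<Omega>" and ps: "partly_smooth g (M \<times> \<Omega>)"
    and conv: "\<And>u. u \<in> \<Omega> \<Longrightarrow> convex_fun (\<lambda>x. g (x, u))"
begin

lemma partly_smooth_pointD:
  assumes "x \<in> M" and "u \<in> \<Omega>"
  shows "regular_fun_at g (x, u)" and "subdiff g (x, u) \<noteq> {}"
    and "par (subdiff g (x, u)) = normal_space M x \<times> {0}"
    and "setmap_continuous_at (subdiff g) (M \<times> \<Omega>) (x, u)"
    and "\<exists>d. C2_manifold_around d (M \<times> \<Omega>) (x, u)"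
    and "\<exists>k. C2_extension (M \<times> \<Omega>) g (x, u) k"
proof -
  have *: "partly_smooth_at g (M \<times> \<Omega>) (x, u)" using ps assms unfolding partly_smooth_def by simp
  then show ne: "subdiff g (x, u) \<noteq> {}"
    and "setmap_continuous_at (subdiff g) (M \<times> \<Omega>) (x, u)"
    and "\<exists>d. C2_manifold_around d (M \<times> \<Omega>) (x, u)"
    and "\<exists>k. C2_extension (M \<times> \<Omega>) g (x, u) k"
    unfolding partly_smooth_at_def by blast+
  show "par (subdiff g (x, u)) = normal_space M x \<times> {0}"
    using * normal_space_Times[OF assms(1) open_\<Omega> assms(2)] unfolding partly_smooth_at_def by simp
  \<comment> \<open>Regularity is granted only where \<open>g\<close> is finite; the existence of a
    subgradient certifies finiteness.\<close>
  have "g (x, u) \<noteq> \<infinity>" using ne unfolding subdiff_def by auto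
  then show "regular_fun_at g (x, u)"
    using * eventually_nhds_x_imp_x unfolding partly_smooth_at_def by blast
qed

lemma subdiff_eq:
  assumes "x \<in> M" and "u \<in> \<Omega>"
  shows "subdiff g (x, u) = regular_subdiff g (x, u)"
  by (rule subdiff_eq_regular_subdiff[OF partly_smooth_pointD(1)[OF assms]])

lemma subdiff_imp_partial:
  assumes "x \<in> M" and "u \<in> \<Omega>" and "(a, w) \<in> subdiff g (x, u)"
  shows "a \<in> convex_subdiff (\<lambda>x. g (x, u)) x"
  using regular_subdiff_partial[of a w g x u] assms subdiff_eq[OF assms(1,2)]
    convex_regular_imp_convex_subgradient[OF conv[OF assms(2)]] by simp

text \<open>The one-sided estimate is used for \<open>(t, b)\<close> and for its negative. Thus the
  tangential part of a joint subgradient, which includes its whole \<open>u\<close> part, is that of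
  the derivative of \<open>k\<close>.\<close>

lemma subdiff_inner_tangent:
  assumes "x \<in> M" and "u \<in> \<Omega>" and "open Vk" and "(x, u) \<in> Vk"
    and k': "(k has_derivative k') (at (x, u))"
    and gk: "\<And>x u. x \<in> M \<Longrightarrow> u \<in> \<Omega> \<Longrightarrow> (x, u) \<in> Vk \<Longrightarrow> g (x, u) = ereal (k (x, u))"
    and p: "p \<in> subdiff g (x, u)" and t: "t \<in> tangent_space M x"
  shows "p \<bullet> (t, b) = k' (t, b)"
proof -
  have le: "p \<bullet> (t, b) \<le> k' (t, b)" if "t \<in> tangent_space M x" for t b
  proof (rule regular_subdiff_tangent_le[where h = g and x = "(x, u)" and M = "M \<times> \<Omega>", OF _ assms(3,4) _ k'])
    show "p \<in> regular_subdiff g (x, u)" using p subdiff_eq[OF assms(1,2)] by simp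
    show "g y = ereal (k y)" if "y \<in> M \<times> \<Omega> \<inter> Vk" for y using gk that by (cases y) auto
    show "(t, b) \<in> tangent_space (M \<times> \<Omega>) (x, u)"
      using tangent_space_Times[OF assms(1) open_\<Omega> assms(2)] that by simp
  qed
  have "- t \<in> tangent_space M x" by (rule subspace_neg[OF subspace_tangent_space_submanifold[OF M assms(1)] t])
  from le[OF this, of "- b"] have "p \<bullet> (- (t, b)) \<le> k' (- (t, b))" by simp
  then have "k' (t, b) \<le> p \<bullet> (t, b)"
    unfolding inner_minus_right linear_neg[OF has_derivative_linear[OF k']] by simp
  then show ?thesis using le[OF t] by (intro antisym)
qed

text \<open>The \<open>u\<close> part of every joint subgradient over
  \<open>M \<times> \<Omega>\<close> is the partial gradient \<open>Dk\<close> of the smooth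
  extension, so candidates are completed by \<open>Dk\<close>. At the base point the partial
  subdifferential is the projection of the joint one, and relative interiority of \<open>v\<close>
  leaves room around \<open>(v, Dk (xs, us))\<close> in all normal directions.\<close>

lemma identification:
  assumes xs: "xs \<in> M" and us: "us \<in> \<Omega>" and Vk: "open Vk" "(xs, us) \<in> Vk"
    and k': "\<And>p. p \<in> Vk \<Longrightarrow> (k has_derivative blinfun_apply (k' p)) (at p)" and cont_k': "continuous_on Vk k'"
    and gk: "\<And>x u. x \<in> M \<Longrightarrow> u \<in> \<Omega> \<Longrightarrow> (x, u) \<in> Vk \<Longrightarrow> g (x, u) = ereal (k (x, u))"
    and v: "v \<in> rel_interior (convex_subdiff (\<lambda>x. g (x, us)) xs)"
    and xn: "\<And>n. xn n \<in> M" and un: "\<And>n. un n \<in> \<Omega>" and xun: "\<And>n. (xn n, un n) \<in> Vk"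
    and lim: "xn \<longlonglongrightarrow> xs" "un \<longlonglongrightarrow> us" "vn \<longlonglongrightarrow> v"
    and crit: "\<And>n t. t \<in> tangent_space M (xn n) \<Longrightarrow> vn n \<bullet> t = k' (xn n, un n) (t, 0)"
  shows "\<exists>n::nat. vn n \<in> convex_subdiff (\<lambda>x. g (x, un n)) (xn n)"
proof -
  define Dk where "Dk p = (\<Sum>b\<in>Basis. k' p (0, b) *\<^sub>R b)" for p
  have bl: "bounded_linear (\<lambda>b. k' p (0, b))" for p
    by (rule bounded_linear_compose[OF blinfun.bounded_linear_right
          bounded_linear_Pair[OF bounded_linear_zero bounded_linear_ident]])
  have Dk: "Dk p \<bullet> b = k' p (0, b)" for p b
    unfolding Dk_def by (rule inner_sum_Basis_functional[OF bounded_linear.linear[OF bl]])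
  have tan: "p \<bullet> (t, b) = k' (x, u) (t, b)"
    if "x \<in> M" "u \<in> \<Omega>" "(x, u) \<in> Vk" "p \<in> subdiff g (x, u)" "t \<in> tangent_space M x" for x u p t b
    by (rule subdiff_inner_tangent[OF that(1,2) Vk(1) that(3) k'[OF that(3)] gk that(4,5)])
  have snd_eq: "snd p = Dk (x, u)" if "x \<in> M" "u \<in> \<Omega>" "(x, u) \<in> Vk" "p \<in> subdiff g (x, u)" for x u p
  proof -
    have "snd p \<bullet> b = Dk (x, u) \<bullet> b" for b
      using tan[OF that zero_in_tangent_space[OF that(1)], of b] by (simp add: Dk inner_prod_def)
    then show ?thesis by (metis inner_commute vector_eq_ldot)
  qed
  let ?C = "subdiff g (xs, us)" and ?D = "convex_subdiff (\<lambda>x. g (x, us)) xs"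
  obtain c where c: "c \<in> ?C" using partly_smooth_pointD(2)[OF xs us] by blast
  have lift: "(a, Dk (xs, us)) \<in> ?C" if a: "a \<in> ?D" for a
  proof -
    have "lsc_fun g" "\<And>p. g p \<noteq> - \<infinity>" using ps unfolding partly_smooth_def proper_fun_def by auto
    moreover have "w = 0" if "(0, w) \<in> par ?C" for w
      using that partly_smooth_pointD(3)[OF xs us] by auto
    ultimately obtain w where "(a, w) \<in> ?C"
      using partial_subgradient_lift[OF _ _ partly_smooth_pointD(1)[OF xs us] a c] by blast
    then show ?thesis using snd_eq[OF xs us Vk(2), of "(a, w)"] by simp
  qed
  have D_eq: "?D = fst ` ?C"
  proof (intro equalityI subsetI)
    fix a assume "a \<in> ?D"
    then show "a \<in> fst ` ?C" using lift[of a] by force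
  next
    fix a assume "a \<in> fst ` ?C"
    then obtain w where "(a, w) \<in> ?C" by force
    then show "a \<in> ?D" by (rule subdiff_imp_partial[OF xs us])
  qed
  have vD: "v \<in> ?D" using v rel_interior_subset by blast
  obtain e where e: "e > 0" "ball v e \<inter> affine hull ?D \<subseteq> ?D" using v by (auto simp: mem_rel_interior_ball)
  have interior: "\<exists>\<epsilon>>0. (v, Dk (xs, us)) + \<epsilon> *\<^sub>R a \<in> ?C" if a: "a \<in> normal_space (M \<times> \<Omega>) (xs, us)" for a
  proof -
    obtain d where d: "a = (d, 0)" "(d, 0) \<in> par ?C"
      using a normal_space_Times[OF xs open_\<Omega> us] partly_smooth_pointD(3)[OF xs us] by auto
    \<comment> \<open>The step along \<open>d\<close> stays within half the radius \<open>e\<close>;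
      the \<open>+ 1\<close> covers \<open>d = 0\<close>.\<close>
    define \<epsilon> where "\<epsilon> = e / (2 * (norm d + 1))"
    have n: "norm d + 1 > 0" by (simp add: add_nonneg_pos)
    have \<epsilon>: "\<epsilon> > 0" using e n by (simp add: \<epsilon>_def)
    have "\<epsilon> *\<^sub>R (d, 0) \<in> par ?C"
      by (rule subspace_scale[OF par_properties(1)[OF partly_smooth_pointD(2)[OF xs us]] d(2)])
    then have "(v, Dk (xs, us)) + \<epsilon> *\<^sub>R (d, 0) \<in> affine hull ?C"
      by (rule add_par_in_affine_hull[OF lift[OF vD]])
    then have "fst ((v, Dk (xs, us)) + \<epsilon> *\<^sub>R (d, 0 :: 'u)) \<in> affine hull ?D"
      unfolding D_eq affine_hull_linear_image[OF bounded_linear_fst, symmetric] by (rule imageI)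
    moreover have "v + \<epsilon> *\<^sub>R d \<in> ball v e"
    proof -
      have "\<epsilon> * norm d \<le> \<epsilon> * (norm d + 1)" using \<epsilon> by simp
      also have "\<dots> = e / 2" using n by (simp add: \<epsilon>_def field_simps)
      also have "\<dots> < e" using e by simp
      finally show ?thesis using \<epsilon> by (simp add: dist_norm)
    qed
    ultimately have "v + \<epsilon> *\<^sub>R d \<in> ?D" using e(2) by auto
    from lift[OF this] show ?thesis using \<epsilon> d(1) by (intro exI[of _ \<epsilon>]) simp
  qed
  obtain d where mfd: "C2_manifold_around d (M \<times> \<Omega>) (xs, us)" using partly_smooth_pointD(5)[OF xs us] by blast
  \<comment> \<open>Any subgradient serves as reference: by \<open>crit\<close> and
    \<open>snd_eq\<close> the candidate differs from it by a normal vector.\<close>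
  define cn where "cn n = (SOME c. c \<in> subdiff g (xn n, un n))" for n
  have cn: "cn n \<in> subdiff g (xn n, un n)" for n
    unfolding cn_def using partly_smooth_pointD(2)[OF xn un] by (simp add: some_in_eq)
  have "\<exists>n. (vn n, Dk (xn n, un n)) \<in> subdiff g (xn n, un n)"
  proof (rule partly_smooth_identification[OF mfd partly_smooth_pointD(4)[OF xs us], where c = cn and q = "(v, Dk (xs, us))"])
    show "(xs, us) \<in> M \<times> \<Omega>" "\<And>n. (xn n, un n) \<in> M \<times> \<Omega>" using xs us xn un by auto
    show pn: "(\<lambda>n. (xn n, un n)) \<longlonglongrightarrow> (xs, us)" by (intro tendsto_intros lim)
    show "convex (subdiff g (xn n, un n))" "closed (subdiff g (xn n, un n))" for n
      unfolding subdiff_eq[OF xn un] by (rule convex_regular_subdiff closed_regular_subdiff)+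
    show "normal_space (M \<times> \<Omega>) (xn n, un n) = par (subdiff g (xn n, un n))" for n
      unfolding partly_smooth_pointD(3)[OF xn un] by (rule normal_space_Times[OF xn open_\<Omega> un])
    show "cn n \<in> subdiff g (xn n, un n)" for n by (rule cn)
    show "(vn n, Dk (xn n, un n)) - cn n \<in> normal_space (M \<times> \<Omega>) (xn n, un n)" for n
    proof -
      have "vn n - fst (cn n) \<in> normal_space M (xn n)"
        unfolding normal_space_iff
      proof
        fix t assume t: "t \<in> tangent_space M (xn n)"
        show "(vn n - fst (cn n)) \<bullet> t = 0"
          using tan[OF xn un xun cn t, of 0] crit[OF t] by (simp add: inner_diff_left inner_prod_def)
      qed
      then show ?thesis
        using snd_eq[OF xn un xun cn, of n] unfolding normal_space_Times[OF xn open_\<Omega> un] by (cases "cn n") auto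
    qed
    have "(\<lambda>n. k' (xn n, un n)) \<longlonglongrightarrow> k' (xs, us)"
      using continuous_on_tendsto_compose[OF cont_k' pn Vk(2)] xun by (simp add: always_eventually)
    then show "(\<lambda>n. (vn n, Dk (xn n, un n))) \<longlonglongrightarrow> (v, Dk (xs, us))"
      unfolding Dk_def by (intro tendsto_intros lim)
    show "\<exists>\<epsilon>>0. (v, Dk (xs, us)) + \<epsilon> *\<^sub>R a \<in> ?C" if "a \<in> normal_space (M \<times> \<Omega>) (xs, us)" for a
      by (rule interior[OF that])
  qed
  then show ?thesis using subdiff_imp_partial[OF xn un] by blast
qed

end

section \<open>Spectra of the update maps\<close>

text \<open>In coordinates \<open>s \<in> S\<close> of the tangent space \<open>J(S)\<close>, \<open>B = J \<circ> Z\<close> is the derivative of the proximal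
  gradient step: \<open>\<alpha>K + J\<^sup>TJ\<close>, with \<open>K \<ge> 0\<close> the Hessian of \<open>g\<close> along the manifold, is inverted against
  \<open>I - \<alpha> H\<close>. So \<open>B\<close> is similar to a symmetric operator, and Rayleigh quotients bound its spectrum.\<close>

lemma proximal_gradient_eigenvalue:
  fixes J Z H :: "'a::euclidean_space \<Rightarrow> 'a" and K :: "'a \<Rightarrow> 'a \<Rightarrow> real"
  assumes S: "subspace S" and J: "linear J" and Z: "linear Z" "\<And>h. Z h \<in> S"
    and K: "\<And>t. linear (\<lambda>s. K s t)" "\<And>s t. K s t = K t s" "\<And>s. s \<in> S \<Longrightarrow> K s s \<ge> 0"
    and id: "\<And>h s. s \<in> S \<Longrightarrow> \<alpha> * K (Z h) s + J (Z h) \<bullet> J s = (h - \<alpha> *\<^sub>R H h) \<bullet> J s"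
    and H: "\<And>a b. H a \<bullet> b = a \<bullet> H b" "\<And>s. s \<in> S \<Longrightarrow> J s \<noteq> 0 \<Longrightarrow> J s \<bullet> H (J s) > 0"
      "\<And>h. h \<bullet> H h \<le> L * (norm h)\<^sup>2"
    and \<alpha>: "\<alpha> > 0" "\<alpha> * L < 2"
    and c: "complex_eigenvalue (\<lambda>h. J (Z h)) c" "c \<noteq> 0"
  obtains p a where "c = of_real p" "a \<noteq> 0" "J (Z a) = p *\<^sub>R a" "- 1 < p" "p < 1"
proof -
  define p q where "p = Re c" and "q = Im c"
  obtain a1 a2 where a: "a1 \<noteq> 0 \<or> a2 \<noteq> 0" "J (Z a1) = p *\<^sub>R a1 - q *\<^sub>R a2" "J (Z a2) = q *\<^sub>R a1 + p *\<^sub>R a2"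
    using c(1) unfolding complex_eigenvalue_def p_def q_def by blast
  define r where "r = p\<^sup>2 + q\<^sup>2"
  have r: "r > 0" using c(2) by (simp add: r_def p_def q_def complex_eq_iff sum_power2_gt_zero_iff)
  \<comment> \<open>\<open>s1\<close> and \<open>s2\<close> are the real and imaginary parts of
    \<open>Z\<close> applied to the eigenvector, divided by \<open>c\<close>. As
    \<open>c \<noteq> 0\<close>, this presents the eigenvector as the image under \<open>J\<close>
    of coordinates in \<open>S\<close>.\<close>
  define s1 where "s1 = inverse r *\<^sub>R (p *\<^sub>R Z a1 + q *\<^sub>R Z a2)"
  define s2 where "s2 = inverse r *\<^sub>R (p *\<^sub>R Z a2 - q *\<^sub>R Z a1)"
  have sS: "s1 \<in> S" "s2 \<in> S"
    unfolding s1_def s2_def using Z(2) S by (auto intro!: subspace_add subspace_diff subspace_scale)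
  have Js: "J s1 = a1" "J s2 = a2"
  proof -
    have "J s1 = inverse r *\<^sub>R (r *\<^sub>R a1)"
      by (simp add: s1_def linear_add[OF J] linear_cmul[OF J] a r_def power2_eq_square algebra_simps)
    then show "J s1 = a1" using r by simp
    have "J s2 = inverse r *\<^sub>R (r *\<^sub>R a2)"
      by (simp add: s2_def linear_diff[OF J] linear_cmul[OF J] a r_def power2_eq_square algebra_simps)
    then show "J s2 = a2" using r by simp
  qed
  have Za: "Z a1 = p *\<^sub>R s1 - q *\<^sub>R s2" "Z a2 = q *\<^sub>R s1 + p *\<^sub>R s2"
  proof -
    have "p *\<^sub>R s1 - q *\<^sub>R s2 = inverse r *\<^sub>R (r *\<^sub>R Z a1)"
      by (simp add: s1_def s2_def r_def power2_eq_square algebra_simps)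
    then show "Z a1 = p *\<^sub>R s1 - q *\<^sub>R s2" using r by simp
    have "q *\<^sub>R s1 + p *\<^sub>R s2 = inverse r *\<^sub>R (r *\<^sub>R Z a2)"
      by (simp add: s1_def s2_def r_def power2_eq_square algebra_simps)
    then show "Z a2 = q *\<^sub>R s1 + p *\<^sub>R s2" using r by simp
  qed
  have Kl: "K (x *\<^sub>R s + y *\<^sub>R t) w = x * K s w + y * K t w" for x y s t w
    using linear_add[OF K(1)[of w]] linear_cmul[OF K(1)[of w]] by simp
  have KZ: "K (Z a1) s = p * K s1 s - q * K s2 s" "K (Z a2) s = q * K s1 s + p * K s2 s" for s
    using Kl[of p s1 "- q" s2 s] Kl[of q s1 p s2 s] by (simp_all add: Za)
  \<comment> \<open>The identity is tested crosswise, each part of the eigenvector against the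
    coordinates of the other. Symmetry of \<open>H\<close> and \<open>K\<close> cancels everything
    but \<open>q\<close> times a positive quantity, so the eigenvalue is real.\<close>
  have "\<alpha> * K (Z a1) s2 + J (Z a1) \<bullet> a2 = (a1 - \<alpha> *\<^sub>R H a1) \<bullet> a2"
    and "\<alpha> * K (Z a2) s1 + J (Z a2) \<bullet> a1 = (a2 - \<alpha> *\<^sub>R H a2) \<bullet> a1"
    using id[OF sS(2), of a1] id[OF sS(1), of a2] by (simp_all add: Js)
  moreover have "(a1 - \<alpha> *\<^sub>R H a1) \<bullet> a2 = (a2 - \<alpha> *\<^sub>R H a2) \<bullet> a1"
    using H(1)[of a1 a2] by (simp add: inner_diff_left inner_commute[of a2] inner_commute[of "H a2"])
  ultimately have "\<alpha> * (p * K s1 s2 - q * K s2 s2) + (p * (a1 \<bullet> a2) - q * (a2 \<bullet> a2))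
      = \<alpha> * (q * K s1 s1 + p * K s2 s1) + (q * (a1 \<bullet> a1) + p * (a2 \<bullet> a1))"
    by (simp add: KZ a inner_diff_left inner_add_left)
  then have "q * (\<alpha> * K s1 s1 + \<alpha> * K s2 s2 + a1 \<bullet> a1 + a2 \<bullet> a2) = 0"
    using K(2)[of s1 s2] by (simp add: inner_commute[of a2 a1] algebra_simps)
  moreover have "\<alpha> * K s1 s1 + \<alpha> * K s2 s2 + a1 \<bullet> a1 + a2 \<bullet> a2 > 0"
  proof -
    have "\<alpha> * K s1 s1 \<ge> 0" "\<alpha> * K s2 s2 \<ge> 0" using K(3) sS \<alpha> by simp_all
    moreover have "a1 \<bullet> a1 + a2 \<bullet> a2 > 0"
      using a(1) inner_gt_zero_iff[of a1] inner_gt_zero_iff[of a2] inner_ge_zero[of a1] inner_ge_zero[of a2]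
      by linarith
    ultimately show ?thesis by linarith
  qed
  ultimately have q: "q = 0" by simp
  then have p: "p \<noteq> 0" using r by (auto simp: r_def)
  obtain a' s' where a': "a' \<noteq> 0" "J (Z a') = p *\<^sub>R a'" "s' \<in> S" "J s' = a'" "Z a' = p *\<^sub>R s'"
    using a Za Js sS unfolding q by (cases "a1 = 0") auto
  \<comment> \<open>\<open>p\<close> is the quotient of
    \<open>a' \<bullet> a' - \<alpha> * (a' \<bullet> H a')\<close> by \<open>Q\<close>, and
    \<open>Q \<ge> a' \<bullet> a'\<close>. Positivity of \<open>H\<close> gives
    \<open>p < 1\<close>, and \<open>\<alpha> * L < 2\<close> gives \<open>- 1 < p\<close>.\<close>
  define Q where "Q = \<alpha> * K s' s' + a' \<bullet> a'"
  have Q: "Q \<ge> a' \<bullet> a'" using K(3)[OF a'(3)] \<alpha> by (simp add: Q_def)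
  have aa: "a' \<bullet> a' > 0" using a'(1) by simp
  have "K (Z a') s' = p * K s' s'" using Kl[of p s' 0 0 s'] by (simp add: a')
  then have pQ: "p * Q = a' \<bullet> a' - \<alpha> * (a' \<bullet> H a')"
    using id[OF a'(3), of a'] unfolding a'(4) a'(2)
    by (simp add: Q_def inner_diff_left inner_commute[of "H a'"] algebra_simps)
  have "\<alpha> * (a' \<bullet> H a') > 0" using H(2)[OF a'(3)] a'(1,4) \<alpha>(1) by simp
  then have "p * Q < 1 * Q" using pQ Q by linarith
  then have p1: "p < 1" using Q aa by (subst (asm) mult_less_cancel_right_pos) linarith+
  have "\<alpha> * (a' \<bullet> H a') \<le> \<alpha> * (L * (a' \<bullet> a'))"
    using H(3)[of a'] \<alpha>(1) by (intro mult_left_mono) (auto simp: power2_norm_eq_inner)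
  also have "\<dots> < 2 * (a' \<bullet> a')" using mult_strict_right_mono[OF \<alpha>(2) aa] by (simp add: mult.assoc)
  finally have "(- 1) * Q < p * Q" using pQ Q by linarith
  then have p2: "- 1 < p" using Q aa by (subst (asm) mult_less_cancel_right_pos) linarith+
  have "c = of_real p" using q by (simp add: p_def q_def complex_eq_iff)
  then show ?thesis using that a'(1,2) p1 p2 by blast
qed

section \<open>Eigenvalues of the momentum update\<close>

lemma lambda_min_le:
  fixes A :: "'a::euclidean_space \<Rightarrow> 'a"
  assumes "linear A" and "a \<noteq> 0" and "A a = p *\<^sub>R a"
  shows "lambda_min A \<le> p"
proof -
  have "{c. \<exists>v. v \<noteq> 0 \<and> A v = c *\<^sub>R v} \<subseteq> Re ` {c. complex_eigenvalue A c}"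
  proof clarify
    fix c :: real and v assume "v \<noteq> 0" "A v = c *\<^sub>R v"
    then have "complex_eigenvalue A (of_real c)"
      unfolding complex_eigenvalue_def by (intro exI[of _ v] exI[of _ 0]) (simp add: linear_0[OF assms(1)])
    then show "c \<in> Re ` {c. complex_eigenvalue A c}" by force
  qed
  then have "finite {c. \<exists>v. v \<noteq> 0 \<and> A v = c *\<^sub>R v}"
    using finite_complex_eigenvalues[OF assms(1)] finite_surj by blast
  then show ?thesis unfolding lambda_min_def using assms by (intro Min_le) auto
qed

text \<open>The Schur--Cohn criterion for \<open>\<mu>\<^sup>2 - (1 + \<beta>)\<lambda>\<mu> + \<beta>\<lambda>\<close>.\<close>

lemma momentum_root_bound:
  fixes l \<beta> :: real and m :: complex
  assumes \<beta>: "0 \<le> \<beta>" "\<beta> \<le> 1" and l: "- 1 < l" "l < 1" "- 1 / (1 + 2 * \<beta>) < l"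
    and m: "m\<^sup>2 = of_real l * (of_real (1 + \<beta>) * m - of_real \<beta>)"
  shows "cmod m < 1"
proof -
  define x y where "x = Re m" and "y = Im m"
  have eqs: "x\<^sup>2 - y\<^sup>2 = l * ((1 + \<beta>) * x - \<beta>)" "2 * x * y = l * ((1 + \<beta>) * y)"
    using arg_cong[OF m, of Re] arg_cong[OF m, of Im] by (simp_all add: x_def y_def power2_eq_square)
  have "(cmod m)\<^sup>2 < 1"
  proof (cases "y = 0")
    \<comment> \<open>Nonreal roots are conjugate, so the squared modulus is their product
      \<open>l * \<beta>\<close>.\<close>
    case False
    then have "2 * x = l * (1 + \<beta>)" using eqs(2) by simp
    then have "x * (2 * x) = x * (l * (1 + \<beta>))" by simp
    then have "x\<^sup>2 + y\<^sup>2 = l * \<beta>" using eqs(1) by (simp add: power2_eq_square algebra_simps)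
    also have "\<dots> \<le> \<bar>l\<bar> * 1" using \<beta> by (metis abs_ge_self abs_mult abs_of_nonneg abs_ge_zero mult_left_mono order_trans)
    also have "\<dots> < 1" using l by simp
    finally show ?thesis by (simp add: cmod_power2 x_def y_def)
  next
    case True
    then have f: "x\<^sup>2 - l * (1 + \<beta>) * x + l * \<beta> = 0" using eqs(1) by (simp add: algebra_simps)
    have "\<bar>l * (1 + \<beta>)\<bar> \<le> 1 * 2" unfolding abs_mult using \<beta> l by (intro mult_mono) auto
    then have b: "2 - l * (1 + \<beta>) \<ge> 0" "2 + l * (1 + \<beta>) \<ge> 0" by linarith+
    have "x < 1"
    proof (rule ccontr)
      \<comment> \<open>The quadratic is expanded at 1, where its value is \<open>1 - l\<close> and
        its slope \<open>2 - l * (1 + \<beta>)\<close>.\<close>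
      assume "\<not> x < 1"
      then have "(x - 1) * (2 - l * (1 + \<beta>)) \<ge> 0" using b by simp
      moreover have "(x - 1)\<^sup>2 + (x - 1) * (2 - l * (1 + \<beta>)) + (1 - l) = x\<^sup>2 - l * (1 + \<beta>) * x + l * \<beta>"
        by (simp add: power2_eq_square algebra_simps)
      ultimately show False using f l(2) zero_le_power2[of "x - 1"] by linarith
    qed
    moreover have "- 1 < x"
    proof (rule ccontr)
      \<comment> \<open>Expansion at -1. The value there is
        \<open>1 + l * (1 + 2 * \<beta>)\<close>, whose positivity is the lower bound imposed on the
        smallest eigenvalue.\<close>
      assume "\<not> - 1 < x"
      then have "(- x - 1) * (2 + l * (1 + \<beta>)) \<ge> 0" using b by simp
      moreover have "(- x - 1)\<^sup>2 + (- x - 1) * (2 + l * (1 + \<beta>)) + (1 + l * (1 + 2 * \<beta>)) = x\<^sup>2 - l * (1 + \<beta>) * x + l * \<beta>"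
        by (simp add: power2_eq_square algebra_simps)
      moreover have "1 + l * (1 + 2 * \<beta>) > 0" using l(3) \<beta> pos_divide_less_eq[of "1 + 2 * \<beta>" "- 1" l] by simp
      ultimately show False using f zero_le_power2[of "- x - 1"] by linarith
    qed
    ultimately have "x\<^sup>2 < 1" by (simp add: abs_square_less_1)
    then show ?thesis using True by (simp add: cmod_power2 x_def y_def)
  qed
  then show ?thesis by (simp add: abs_square_less_1)
qed

text \<open>For an eigenvector with components \<open>A\<close> and \<open>D\<close> and
  \<open>m \<noteq> 0\<close>, the first row puts \<open>A\<close> into \<open>T\<close>, and the
  second then gives \<open>A = m D\<close>. Eliminating \<open>D\<close> makes \<open>A\<close> an
  eigenvector of \<open>B\<close> for \<open>m / \<kappa>\<close> with
  \<open>\<kappa> = 1 + \<beta> - \<beta> / m\<close>, which amounts to the quadratic equation of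
  \<open>momentum_root_bound\<close>.\<close>

lemma momentum_eigenvalue_bound:
  fixes B :: "'a::euclidean_space \<Rightarrow> 'a"
  assumes B: "linear B" "\<And>h. B h \<in> T" and T: "subspace T" and \<beta>: "0 \<le> \<beta>" "\<beta> \<le> 1"
    and ev: "\<And>c. complex_eigenvalue B c \<Longrightarrow> c \<noteq> 0 \<Longrightarrow>
      \<exists>l. c = of_real l \<and> - 1 < l \<and> l < 1 \<and> - 1 / (1 + 2 * \<beta>) < l"
    and C: "\<And>a b. C (a, b) = (B ((1 + \<beta>) *\<^sub>R closest_point T a - \<beta> *\<^sub>R closest_point T b), closest_point T a)"
    and m: "complex_eigenvalue C m"
  shows "cmod m < 1"
proof (cases "m = 0")
  case False
  obtain z w where zw: "z \<noteq> 0 \<or> w \<noteq> 0" "C z = Re m *\<^sub>R z - Im m *\<^sub>R w" "C w = Im m *\<^sub>R z + Re m *\<^sub>R w"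
    using m unfolding complex_eigenvalue_def by blast
  define A where "A = (fst z, fst w)"
  define D where "D = (snd z, snd w)"
  define pT where "pT = complexify (closest_point T)"
  have lB: "linear (complexify B)" by (rule linear_complexify[OF B(1)])
  have z: "z = (fst A, fst D)" and w: "w = (snd A, snd D)" by (auto simp: A_def D_def)
  have 1: "complexify B ((1 + \<beta>) *\<^sub>R pT A - \<beta> *\<^sub>R pT D) = cscale m A"
    and 2: "pT A = cscale m D"
  proof -
    have c: "B ((1 + \<beta>) *\<^sub>R closest_point T (fst A) - \<beta> *\<^sub>R closest_point T (fst D)) = Re m *\<^sub>R fst A - Im m *\<^sub>R snd A
        \<and> closest_point T (fst A) = Re m *\<^sub>R fst D - Im m *\<^sub>R snd D"
      using arg_cong[OF zw(2), of fst] arg_cong[OF zw(2), of snd] unfolding z w C by (intro conjI) (simp_all only: fst_conv snd_conv fst_diff snd_diff fst_add snd_add fst_scaleR snd_scaleR)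
    have c': "B ((1 + \<beta>) *\<^sub>R closest_point T (snd A) - \<beta> *\<^sub>R closest_point T (snd D)) = Im m *\<^sub>R fst A + Re m *\<^sub>R snd A
        \<and> closest_point T (snd A) = Im m *\<^sub>R fst D + Re m *\<^sub>R snd D"
      using arg_cong[OF zw(3), of fst] arg_cong[OF zw(3), of snd] unfolding z w C by (intro conjI) (simp_all only: fst_conv snd_conv fst_diff snd_diff fst_add snd_add fst_scaleR snd_scaleR)
    note e = conjunct2[OF c] and e' = conjunct2[OF c']
    have "B ((1 + \<beta>) *\<^sub>R closest_point T (fst A) - \<beta> *\<^sub>R closest_point T (fst D)) = Re m *\<^sub>R fst A - Im m *\<^sub>R snd A"
      and "B ((1 + \<beta>) *\<^sub>R closest_point T (snd A) - \<beta> *\<^sub>R closest_point T (snd D)) = Im m *\<^sub>R fst A + Re m *\<^sub>R snd A"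
      using conjunct1[OF c] conjunct1[OF c'] .
    then show "complexify B ((1 + \<beta>) *\<^sub>R pT A - \<beta> *\<^sub>R pT D) = cscale m A"
      unfolding complexify_def cscale_def pT_def prod_eq_iff fst_diff snd_diff fst_scaleR snd_scaleR fst_conv snd_conv
      by blast
    show "pT A = cscale m D" using e e' by (simp add: complexify_def cscale_def pT_def)
  qed
  have pT_id: "pT (cscale c E) = cscale c E" if "fst E \<in> T" "snd E \<in> T" for c E
    using that T unfolding pT_def complexify_def cscale_def
    by (simp add: closest_point_self subspace_add subspace_diff subspace_scale)
  have A_eq: "A = cscale (1 / m) (complexify B ((1 + \<beta>) *\<^sub>R pT A - \<beta> *\<^sub>R pT D))"
    unfolding 1 using False by simp
  have "pT A = A"
    by (subst (1 2) A_eq, rule pT_id) (simp_all add: complexify_def B(2))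
  then have A: "A = cscale m D" using 2 by simp
  then have D: "D = cscale (1 / m) A" using False by simp
  have AT: "fst A \<in> T" "snd A \<in> T"
    using \<open>pT A = A\<close> closest_point_subspace(1)[OF T] unfolding pT_def complexify_def by (metis fst_conv snd_conv)+
  have "pT D = D" unfolding D by (rule pT_id[OF AT])
  have "A \<noteq> 0"
  proof
    assume "A = 0"
    then have "D = 0" using D by simp
    have "z = 0" "w = 0" using z w \<open>A = 0\<close> \<open>D = 0\<close> by (metis fst_zero snd_zero zero_prod_def)+
    then show False using zw(1) by simp
  qed
  define \<kappa> where "\<kappa> = of_real (1 + \<beta>) - of_real \<beta> / m"
  have \<kappa>_parts: "Re \<kappa> = 1 + \<beta> - \<beta> * Re (1 / m)" "Im \<kappa> = - \<beta> * Im (1 / m)"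
    by (simp_all add: \<kappa>_def Re_divide Im_divide)
  have "(1 + \<beta>) *\<^sub>R pT A - \<beta> *\<^sub>R pT D = cscale \<kappa> A"
    unfolding \<open>pT A = A\<close> \<open>pT D = D\<close> unfolding D by (simp add: cscale_def \<kappa>_parts prod_eq_iff algebra_simps)
  then have k: "cscale \<kappa> (complexify B A) = cscale m A"
    using 1 complexify_cscale[OF B(1)] by metis
  have "\<kappa> \<noteq> 0" using k False \<open>A \<noteq> 0\<close> by auto
  have "cscale (1 / \<kappa>) (cscale \<kappa> (complexify B A)) = cscale (1 / \<kappa>) (cscale m A)" by (simp add: k)
  then have "complexify B A = cscale (m / \<kappa>) A" using \<open>\<kappa> \<noteq> 0\<close> by simp
  then have "complex_eigenvalue B (m / \<kappa>)" using \<open>A \<noteq> 0\<close> complex_eigenvalue_iff by blast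
  then obtain l where l: "m / \<kappa> = of_real l" "- 1 < l" "l < 1" "- 1 / (1 + 2 * \<beta>) < l"
    using ev[of "m / \<kappa>"] False \<open>\<kappa> \<noteq> 0\<close> by auto
  have "m = of_real l * \<kappa>" using l(1) \<open>\<kappa> \<noteq> 0\<close> by (simp add: field_simps)
  then have "m * m = of_real l * (\<kappa> * m)" by (metis mult.assoc)
  also have "\<kappa> * m = of_real (1 + \<beta>) * m - of_real \<beta>" using False by (simp add: \<kappa>_def left_diff_distrib)
  finally show ?thesis
    using momentum_root_bound[OF \<beta> l(2-4), of m] by (simp add: power2_eq_square)
qed simp

section \<open>Convergence of projections and derivatives of the update maps\<close>

lemma LIMSEQ_from_subsequences:
  fixes f :: "nat \<Rightarrow> 'a::metric_space"
  assumes "\<And>r :: nat \<Rightarrow> nat. strict_mono r \<Longrightarrow> \<exists>s. strict_mono s \<and> (\<lambda>n. f (r (s n))) \<longlonglongrightarrow> l"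
  shows "f \<longlonglongrightarrow> l"
proof (rule ccontr)
  assume "\<not> f \<longlonglongrightarrow> l"
  then obtain e where e: "e > 0" "\<And>N. \<exists>n\<ge>N. \<not> dist (f n) l < e"
    unfolding lim_sequentially by blast
  then have "infinite {n. \<not> dist (f n) l < e}"
    unfolding infinite_nat_iff_unbounded_le by blast
  then obtain r :: "nat \<Rightarrow> nat" where r: "strict_mono r" "\<And>n. r n \<in> {n. \<not> dist (f n) l < e}"
    using infinite_enumerate by blast
  obtain s where s: "strict_mono s" "(\<lambda>n. f (r (s n))) \<longlonglongrightarrow> l" using assms[OF r(1)] by blast
  have "\<forall>\<^sub>F n in sequentially. dist (f (r (s n))) l < e" using tendstoD[OF s(2) e(1)] .
  then show False using r(2) by simp
qed

lemma (in C2_chart) tendsto_tproj: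
  assumes xn: "xn \<longlonglongrightarrow> x" "\<And>n. xn n \<in> M" and x: "x \<in> M" "x \<in> V"
    and sub: "\<And>n. subspace (tangent_space M (xn n))" and v: "v \<longlonglongrightarrow> w"
  shows "(\<lambda>n. tproj M (xn n) (v n)) \<longlonglongrightarrow> tproj M x w"
proof (rule LIMSEQ_from_subsequences)
  fix r :: "nat \<Rightarrow> nat" assume r: "strict_mono r"
  have "(\<lambda>n. xn (r n)) \<longlonglongrightarrow> x" "(\<lambda>n. v (r n)) \<longlonglongrightarrow> w"
    using LIMSEQ_subseq_LIMSEQ[OF xn(1) r] LIMSEQ_subseq_LIMSEQ[OF v r] by (simp_all add: o_def)
  from tproj_limit[OF this(1) xn(2) x sub this(2)]
  show "\<exists>s. strict_mono s \<and> (\<lambda>n. tproj M (xn (r (s n))) (v (r (s n)))) \<longlonglongrightarrow> tproj M x w" by simp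
qed

text \<open>The update is \<open>pgd\<close> after the linear extrapolation \<open>e\<close>, paired
  with a copy of the first component. On the diagonal extrapolation returns \<open>x\<close>, so all
  derivatives are read off the one joint derivative \<open>A\<close> of \<open>pgd\<close> at
  \<open>(x, u)\<close>.\<close>

lemma apgd_derivatives:
  fixes f :: "'x::euclidean_space \<times> 'u::euclidean_space \<Rightarrow> real"
  assumes A: "((\<lambda>p. pgd f g \<alpha> (fst p) (snd p)) has_derivative A) (at (x, u))"
  shows "(\<lambda>(z, u). apgd f g \<alpha> \<beta> z u) differentiable (at ((x, x), u))"
    and "Dz_apgd f g \<alpha> \<beta> (x, x) u (a, b) = (A ((1 + \<beta>) *\<^sub>R a - \<beta> *\<^sub>R b, 0), a)"
    and "Du_apgd f g \<alpha> \<beta> (x, x) u du = (A (0, du), 0)"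
    and "Dx_pgd f g \<alpha> x u a = A (a, 0)"
    and "linear (Dz_apgd f g \<alpha> \<beta> (x, x) u)"
proof -
  define e :: "('x \<times> 'x) \<times> 'u \<Rightarrow> 'x \<times> 'u" where "e q = (fst (fst q) + \<beta> *\<^sub>R (fst (fst q) - snd (fst q)), snd q)" for q
  have e: "(e has_derivative e) (at q)" for q
    unfolding e_def by (auto intro!: derivative_eq_intros)
  have A': "((\<lambda>p. pgd f g \<alpha> (fst p) (snd p)) has_derivative A) (at (e ((x, x), u)))"
    using A by (simp add: e_def)
  have "((\<lambda>q. (pgd f g \<alpha> (fst (e q)) (snd (e q)), fst (fst q))) has_derivative (\<lambda>q. (A (e q), fst (fst q)))) (at ((x, x), u))"
    by (intro has_derivative_Pair has_derivative_compose[OF e A'] derivative_intros)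
  then have der: "((\<lambda>(z, u). apgd f g \<alpha> \<beta> z u) has_derivative (\<lambda>q. (A (e q), fst (fst q)))) (at ((x, x), u))"
    by (simp add: e_def apgd_def case_prod_unfold)
  then show "(\<lambda>(z, u). apgd f g \<alpha> \<beta> z u) differentiable (at ((x, x), u))" by (rule differentiableI)
  have z: "((\<lambda>z. (z, u)) has_derivative (\<lambda>z. (z, 0))) (at (x, x))"
    and u: "((\<lambda>u. ((x, x), u)) has_derivative (\<lambda>u. (0, u))) (at u)"
    and x: "((\<lambda>x. (x, u)) has_derivative (\<lambda>h. (h, 0))) (at x)"
    by (intro derivative_intros)+
  have dz: "((\<lambda>z. apgd f g \<alpha> \<beta> z u) has_derivative (\<lambda>z. (A (e (z, 0)), fst z))) (at (x, x))"
    using has_derivative_compose[OF z der] by simp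
  have du: "((\<lambda>u. apgd f g \<alpha> \<beta> (x, x) u) has_derivative (\<lambda>du. (A (e (0, du)), 0))) (at u)"
    using has_derivative_compose[OF u der] by simp
  have dx: "((\<lambda>x. pgd f g \<alpha> x u) has_derivative (\<lambda>h. A (h, 0))) (at x)"
    using has_derivative_compose[OF x A] by simp
  show "Dz_apgd f g \<alpha> \<beta> (x, x) u (a, b) = (A ((1 + \<beta>) *\<^sub>R a - \<beta> *\<^sub>R b, 0), a)"
    unfolding Dz_apgd_def frechet_derivative_at[OF dz, symmetric] by (simp add: e_def algebra_simps)
  show "Du_apgd f g \<alpha> \<beta> (x, x) u du = (A (0, du), 0)"
    unfolding Du_apgd_def frechet_derivative_at[OF du, symmetric] by (simp add: e_def)
  show "Dx_pgd f g \<alpha> x u a = A (a, 0)"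
    unfolding Dx_pgd_def frechet_derivative_at[OF dx, symmetric] ..
  show "linear (Dz_apgd f g \<alpha> \<beta> (x, x) u)"
    unfolding Dz_apgd_def frechet_derivative_at[OF dz, symmetric] using dz by (rule has_derivative_linear)
qed

lemma linear_tproj2:
  assumes "subspace (tangent_space M (x :: 'a::euclidean_space))"
  shows "linear (tproj2 M (x, x))"
proof -
  have l: "linear (tproj M x)" unfolding tproj_def by (rule linear_closest_point_subspace[OF assms])
  show ?thesis
    by (rule linearI) (simp_all add: tproj2_def linear_add[OF l] linear_cmul[OF l])
qed

section \<open>The proximal gradient step in a chart and the spectrum near the base point\<close>

locale pgd_chart = prox_chart M V \<phi> P S \<phi>' P' g \<Omega> k k' Vk \<alpha> xs us v
  for M V :: "'x::euclidean_space set" and \<phi> P S \<phi>' P' and g :: "'x \<times> 'u::euclidean_space \<Rightarrow> ereal"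
    and \<Omega> k k' Vk \<alpha> xs us v +
  fixes f :: "'x \<times> 'u \<Rightarrow> real" and G :: "'x \<times> 'u \<Rightarrow> 'x" and L \<beta> :: real
  assumes M: "C2_submanifold M"
    and C1_G: "C1_map_on UNIV G" and grad_f: "\<And>x u. grad (\<lambda>y. f (y, u)) x = G (x, u)"
    and f_der: "\<And>x. ((\<lambda>y. f (y, us)) has_derivative (\<lambda>h. G (x, us) \<bullet> h)) (at x)"
    and lipschitz: "L-lipschitz_on UNIV (\<lambda>x. G (x, us))"
    and v: "v = - G (xs, us)" and \<alpha>L: "\<alpha> * L < 2"
    and pos_def: "pos_def_on (tangent_space M xs) (\<lambda>h. tproj M xs (hess (\<lambda>y. f (y, us)) xs h))"
    and \<beta>: "0 \<le> \<beta>" "\<beta> \<le> 1"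
    and lambda: "- 1 / (1 + 2 * \<beta>) < lambda_min (Dx_pgd f g \<alpha> xs us)"
begin

lemma subspace_T: "x \<in> M \<Longrightarrow> subspace (tangent_space M x)"
  by (rule subspace_tangent_space_submanifold[OF M])

definition Hf :: "'x \<Rightarrow> 'x" where
  "Hf = frechet_derivative (\<lambda>x. G (x, us)) (at xs)"

lemma Hf: "((\<lambda>x. G (x, us)) has_derivative Hf) (at xs)"
proof -
  obtain G' where "\<And>p. (G has_derivative blinfun_apply (G' p)) (at p)"
    using C1_map_onE[OF C1_G] by (metis UNIV_I)
  moreover have "((\<lambda>x. (x, us)) has_derivative (\<lambda>h. (h, 0))) (at xs)" by (intro derivative_intros)
  ultimately have "((\<lambda>x. G (x, us)) has_derivative (\<lambda>h. G' (xs, us) (h, 0))) (at xs)"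
    using has_derivative_compose by blast
  then show ?thesis unfolding Hf_def using differentiableI frechet_derivative_works by blast
qed

lemma hess_f: "hess (\<lambda>y. f (y, us)) xs = Hf"
  unfolding hess_def Hf_def grad_f ..

text \<open>\<open>Z\<close> is the derivative in \<open>x\<close> of the chart coordinate of the
  step. It maps into \<open>S\<close> because the coordinate stays in \<open>S\<close>, and
  differentiating \<open>E = 0\<close> gives its equation, which is the form that
  \<open>proximal_gradient_eigenvalue\<close> expects.\<close>

lemma pgd_in_chart:
  obtains X0 A Z where "open X0" "(xs, us) \<in> X0"
    "\<And>p. p \<in> X0 \<Longrightarrow> ((\<lambda>p. pgd f g \<alpha> (fst p) (snd p)) has_derivative blinfun_apply (A p)) (at p)"
    "continuous_on X0 A"
    "\<And>p h. p \<in> X0 \<Longrightarrow> A p h \<in> tangent_space M (pgd f g \<alpha> (fst p) (snd p))"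
    "pgd f g \<alpha> xs us = xs"
    "linear Z" "\<And>h. Z h \<in> S" "\<And>h. A (xs, us) (h, 0) = P' y0 (Z h)"
    "\<And>h s. s \<in> S \<Longrightarrow> \<alpha> * h'' (Z h) s + P' y0 (Z h) \<bullet> P' y0 s = (h - \<alpha> *\<^sub>R Hf h) \<bullet> P' y0 s"
proof -
  obtain W Y where W: "open W" "(w0, us) \<in> W" "C1_map_on W Y" "Y (w0, us) = y0"
    "\<And>w u. (w, u) \<in> W \<Longrightarrow> Y (w, u) \<in> \<phi> ` V \<and> Y (w, u) \<in> S \<and> u \<in> \<Omega> \<and> prox g \<alpha> w u = P (Y (w, u))"
    "\<And>w s. (w, us) \<in> W \<Longrightarrow> s \<in> S \<Longrightarrow> E (Y (w, us)) w us s = 0"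
    by (rule prox_in_chart) (rule that)
  define N where "N p = (fst p - \<alpha> *\<^sub>R G p, snd p)" for p
  have C1_N: "C1_map_on UNIV N"
    unfolding N_def
    by (intro C1_map_on_Pair C1_map_on_diff C1_map_on_bilinear[OF bounded_bilinear_scaleR C1_map_on_const C1_G]
        C1_map_on_bounded_linear bounded_linear_fst bounded_linear_snd)
  define X0 where "X0 = N -` W"
  have oX: "open X0"
    unfolding X0_def
    using continuous_on_open_vimage[OF open_UNIV, of N] C1_map_on_imp_continuous_on[OF C1_N] W(1) by simp
  have N0: "N (xs, us) = (w0, us)" by (simp add: N_def v)
  have base: "(xs, us) \<in> X0" using W(2) N0 by (simp add: X0_def)
  have C1_YN: "C1_map_on X0 (\<lambda>p. Y (N p))"
    by (rule C1_map_on_compose[OF C1_map_on_subset[OF C1_N subset_UNIV] W(3)]) (auto simp: X0_def)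
  have YN: "Y (N p) \<in> \<phi> ` V" "Y (N p) \<in> S" "pgd f g \<alpha> (fst p) (snd p) = P (Y (N p))" if "p \<in> X0" for p
    using W(5)[of "fst (N p)" "snd (N p)"] that by (auto simp: X0_def N_def pgd_def grad_f)
  have "C1_map_on X0 (\<lambda>p. P (Y (N p)))"
    by (rule C1_map_on_compose[OF C1_YN C1_P]) (use YN(1) in auto)
  then have "C1_map_on X0 (\<lambda>p. pgd f g \<alpha> (fst p) (snd p))"
    by (rule C1_map_on_cong[OF _ oX]) (simp add: YN(3))
  then obtain A where A: "\<And>p. p \<in> X0 \<Longrightarrow> ((\<lambda>p. pgd f g \<alpha> (fst p) (snd p)) has_derivative blinfun_apply (A p)) (at p)"
    "continuous_on X0 A" by (rule C1_map_onE) (rule that)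
  obtain Y' where Y': "\<And>p. p \<in> X0 \<Longrightarrow> ((\<lambda>p. Y (N p)) has_derivative blinfun_apply (Y' p)) (at p)"
    using C1_YN by (rule C1_map_onE) (rule that)
  have Y'S: "Y' p h \<in> S" if "p \<in> X0" for p h
    by (rule has_derivative_in_subspace[OF Y'[OF that] oX that YN(2) S])
  have A_eq: "A p h = P' (Y (N p)) (Y' p h)" if "p \<in> X0" for p h
  proof -
    have "((\<lambda>p. P (Y (N p))) has_derivative (\<lambda>h. P' (Y (N p)) (Y' p h))) (at p)"
      by (rule has_derivative_compose[OF Y'[OF that] P'[OF YN(1)[OF that]]])
    then have "((\<lambda>p. pgd f g \<alpha> (fst p) (snd p)) has_derivative (\<lambda>h. P' (Y (N p)) (Y' p h))) (at p)"
      by (rule has_derivative_transform_within_open[OF _ oX that]) (simp add: YN(3))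
    then show ?thesis using has_derivative_unique[OF A(1)[OF that]] by metis
  qed
  have AT: "A p h \<in> tangent_space M (pgd f g \<alpha> (fst p) (snd p))" if "p \<in> X0" for p h
    unfolding YN(3)[OF that] tangent_space_eq[OF YN(1)[OF that] YN(2)[OF that]] A_eq[OF that]
    using Y'S[OF that] by (rule imageI)
  have YN0: "Y (N (xs, us)) = y0" by (simp add: N0 W(4))
  define Z where "Z h = Y' (xs, us) (h, 0)" for h
  have pair: "((\<lambda>x. (x, us)) has_derivative (\<lambda>h. (h, 0))) (at xs)" by (intro derivative_intros)
  have Zd: "((\<lambda>x. Y (N (x, us))) has_derivative Z) (at xs)"
    using has_derivative_compose[OF pair Y'[OF base]] by (simp add: Z_def[abs_def])
  have key: "\<alpha> * h'' (Z h) s + P' y0 (Z h) \<bullet> P' y0 s = (h - \<alpha> *\<^sub>R Hf h) \<bullet> P' y0 s" if s: "s \<in> S" for h s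
  proof -
    define y where "y x = Y (N (x, us))" for x
    have y0_eq: "y xs = y0" by (simp add: y_def YN0)
    have y: "(y has_derivative Z) (at xs)" unfolding y_def by (rule Zd)
    obtain P'' where P'': "\<And>y. y \<in> \<phi> ` V \<Longrightarrow> (P' has_derivative blinfun_apply (P'' y)) (at y)"
      using C1_P' by (rule C1_map_onE) (rule that)
    have "(h' has_derivative h'') (at (y xs))" using h'' by (simp add: y0_eq)
    from blinfun.FDERIV[OF has_derivative_compose[OF y this] has_derivative_const[of s]]
    have 1: "((\<lambda>x. h' (y x) s) has_derivative (\<lambda>t. h'' (Z t) s)) (at xs)" by (simp add: blinfun.zero_right)
    have "(P' has_derivative P'' y0) (at (y xs))" using P''[OF y0(1)] by (simp add: y0_eq)
    from blinfun.FDERIV[OF has_derivative_compose[OF y this] has_derivative_const[of s]]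
    have 2: "((\<lambda>x. P' (y x) s) has_derivative (\<lambda>t. P'' y0 (Z t) s)) (at xs)" by (simp add: blinfun.zero_right)
    have "(P has_derivative P' y0) (at (y xs))" using P'[OF y0(1)] by (simp add: y0_eq)
    from has_derivative_compose[OF y this]
    have "((\<lambda>x. P (y x)) has_derivative (\<lambda>t. P' y0 (Z t))) (at xs)" .
    then have 3: "((\<lambda>x. P (y x) - (x - \<alpha> *\<^sub>R G (x, us)) + \<alpha> *\<^sub>R v) has_derivative
        (\<lambda>t. P' y0 (Z t) - (t - \<alpha> *\<^sub>R Hf t))) (at xs)"
      by (auto intro!: derivative_eq_intros Hf)
    \<comment> \<open>The first factor of the inner product is 0 at \<open>xs\<close> since
      \<open>v = - G (xs, us)\<close>, so the derivative of \<open>P'\<close> drops out.\<close>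
    have "((\<lambda>x. \<alpha> * h' (y x) s + (P (y x) - (x - \<alpha> *\<^sub>R G (x, us)) + \<alpha> *\<^sub>R v) \<bullet> P' (y x) s) has_derivative
        (\<lambda>t. \<alpha> * h'' (Z t) s + (P' y0 (Z t) - (t - \<alpha> *\<^sub>R Hf t)) \<bullet> P' y0 s)) (at xs)"
      using has_derivative_add[OF has_derivative_mult_right[OF 1, of \<alpha>] bounded_bilinear.FDERIV[OF bounded_bilinear_inner 3 2]]
      by (simp add: y0_eq y0 v)
    moreover have "((\<lambda>x. \<alpha> * h' (y x) s + (P (y x) - (x - \<alpha> *\<^sub>R G (x, us)) + \<alpha> *\<^sub>R v) \<bullet> P' (y x) s) has_derivative (\<lambda>_. 0)) (at xs)"
    proof (rule has_derivative_transform_within_open[OF has_derivative_const])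
      show "open ((\<lambda>x. (x, us)) -` X0)" by (intro open_vimage oX continuous_intros)
      show "xs \<in> (\<lambda>x. (x, us)) -` X0" using base by simp
      fix x assume "x \<in> (\<lambda>x. (x, us)) -` X0"
      then have "(x - \<alpha> *\<^sub>R G (x, us), us) \<in> W" by (simp add: X0_def N_def)
      from W(6)[OF this s] show "0 = \<alpha> * h' (y x) s + (P (y x) - (x - \<alpha> *\<^sub>R G (x, us)) + \<alpha> *\<^sub>R v) \<bullet> P' (y x) s"
        by (simp add: E_us y_def N_def)
    qed
    ultimately have "(\<lambda>t. \<alpha> * h'' (Z t) s + (P' y0 (Z t) - (t - \<alpha> *\<^sub>R Hf t)) \<bullet> P' y0 s) = (\<lambda>_. 0)"
      using has_derivative_unique by blast
    from fun_cong[OF this, of h] show ?thesis by (simp add: inner_diff_left)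
  qed
  show ?thesis
  proof (rule that[OF oX base A(1,2) AT _ has_derivative_linear[OF Zd] _ _ key])
    show "pgd f g \<alpha> xs us = xs" using YN(3)[OF base] by (simp add: YN0 y0)
    show "Z h \<in> S" for h unfolding Z_def by (rule Y'S[OF base])
    show "A (xs, us) (h, 0) = P' y0 (Z h)" for h using A_eq[OF base] by (simp add: YN0 Z_def)
  qed
qed

lemma base_eigenvalue_bound:
  assumes A: "((\<lambda>p. pgd f g \<alpha> (fst p) (snd p)) has_derivative A) (at (xs, us))"
    and Z: "linear Z" "\<And>h. Z h \<in> S" "\<And>h. A (h, 0) = P' y0 (Z h)"
    and key: "\<And>h s. s \<in> S \<Longrightarrow> \<alpha> * h'' (Z h) s + P' y0 (Z h) \<bullet> P' y0 s = (h - \<alpha> *\<^sub>R Hf h) \<bullet> P' y0 s"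
    and m: "complex_eigenvalue (Dz_apgd f g \<alpha> \<beta> (xs, xs) us \<circ> tproj2 M (xs, xs)) m"
  shows "cmod m < 1"
proof -
  let ?J = "blinfun_apply (P' y0)"
  let ?B = "\<lambda>h. ?J (Z h)"
  have J: "linear ?J" by (rule bounded_linear.linear[OF blinfun.bounded_linear_right])
  have T: "tangent_space M xs = ?J ` S" using tangent_space_eq[OF y0(1,2)] by (simp add: y0)
  have subT: "subspace (tangent_space M xs)" by (rule subspace_T[OF xs(1)])
  have B: "linear ?B" using linear_compose[OF Z(1) J] by (simp add: o_def)
  have Hsym: "Hf a \<bullet> b = a \<bullet> Hf b" for a b by (rule gradient_derivative_symmetric[OF f_der Hf])
  \<comment> \<open>Against a tangent vector the projection in the condition on the Hessian of
    \<open>f\<close> has no effect.\<close>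
  have Hpos: "?J s \<bullet> Hf (?J s) > 0" if "s \<in> S" "?J s \<noteq> 0" for s
  proof -
    have JT: "?J s \<in> tangent_space M xs" using that(1) unfolding T by (rule imageI)
    then have "?J s \<bullet> tproj M xs (Hf (?J s)) > 0"
      using pos_def that(2) unfolding pos_def_on_def hess_f by blast
    then show ?thesis
      using inner_closest_point_subspace[OF subT JT, of "Hf (?J s)"] by (simp add: tproj_def inner_commute)
  qed
  have HL: "h \<bullet> Hf h \<le> L * (norm h)\<^sup>2" for h
  proof -
    have "h \<bullet> Hf h \<le> norm h * norm (Hf h)" by (rule norm_cauchy_schwarz)
    also have "\<dots> \<le> norm h * (L * norm h)"
      by (rule mult_left_mono[OF lipschitz_derivative_bound[OF lipschitz Hf] norm_ge_zero])
    finally show ?thesis by (simp add: power2_eq_square mult_ac)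
  qed
  have Klin: "linear (\<lambda>s. h'' s t)" for t
    by (rule linearI) (simp_all add: linear_add[OF has_derivative_linear[OF h'']]
        linear_cmul[OF has_derivative_linear[OF h'']] blinfun.add_left blinfun.scaleR_left)
  have ev: "\<exists>l. c = of_real l \<and> - 1 < l \<and> l < 1 \<and> - 1 / (1 + 2 * \<beta>) < l"
    if c: "complex_eigenvalue ?B c" "c \<noteq> 0" for c
  proof -
    obtain p a where pa: "c = of_real p" "a \<noteq> 0" "?J (Z a) = p *\<^sub>R a" "- 1 < p" "p < 1"
      by (rule proximal_gradient_eigenvalue[OF S J Z(1,2) Klin h''_symmetric h''_nonneg key Hsym Hpos HL \<alpha> \<alpha>L c])
        (simp_all add: that)
    \<comment> \<open>Here the real eigenvector \<open>a\<close> is needed, because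
      \<open>lambda_min\<close> ranges over real eigenpairs.\<close>
    have "lambda_min ?B \<le> p" by (rule lambda_min_le[where A = ?B, OF B pa(2,3)])
    moreover have "Dx_pgd f g \<alpha> xs us = ?B" using apgd_derivatives(4)[OF A] Z(3) by (intro ext) simp
    ultimately show ?thesis using pa lambda by auto
  qed
  show ?thesis
  proof (rule momentum_eigenvalue_bound[OF B _ subT \<beta> ev _ m])
    show "?B h \<in> tangent_space M xs" for h unfolding T using Z(2) by (rule imageI)
    show "(Dz_apgd f g \<alpha> \<beta> (xs, xs) us \<circ> tproj2 M (xs, xs)) (a, b)
        = (?B ((1 + \<beta>) *\<^sub>R closest_point (tangent_space M xs) a - \<beta> *\<^sub>R closest_point (tangent_space M xs) b),
           closest_point (tangent_space M xs) a)" for a b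
      by (simp add: tproj2_def tproj_def apgd_derivatives(2)[OF A] Z(3))
  qed
qed

theorem local_eigenvalue_bound:
  obtains W A where "open W" "(xs, us) \<in> W"
    "\<And>p. p \<in> W \<Longrightarrow> ((\<lambda>p. pgd f g \<alpha> (fst p) (snd p)) has_derivative A p) (at p)"
    "\<And>p h. p \<in> W \<Longrightarrow> A p h \<in> tangent_space M (pgd f g \<alpha> (fst p) (snd p))"
    "\<And>x u m. (x, u) \<in> W \<Longrightarrow> x \<in> M \<Longrightarrow>
      complex_eigenvalue (Dz_apgd f g \<alpha> \<beta> (x, x) u \<circ> tproj2 M (x, x)) m \<Longrightarrow> cmod m < 1"
proof -
  obtain X0 A Z where X0: "open X0" "(xs, us) \<in> X0"
    "\<And>p. p \<in> X0 \<Longrightarrow> ((\<lambda>p. pgd f g \<alpha> (fst p) (snd p)) has_derivative blinfun_apply (A p)) (at p)"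
    "continuous_on X0 A"
    "\<And>p h. p \<in> X0 \<Longrightarrow> A p h \<in> tangent_space M (pgd f g \<alpha> (fst p) (snd p))"
    "pgd f g \<alpha> xs us = xs"
    and Z: "linear Z" "\<And>h. Z h \<in> S" "\<And>h. A (xs, us) (h, 0) = P' y0 (Z h)"
    "\<And>h s. s \<in> S \<Longrightarrow> \<alpha> * h'' (Z h) s + P' y0 (Z h) \<bullet> P' y0 s = (h - \<alpha> *\<^sub>R Hf h) \<bullet> P' y0 s"
    by (rule pgd_in_chart) (rule that)
  define T where "T p = Dz_apgd f g \<alpha> \<beta> (fst p, fst p) (snd p) \<circ> tproj2 M (fst p, fst p)" for p
  \<comment> \<open>Conditioned on membership in \<open>M\<close>: through other points there is no
    curve in \<open>M\<close>, and the tangent space is empty.\<close>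
  define R where "R p \<longleftrightarrow> fst p \<in> M \<longrightarrow> (\<forall>m. complex_eigenvalue (T p) m \<longrightarrow> cmod m < 1)" for p
  have T_eq: "T p z = (A p ((1 + \<beta>) *\<^sub>R tproj M (fst p) (fst z) - \<beta> *\<^sub>R tproj M (fst p) (snd z), 0), tproj M (fst p) (fst z))"
    if "p \<in> X0" for p z
    using apgd_derivatives(2)[of f g \<alpha> "A p" "fst p" "snd p"] X0(3)[OF that] by (simp add: T_def tproj2_def)
  have lT: "linear (T p)" if "p \<in> X0" "fst p \<in> M" for p
    unfolding T_def
    using apgd_derivatives(5)[of f g \<alpha> "A p" "fst p" "snd p"] X0(3)[OF that(1)]
    by (intro linear_compose linear_tproj2 subspace_T that(2)) simp
  have "\<forall>\<^sub>F p in nhds (xs, us). R p"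
  proof (rule ccontr)
    assume no: "\<not> (\<forall>\<^sub>F p in nhds (xs, us). R p)"
    have evX: "\<forall>\<^sub>F p in nhds (xs, us). p \<in> X0" using X0(1,2) by (rule eventually_nhds_in_open)
    have "\<not> (\<forall>\<^sub>F p in nhds (xs, us). p \<in> X0 \<longrightarrow> R p)"
    proof
      assume "\<forall>\<^sub>F p in nhds (xs, us). p \<in> X0 \<longrightarrow> R p"
      from eventually_mp[OF this evX] show False using no by simp
    qed
    then obtain s where s: "s \<longlonglongrightarrow> (xs, us)" "\<And>n::nat. \<not> (s n \<in> X0 \<longrightarrow> R (s n))"
      by (rule not_eventually_nhds_sequence) (rule that)
    then have sX: "\<And>n. s n \<in> X0" and sM: "\<And>n. fst (s n) \<in> M"
      and "\<exists>m. complex_eigenvalue (T (s n)) m \<and> cmod m \<ge> 1" for n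
      by (auto simp: R_def not_less)
    then obtain m where m: "\<And>n. complex_eigenvalue (T (s n)) (m n)" "\<And>n. cmod (m n) \<ge> 1" by metis
    \<comment> \<open>Divided by the eigenvalue, the equation contains only its reciprocal, which
      lies in the closed unit disc. Compactness then applies without an upper bound on the
      eigenvalues.\<close>
    have "\<exists>z. norm z = 1 \<and> z = cscale (1 / m n) (complexify (T (s n)) z)" for n
    proof -
      obtain z where z: "z \<noteq> 0" "complexify (T (s n)) z = cscale (m n) z"
        using m(1)[of n] complex_eigenvalue_iff by blast
      have "m n \<noteq> 0" using m(2)[of n] by auto
      have "complexify (T (s n)) (inverse (norm z) *\<^sub>R z) = cscale (m n) (inverse (norm z) *\<^sub>R z)"
        by (simp add: linear_cmul[OF linear_complexify[OF lT[OF sX sM]]] linear_cmul[OF linear_cscale] z(2))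
      then have "inverse (norm z) *\<^sub>R z = cscale (1 / m n) (complexify (T (s n)) (inverse (norm z) *\<^sub>R z))"
        using \<open>m n \<noteq> 0\<close> by simp
      moreover have "norm (inverse (norm z) *\<^sub>R z) = 1" using z(1) by simp
      ultimately show ?thesis by blast
    qed
    then obtain z where z: "\<And>n. norm (z n) = 1" "\<And>n. z n = cscale (1 / m n) (complexify (T (s n)) (z n))" by metis
    have "cmod (1 / m n) \<le> 1" for n using m(2)[of n] by (simp add: norm_divide divide_le_eq)
    then have "(z n, 1 / m n) \<in> sphere 0 1 \<times> cball 0 1" for n using z(1) by simp
    moreover have "compact (sphere (0 :: ('x \<times> 'x) \<times> ('x \<times> 'x)) 1 \<times> cball (0 :: complex) 1)"
      by (intro compact_Times compact_sphere compact_cball)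
    ultimately obtain l r where r: "strict_mono (r :: nat \<Rightarrow> nat)" "((\<lambda>n. (z n, 1 / m n)) \<circ> r) \<longlonglongrightarrow> l"
        "l \<in> sphere 0 1 \<times> cball 0 1"
      unfolding compact_def by (metis (no_types, lifting))
    obtain \<zeta> \<nu> where l: "l = (\<zeta>, \<nu>)" by (cases l)
    have z_lim: "(\<lambda>n. z (r n)) \<longlonglongrightarrow> \<zeta>" and \<nu>_lim: "(\<lambda>n. 1 / m (r n)) \<longlonglongrightarrow> \<nu>"
      using tendsto_fst[OF r(2)] tendsto_snd[OF r(2)] by (simp_all add: l o_def)
    have s_lim: "(\<lambda>n. s (r n)) \<longlonglongrightarrow> (xs, us)" using LIMSEQ_subseq_LIMSEQ[OF s(1) r(1)] by (simp add: o_def)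
    have x_lim: "(\<lambda>n. fst (s (r n))) \<longlonglongrightarrow> xs" using tendsto_fst[OF s_lim] by simp
    have A_lim: "(\<lambda>n. A (s (r n))) \<longlonglongrightarrow> A (xs, us)"
      using continuous_on_tendsto_compose[OF X0(4) s_lim X0(2)] sX by (simp add: always_eventually)
    have T_lim: "(\<lambda>n. T (s (r n)) (y n)) \<longlonglongrightarrow> T (xs, us) y'" if "y \<longlonglongrightarrow> y'" for y y'
    proof -
      have p: "(\<lambda>n. tproj M (fst (s (r n))) (c n)) \<longlonglongrightarrow> tproj M xs c'" if "c \<longlonglongrightarrow> c'" for c c'
        by (rule tendsto_tproj[OF x_lim sM xs subspace_T[OF sM] that])
      show ?thesis
        unfolding T_eq[OF sX] T_eq[OF X0(2)] fst_conv
        by (intro tendsto_intros A_lim p that)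
    qed
    have "(\<lambda>n. complexify (T (s (r n))) (z (r n))) \<longlonglongrightarrow> complexify (T (xs, us)) \<zeta>"
      unfolding complexify_def by (intro tendsto_intros T_lim z_lim)
    then have "(\<lambda>n. cscale (1 / m (r n)) (complexify (T (s (r n))) (z (r n)))) \<longlonglongrightarrow> cscale \<nu> (complexify (T (xs, us)) \<zeta>)"
      unfolding cscale_def by (intro tendsto_intros \<nu>_lim)
    then have eq: "\<zeta> = cscale \<nu> (complexify (T (xs, us)) \<zeta>)"
      using z_lim LIMSEQ_unique unfolding z(2)[symmetric] by blast
    have \<zeta>: "\<zeta> \<noteq> 0" using r(3) by (auto simp: l)
    \<comment> \<open>A zero reciprocal would make the unit vector \<zeta> vanish; the eigenvalues
      thus cannot escape to infinity.\<close>
    then have "\<nu> \<noteq> 0" using eq by auto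
    have "complexify (T (xs, us)) \<zeta> = cscale (1 / \<nu>) (cscale \<nu> (complexify (T (xs, us)) \<zeta>))"
      using \<open>\<nu> \<noteq> 0\<close> by simp
    then have "complexify (T (xs, us)) \<zeta> = cscale (1 / \<nu>) \<zeta>" using eq by simp
    then have "complex_eigenvalue (T (xs, us)) (1 / \<nu>)" using \<zeta> complex_eigenvalue_iff by blast
    then have ev: "complex_eigenvalue (Dz_apgd f g \<alpha> \<beta> (xs, xs) us \<circ> tproj2 M (xs, xs)) (1 / \<nu>)"
      by (simp add: T_def)
    have "cmod (1 / \<nu>) < 1"
      by (rule base_eigenvalue_bound[OF X0(3)[OF X0(2)] Z(1-3) _ ev]) (rule Z(4))
    moreover have "cmod \<nu> \<le> 1" using r(3) by (simp add: l)
    ultimately show False using \<open>\<nu> \<noteq> 0\<close> by (simp add: norm_divide divide_less_eq)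
  qed
  then obtain W where W: "open W" "(xs, us) \<in> W" "\<And>p. p \<in> W \<Longrightarrow> R p"
    unfolding eventually_nhds by blast
  show ?thesis
  proof (rule that[of "W \<inter> X0" A])
    show "open (W \<inter> X0)" "(xs, us) \<in> W \<inter> X0" using W X0 by auto
    fix p assume "p \<in> W \<inter> X0"
    then show "((\<lambda>p. pgd f g \<alpha> (fst p) (snd p)) has_derivative A p) (at p)"
      "A p h \<in> tangent_space M (pgd f g \<alpha> (fst p) (snd p))" for h
      using X0 by auto
  next
    fix x u m assume "(x, u) \<in> W \<inter> X0" "x \<in> M"
      "complex_eigenvalue (Dz_apgd f g \<alpha> \<beta> (x, x) u \<circ> tproj2 M (x, x)) m"
    then show "cmod m < 1" using W(3)[of "(x, u)"] by (simp add: R_def T_def)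
  qed
qed

end

text \<open>Off the solution curve the ambient derivative maps into the tangent space at the image
  of the step, which may differ from the one at \<open>x\<close>; the recursion is therefore stated
  with \<open>Dz_tangent\<close>. At \<open>x = \<psi> u\<close> the step fixes \<open>x\<close>,
  and the recursion with the ambient derivative is covered as well.\<close>

theorem mainTheorem5:
  fixes f :: "'x::euclidean_space \<times> 'u::euclidean_space \<Rightarrow> real"
    and g :: "'x \<times> 'u \<Rightarrow> ereal"
    and M :: "'x set" and \<Omega> U :: "'u set"
    and xs :: 'x and us :: 'u and \<psi> :: "'u \<Rightarrow> 'x"
    and L \<alpha>l \<alpha>u \<alpha> \<beta> :: real
  assumes "C2_submanifold M" and "open \<Omega>"
    and "CPSO f g M \<Omega> L"
    and "xs \<in> M" and "us \<in> \<Omega>"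
    and "RPD_i f g M xs us" and "RPD_ii f M xs us" and "ND f g xs us"
    and "0 < \<alpha>l" and "\<alpha>l \<le> \<alpha>u" and "\<alpha>u < 2 / L"
    and "\<alpha> \<in> {\<alpha>l..\<alpha>u}" and "\<beta> \<in> {0..1}"
    and "- 1 / (1 + 2 * \<beta>) < lambda_min (Dx_pgd f g \<alpha> xs us)"
    and "local_solution_map f g M \<Omega> xs us U \<psi>"
  shows "\<exists>V. open V \<and> us \<in> V \<and> V \<subseteq> U \<and>
    (\<forall>u\<in>V. \<exists>\<epsilon>>0. \<forall>x\<in>M. dist x (\<psi> u) < \<epsilon> \<longrightarrow>
       (\<lambda>(z, u). apgd f g \<alpha> \<beta> z u) differentiable (at ((x, x), u)) \<and>
       bij (\<lambda>v. v - Dz_apgd f g \<alpha> \<beta> (x, x) u (tproj2 M (x, x) v)) \<and>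
       (\<forall>du zhat.
          (\<forall>k. zhat (Suc k) =
                 Dz_tangent f g M \<alpha> \<beta> (x, x) u (zhat k) + Du_apgd f g \<alpha> \<beta> (x, x) u du) \<longrightarrow>
          converges_linearly zhat (phi f g M \<alpha> \<beta> (x, x) u du)
            (spec_radius (Dz_apgd f g \<alpha> \<beta> (x, x) u \<circ> tproj2 M (x, x)))) \<and>
       (x = \<psi> u \<longrightarrow>
         (\<forall>du zhat.
            (\<forall>k. zhat (Suc k) =
                   Dz_apgd f g \<alpha> \<beta> (x, x) u (zhat k) + Du_apgd f g \<alpha> \<beta> (x, x) u du) \<longrightarrow>
            converges_linearly zhat (phi f g M \<alpha> \<beta> (x, x) u du)
              (spec_radius (Dz_apgd f g \<alpha> \<beta> (x, x) u \<circ> tproj2 M (x, x))))))"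
proof -
  have alpha: "\<alpha> > 0" "\<alpha> * L < 2"
  proof -
    show "\<alpha> > 0" using assms by auto
    \<comment> \<open>\<open>2 / L\<close> exceeds a positive number, which forces
      \<open>L > 0\<close>; for \<open>L = 0\<close> the quotient would be 0.\<close>
    have "\<alpha> < 2 / L" using assms by auto
    moreover from this have "L > 0" using \<open>\<alpha> > 0\<close> by (metis less_trans zero_less_divide_iff zero_less_numeral not_numeral_less_zero)
    ultimately show "\<alpha> * L < 2" by (simp add: pos_less_divide_eq)
  qed
  have C2_f: "C2_map_on UNIV f" and ps: "partly_smooth g (M \<times> \<Omega>)"
    and conv_f: "\<And>u. u \<in> \<Omega> \<Longrightarrow> convex_on UNIV (\<lambda>x. f (x, u))"
    and conv_g: "\<And>u. u \<in> \<Omega> \<Longrightarrow> convex_fun (\<lambda>x. g (x, u))"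
    and lip: "L-lipschitz_on UNIV (grad (\<lambda>x. f (x, us)))"
    using assms(3,5) unfolding CPSO_def by auto
  interpret problem: partly_smooth_problem M \<Omega> g
    by unfold_locales (rule assms(1) assms(2) ps conv_g, assumption?)+
  obtain G where G: "C1_map_on UNIV G"
    "\<And>x u. ((\<lambda>y. f (y, u)) has_derivative (\<lambda>h. G (x, u) \<bullet> h)) (at x)"
    "\<And>x u. grad (\<lambda>y. f (y, u)) x = G (x, u)"
    using C2_f by (rule C2_partial_gradient) (rule that)
  obtain k Vk where k: "open Vk" "(xs, us) \<in> Vk" "C2_map_on Vk k"
    "\<And>x u. x \<in> M \<Longrightarrow> u \<in> \<Omega> \<Longrightarrow> (x, u) \<in> Vk \<Longrightarrow> g (x, u) = ereal (k (x, u))"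
    using problem.partly_smooth_pointD(6)[OF assms(4,5)] unfolding C2_extension_def by auto
  obtain k' where k': "\<And>p. p \<in> Vk \<Longrightarrow> (k has_derivative blinfun_apply (k' p)) (at p)" "C1_map_on Vk k'"
    using k(3) by (rule C2_map_onE) (rule that)
  define v where "v = - G (xs, us)"
  have v: "v \<in> rel_interior (convex_subdiff (\<lambda>x. g (x, us)) xs)"
  proof -
    \<comment> \<open>By the sum rule, nondegeneracy places \<open>- G (xs, us)\<close> in the
      relative interior of the partial subdifferential of \<open>g\<close>.\<close>
    have "0 \<in> rel_interior ((\<lambda>v. G (xs, us) + v) ` convex_subdiff (\<lambda>x. g (x, us)) xs)"
      using assms(8) unfolding ND_def convex_subdiff_objective[where f = f and g = g, OF conv_f[OF assms(5)] conv_g[OF assms(5)] G(2)] .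
    then obtain y where y: "y \<in> rel_interior (convex_subdiff (\<lambda>x. g (x, us)) xs)" "0 = G (xs, us) + y"
      unfolding rel_interior_translation by blast
    have "y = v" unfolding v_def using y(2) by (simp add: eq_neg_iff_add_eq_0 add.commute)
    then show ?thesis using y(1) by simp
  qed
  obtain d where "C2_manifold_around d M xs" using assms(1,4) unfolding C2_submanifold_def by blast
  then obtain Vc \<phi> P S \<phi>' P' where chart: "C2_chart M Vc \<phi> P S \<phi>' P'" "xs \<in> Vc"
    by (rule C2_manifold_around_chart) (rule that)
  interpret chart: C2_chart M Vc \<phi> P S \<phi>' P' by (rule chart(1))
  interpret pgd: pgd_chart M Vc \<phi> P S \<phi>' P' g \<Omega> k k' Vk \<alpha> xs us v f G L \<beta>
  proof unfold_locales
    show "v \<in> convex_subdiff (\<lambda>x. g (x, us)) xs" using v rel_interior_subset by blast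
    show "L-lipschitz_on UNIV (\<lambda>x. G (x, us))" using lip by (simp add: G(3)[abs_def])
    show "pos_def_on (tangent_space M xs) (\<lambda>h. tproj M xs (hess (\<lambda>y. f (y, us)) xs h))"
      using assms(7) unfolding RPD_ii_def .
    show "\<exists>n. vn n \<in> convex_subdiff (\<lambda>x. g (x, un n)) (xn n)"
      if "\<And>n. xn n \<in> M" "\<And>n. un n \<in> \<Omega>" "\<And>n. (xn n, un n) \<in> Vk" "xn \<longlonglongrightarrow> xs" "un \<longlonglongrightarrow> us" "vn \<longlonglongrightarrow> v"
        "\<And>n t. t \<in> tangent_space M (xn n) \<Longrightarrow> vn n \<bullet> t = k' (xn n, un n) (t, 0)" for xn un and vn :: "nat \<Rightarrow> 'x"
      by (rule problem.identification[OF assms(4,5) k(1,2) k'(1) C1_map_on_imp_continuous_on[OF k'(2)] k(4) v that])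
  qed (use assms chart alpha k k' G v_def in auto)
  obtain W A where W: "open W" "(xs, us) \<in> W"
    and A: "\<And>p. p \<in> W \<Longrightarrow> ((\<lambda>p. pgd f g \<alpha> (fst p) (snd p)) has_derivative A p) (at p)"
    and A_tangent: "\<And>p h. p \<in> W \<Longrightarrow> A p h \<in> tangent_space M (pgd f g \<alpha> (fst p) (snd p))"
    and eig: "\<And>x u m. (x, u) \<in> W \<Longrightarrow> x \<in> M \<Longrightarrow>
      complex_eigenvalue (Dz_apgd f g \<alpha> \<beta> (x, x) u \<circ> tproj2 M (x, x)) m \<Longrightarrow> cmod m < 1"
    by (rule pgd.local_eigenvalue_bound) (rule that)
  have U: "open U" "us \<in> U" "U \<subseteq> \<Omega>" "C1_map_on U \<psi>" "\<psi> ` U \<subseteq> M" "\<psi> us = xs"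
    and ND: "\<And>u. u \<in> U \<Longrightarrow> ND f g (\<psi> u) u"
    using assms(15) unfolding local_solution_map_def by blast+
  let ?C = "\<lambda>x u. (\<lambda>(z, u). apgd f g \<alpha> \<beta> z u) differentiable (at ((x, x), u)) \<and>
       bij (\<lambda>v. v - Dz_apgd f g \<alpha> \<beta> (x, x) u (tproj2 M (x, x) v)) \<and>
       (\<forall>du zhat.
          (\<forall>k. zhat (Suc k) =
                 Dz_tangent f g M \<alpha> \<beta> (x, x) u (zhat k) + Du_apgd f g \<alpha> \<beta> (x, x) u du) \<longrightarrow>
          converges_linearly zhat (phi f g M \<alpha> \<beta> (x, x) u du)
            (spec_radius (Dz_apgd f g \<alpha> \<beta> (x, x) u \<circ> tproj2 M (x, x)))) \<and>
       (x = \<psi> u \<longrightarrow>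
         (\<forall>du zhat.
            (\<forall>k. zhat (Suc k) =
                   Dz_apgd f g \<alpha> \<beta> (x, x) u (zhat k) + Du_apgd f g \<alpha> \<beta> (x, x) u du) \<longrightarrow>
            converges_linearly zhat (phi f g M \<alpha> \<beta> (x, x) u du)
              (spec_radius (Dz_apgd f g \<alpha> \<beta> (x, x) u \<circ> tproj2 M (x, x)))))"
  have main: "?C x u"
    if x: "x \<in> M" and xu: "(x, u) \<in> W" and u: "u \<in> U" for x u
  proof -
    let ?D = "Dz_apgd f g \<alpha> \<beta> (x, x) u" and ?T = "Dz_apgd f g \<alpha> \<beta> (x, x) u \<circ> tproj2 M (x, x)"
    note der = apgd_derivatives[OF A[OF xu]]
    have subT: "subspace (tangent_space M x)" by (rule pgd.subspace_T[OF x])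
    have lT: "linear ?T" by (rule linear_compose[OF linear_tproj2[OF subT] der(5)])
    have rho: "spec_radius ?T < 1" using eig[OF xu x] spec_radius_less_iff[OF lT, of 1] by blast
    have phi_eq: "phi f g M \<alpha> \<beta> (x, x) u du = inv (\<lambda>v. v - ?T v) (Du_apgd f g \<alpha> \<beta> (x, x) u du)" for du
      by (simp add: phi_def)
    have "bij (\<lambda>v. v - ?D (tproj2 M (x, x) v))"
      using bij_id_minus[OF lT rho] by simp
    moreover have "converges_linearly zhat (phi f g M \<alpha> \<beta> (x, x) u du) (spec_radius ?T)"
      if "\<And>k. zhat (Suc k) = Dz_tangent f g M \<alpha> \<beta> (x, x) u (zhat k) + Du_apgd f g \<alpha> \<beta> (x, x) u du" for du zhat
      unfolding phi_eq
      by (rule linear_recursion_converges_linearly[OF lT rho, where m = 0]) (simp add: that Dz_tangent_def)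
    moreover have "converges_linearly zhat (phi f g M \<alpha> \<beta> (x, x) u du) (spec_radius ?T)"
      if x_eq: "x = \<psi> u" and rec: "\<And>k. zhat (Suc k) = ?D (zhat k) + Du_apgd f g \<alpha> \<beta> (x, x) u du" for du zhat
    proof -
      have "u \<in> \<Omega>" using u U(3) by blast
      \<comment> \<open>Nondegeneracy persists along \<psi>, so \<open>\<psi> u\<close> is a fixed
        point of the step, and the image of the step has the same tangent space as
        \<open>x\<close>.\<close>
      have "0 \<in> convex_subdiff (objective f g u) x"
        using ND[OF u] rel_interior_subset unfolding ND_def x_eq by blast
      then obtain y where y: "y \<in> convex_subdiff (\<lambda>x. g (x, u)) x" "0 = G (x, u) + y"
        unfolding convex_subdiff_objective[where f = f and g = g, OF conv_f[OF \<open>u \<in> \<Omega>\<close>] conv_g[OF \<open>u \<in> \<Omega>\<close>] G(2)]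
        by blast
      have "y = - G (x, u)" using y(2) by (simp add: eq_neg_iff_add_eq_0 add.commute)
      then have fixed: "pgd f g \<alpha> x u = x"
        unfolding pgd_def G(3) by (intro prox_eqI alpha(1)) (use alpha(1) y(1) in simp)
      have AT: "A (x, u) h \<in> tangent_space M x" for h using A_tangent[OF xu] fixed by simp
      have D_eq: "?D p + Du_apgd f g \<alpha> \<beta> (x, x) u du
          = (A (x, u) ((1 + \<beta>) *\<^sub>R fst p - \<beta> *\<^sub>R snd p, 0) + A (x, u) (0, du), fst p)" for p
        using der(2)[where a = "fst p" and b = "snd p"] der(3) by simp
      \<comment> \<open>Each new first component is a sum of two values of \<open>A\<close> and
        hence tangent; the second component is its copy one step later. From index 2 on the
        projection acts as the identity on the iterates.\<close>
      have fst_T: "fst (zhat (Suc k)) \<in> tangent_space M x" for k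
        unfolding rec D_eq using subspace_add[OF subT AT AT] by simp
      have snd_T: "snd (zhat (Suc (Suc k))) \<in> tangent_space M x" for k
        unfolding rec[of "Suc k"] D_eq using fst_T by simp
      have "zhat (Suc k) = ?T (zhat k) + Du_apgd f g \<alpha> \<beta> (x, x) u du" if "k \<ge> 2" for k
      proof -
        have j: "k = Suc (Suc (k - 2))" using that by simp
        have "tproj2 M (x, x) (zhat k) = zhat k"
          using fst_T[of "Suc (k - 2)"] snd_T[of "k - 2"]
          unfolding j[symmetric] by (simp add: tproj2_def tproj_def closest_point_self)
        then show ?thesis using rec[of k] by simp
      qed
      then show ?thesis unfolding phi_eq by (rule linear_recursion_converges_linearly[OF lT rho])
    qed
    ultimately show ?thesis using der(1) by blast
  qed
  \<comment> \<open>These are the parameters whose solution point lies in the neighbourhood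
    \<open>W\<close>; for each of them the slice of \<open>W\<close> gives the radius.\<close>
  define V where "V = (\<lambda>u. (\<psi> u, u)) -` W \<inter> U"
  show ?thesis
  proof (intro exI[of _ V] conjI ballI)
    have "continuous_on U (\<lambda>u. (\<psi> u, u))"
      by (intro continuous_intros C1_map_on_imp_continuous_on U(4))
    then show "open V" unfolding V_def using continuous_on_open_vimage[OF U(1)] W(1) by blast
    show "us \<in> V" "V \<subseteq> U" using U W by (auto simp: V_def)
    fix u assume "u \<in> V"
    then have u: "u \<in> U" "(\<psi> u, u) \<in> W" by (auto simp: V_def)
    have "open ((\<lambda>x. (x, u)) -` W)" by (intro open_vimage W continuous_intros)
    moreover have "\<psi> u \<in> (\<lambda>x. (x, u)) -` W" using u by simp
    ultimately obtain \<epsilon> where \<epsilon>: "\<epsilon> > 0" "ball (\<psi> u) \<epsilon> \<subseteq> (\<lambda>x. (x, u)) -` W" by (rule openE)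
    have "(x, u) \<in> W" if "dist x (\<psi> u) < \<epsilon>" for x
      using subsetD[OF \<epsilon>(2), of x] that by (simp add: dist_commute)
    then show "\<exists>\<epsilon>>0. \<forall>x\<in>M. dist x (\<psi> u) < \<epsilon> \<longrightarrow> ?C x u"
      using \<epsilon>(1) main[OF _ _ u(1)] by (intro exI[of _ \<epsilon>] conjI[OF \<epsilon>(1)] ballI impI) blast
  qed
qed

end
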